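(* Let $R=\bigoplus_{\alpha\in\Gamma}R_{\alpha}$ be a graded domain with a unique maximal homogeneous ideal. The following are equivalent: (1) $R$ is a gGD domain. (2) There is a homogeneous overring $T$ of $R$ such that $T$ is a graded divided domain and the extension $R\subseteq T$ is integral and homogeneous unibranched. (3) There is an extension of graded domains $R\subseteq T$ such that $T$ is a graded divided domain and $R\subseteq T$ is integral and homogeneous unibranched.
   Context: All rings are commutative with identity. $\Gamma$ is a nonzero torsionless commutative cancellative monoid, written additively (torsionless is equivalent to the existence of a total order compatible with the monoid operation), with quotient group $\langle\Gamma\rangle$. A graded domain $R=\bigoplus_{\alpha\in\Gamma}R_\alpha$ is an integral domain graded by such a monoid; $H=\bigcup_{\alpha\in\Gamma}(R_\alpha\setminus\{0\})$ is its set of nonzero homogeneous elements. The homogeneous quotient field $R_H$ is graded by $\langle\Gamma\rangle$ via $\deg(a/b)=\deg(a)-\deg(b)$. A homogeneous overring of $R$ is a ring $T$ with $R\subseteq T\subseteq R_H$ and $T=\bigoplus_{\alpha\in\langle\Gamma\rangle}(T\cap(R_H)_\alpha)$; it is a $\langle\Gamma\rangle$-graded domain. An ideal is homogeneous if it is generated by homogeneous elements; $\operatorname{Spec}_h(R)$ is the set of homogeneous prime ideals; a maximal homogeneous ideal is an ideal maximal among proper homogeneous ideals. An extension of graded domains $R\subseteq T$ means: $R$ is $\Gamma$-graded, $T=\bigoplus_{\alpha\in\Lambda}T_\alpha$ is a graded domain graded by a torsionless commutative cancellative monoid $\Lambda$, $R$ is a subring of $T$, $\Gamma$ is a subsemigroup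 of $\Lambda$, and $R_\alpha\subseteq T_\alpha$ for all $\alpha\in\Gamma$. It satisfies gGD (graded going-down) if, whenever $P_0\subseteq P$ are homogeneous prime ideals of $R$ and $Q$ is a homogeneous prime ideal of $T$ with $Q\cap R=P$, there is a homogeneous prime ideal $Q_0$ of $T$ with $Q_0\subseteq Q$ and $Q_0\cap R=P_0$. $R$ is a gGD domain if $R\subseteq T$ satisfies gGD for every homogeneous overring $T$ of $R$. An extension of graded domains $R\subseteq T$ is homogeneous unibranched if the contraction map $\operatorname{Spec}_h(T)\to\operatorname{Spec}_h(R)$, $Q\mapsto Q\cap R$, is a bijection. A homogeneous prime ideal $P$ of a graded domain is homogeneous divided if each nonzero homogeneous element not in $P$ divides each homogeneous element of $P$ (equivalently, $P$ is comparable under inclusion to each homogeneous ideal). A graded domain is graded divided if each of its homogeneous prime ideals is homogeneous divided. *)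

theory Defs
  imports
    "HOL-Algebra.Subrings"
    "HOL-Algebra.Divisibility"
    "HOL-Computational_Algebra.Polynomial"
begin

text \<open>
  A graded ring is given by a subset \<^term>\<open>elts\<close> of a commutative ring type, a set \<^term>\<open>degs\<close> of
  degrees in a commutative monoid type, and a family \<^term>\<open>part\<close> of homogeneous components. Only the
  values of \<^term>\<open>part\<close> on \<^term>\<open>degs\<close> matter.
\<close>

record ('a, 'g) graded =
  elts :: "'a set"
  degs :: "'g set"
  part :: "'g \<Rightarrow> 'a set"

text \<open>The underlying ring, as a structure to which the notions of HOL-Algebra apply.\<close>

definition ring_of :: "('a::comm_ring_1, 'g) graded \<Rightarrow> 'a ring" where
  "ring_of R = \<lparr>carrier = elts R, monoid.mult = (*), one = 1, zero = 0, add = (+)\<rparr>"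

text \<open>
  Nonzero torsionless commutative cancellative monoids; the sum over \<open>i < n\<close> is the multiple \<open>n\<alpha>\<close>.
\<close>

definition grading_monoid :: "'g::comm_monoid_add set \<Rightarrow> bool" where
  "grading_monoid \<Gamma> \<longleftrightarrow>
     0 \<in> \<Gamma> \<and> \<Gamma> \<noteq> {0} \<and>
     (\<forall>\<alpha>\<in>\<Gamma>. \<forall>\<beta>\<in>\<Gamma>. \<alpha> + \<beta> \<in> \<Gamma>) \<and>
     (\<forall>\<alpha>\<in>\<Gamma>. \<forall>\<beta>\<in>\<Gamma>. \<forall>\<gamma>\<in>\<Gamma>. \<alpha> + \<gamma> = \<beta> + \<gamma> \<longrightarrow> \<alpha> = \<beta>) \<and>
     (\<forall>n::nat. \<forall>\<alpha>\<in>\<Gamma>. \<forall>\<beta>\<in>\<Gamma>. n > 0 \<and> (\<Sum>i<n. \<alpha>) = (\<Sum>i<n. \<beta>) \<longrightarrow> \<alpha> = \<beta>)"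

text \<open>\<open>c\<close> is the family of homogeneous components of \<open>x\<close>, extended by \<open>0\<close> outside \<^term>\<open>degs R\<close>.\<close>

definition is_decomposition ::
  "('a::comm_ring_1, 'g) graded \<Rightarrow> 'a \<Rightarrow> ('g \<Rightarrow> 'a) \<Rightarrow> bool" where
  "is_decomposition R x c \<longleftrightarrow>
     (\<forall>\<alpha>\<in>degs R. c \<alpha> \<in> part R \<alpha>) \<and> (\<forall>\<alpha>. \<alpha> \<notin> degs R \<longrightarrow> c \<alpha> = 0) \<and>
     finite {\<alpha>. c \<alpha> \<noteq> 0} \<and> x = (\<Sum>\<alpha> | c \<alpha> \<noteq> 0. c \<alpha>)"

definition graded_domain :: "('a::comm_ring_1, 'g::comm_monoid_add) graded \<Rightarrow> bool" where
  "graded_domain R \<longleftrightarrow>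
     domain (ring_of R) \<and> grading_monoid (degs R) \<and>
     (\<forall>\<alpha>\<in>degs R. additive_subgroup (part R \<alpha>) (ring_of R)) \<and>
     (\<forall>\<alpha>\<in>degs R. \<forall>\<beta>\<in>degs R. \<forall>a\<in>part R \<alpha>. \<forall>b\<in>part R \<beta>. a * b \<in> part R (\<alpha> + \<beta>)) \<and>
     (\<forall>x\<in>elts R. \<exists>!c. is_decomposition R x c)"

definition homog :: "('a::comm_ring_1, 'g) graded \<Rightarrow> 'a set" where
  "homog R = (\<Union>\<alpha>\<in>degs R. part R \<alpha>)"

text \<open>The set \<open>H\<close> of nonzero homogeneous elements.\<close>

definition nz_homog :: "('a::comm_ring_1, 'g) graded \<Rightarrow> 'a set" where
  "nz_homog R = homog R - {0}"

definition homogeneous_ideal :: "('a::comm_ring_1, 'g) graded \<Rightarrow> 'a set \<Rightarrow> bool" where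
  "homogeneous_ideal R I \<longleftrightarrow>
     ideal I (ring_of R) \<and> (\<exists>S\<subseteq>homog R. I = genideal (ring_of R) S)"

definition spec_h :: "('a::comm_ring_1, 'g) graded \<Rightarrow> 'a set set" where
  "spec_h R = {P. primeideal P (ring_of R) \<and> homogeneous_ideal R P}"

definition maximal_homogeneous_ideal :: "('a::comm_ring_1, 'g) graded \<Rightarrow> 'a set \<Rightarrow> bool" where
  "maximal_homogeneous_ideal R M \<longleftrightarrow>
     homogeneous_ideal R M \<and> M \<noteq> elts R \<and>
     (\<forall>J. homogeneous_ideal R J \<and> J \<noteq> elts R \<and> M \<subseteq> J \<longrightarrow> J = M)"

text \<open>
  The homogeneous quotient field \<open>R\<^sub>H\<close>, formed inside an ambient field containing \<open>R\<close>, graded by the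
  quotient group of \<^term>\<open>degs R\<close>. The degree of \<open>a / b\<close> is defined for nonzero \<open>a\<close> only, so \<open>0\<close> is
  added to each component separately: there may be degrees in which no nonzero fraction exists.
\<close>

definition hquot :: "('a::field, 'g::ab_group_add) graded \<Rightarrow> ('a, 'g) graded" where
  "hquot R =
     \<lparr>elts = {a / b | a b. a \<in> elts R \<and> b \<in> nz_homog R},
      degs = {\<alpha> - \<beta> | \<alpha> \<beta>. \<alpha> \<in> degs R \<and> \<beta> \<in> degs R},
      part = (\<lambda>\<gamma>. insert 0 {a / b | a b. \<exists>\<alpha>\<in>degs R. \<exists>\<beta>\<in>degs R.
                 a \<in> part R \<alpha> - {0} \<and> b \<in> part R \<beta> - {0} \<and> \<gamma> = \<alpha> - \<beta>})\<rparr>"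

definition homogeneous_overring ::
  "('a::field, 'g::ab_group_add) graded \<Rightarrow> ('a, 'g) graded \<Rightarrow> bool" where
  "homogeneous_overring R T \<longleftrightarrow>
     subring (elts T) (ring_of (hquot R)) \<and> elts R \<subseteq> elts T \<and>
     degs T = degs (hquot R) \<and> part T = (\<lambda>\<alpha>. elts T \<inter> part (hquot R) \<alpha>) \<and>
     (\<forall>x\<in>elts T. \<exists>!c. is_decomposition T x c)"

definition graded_extension ::
  "('a::comm_ring_1, 'g::comm_monoid_add) graded \<Rightarrow> ('a, 'g) graded \<Rightarrow> bool" where
  "graded_extension R T \<longleftrightarrow>
     graded_domain R \<and> graded_domain T \<and> subring (elts R) (ring_of T) \<and>
     degs R \<subseteq> degs T \<and> (\<forall>\<alpha>\<in>degs R. part R \<alpha> \<subseteq> part T \<alpha>)"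

definition gGD :: "('a::comm_ring_1, 'g) graded \<Rightarrow> ('a, 'g) graded \<Rightarrow> bool" where
  "gGD R T \<longleftrightarrow>
     (\<forall>P\<^sub>0\<in>spec_h R. \<forall>P\<in>spec_h R. \<forall>Q\<in>spec_h T. P\<^sub>0 \<subseteq> P \<and> Q \<inter> elts R = P \<longrightarrow>
        (\<exists>Q\<^sub>0\<in>spec_h T. Q\<^sub>0 \<subseteq> Q \<and> Q\<^sub>0 \<inter> elts R = P\<^sub>0))"

definition gGD_domain :: "('a::field, 'g::ab_group_add) graded \<Rightarrow> bool" where
  "gGD_domain R \<longleftrightarrow> graded_domain R \<and> (\<forall>T. homogeneous_overring R T \<longrightarrow> gGD R T)"

definition integral_extension :: "('a::comm_ring_1, 'g) graded \<Rightarrow> ('a, 'g) graded \<Rightarrow> bool" where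
  "integral_extension R T \<longleftrightarrow>
     (\<forall>t\<in>elts T. \<exists>p. lead_coeff p = 1 \<and> (\<forall>i. coeff p i \<in> elts R) \<and> poly p t = 0)"

definition homogeneous_unibranched ::
  "('a::comm_ring_1, 'g) graded \<Rightarrow> ('a, 'g) graded \<Rightarrow> bool" where
  "homogeneous_unibranched R T \<longleftrightarrow> bij_betw (\<lambda>Q. Q \<inter> elts R) (spec_h T) (spec_h R)"

definition homogeneous_divided :: "('a::comm_ring_1, 'g) graded \<Rightarrow> 'a set \<Rightarrow> bool" where
  "homogeneous_divided R P \<longleftrightarrow>
     (\<forall>a\<in>nz_homog R - P. \<forall>b\<in>homog R \<inter> P. a divides\<^bsub>ring_of R\<^esub> b)"

definition graded_divided :: "('a::comm_ring_1, 'g::comm_monoid_add) graded \<Rightarrow> bool" where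
  "graded_divided R \<longleftrightarrow> graded_domain R \<and> (\<forall>P\<in>spec_h R. homogeneous_divided R P)"

definition graded_isomorphic ::
  "('a::comm_ring_1, 'g::comm_monoid_add) graded \<Rightarrow>
   ('b::comm_ring_1, 'l::comm_monoid_add) graded \<Rightarrow> bool" where
  "graded_isomorphic R S \<longleftrightarrow>
     (\<exists>\<phi> \<psi>. \<phi> \<in> ring_iso (ring_of R) (ring_of S) \<and>
        bij_betw \<psi> (degs R) (degs S) \<and>
        (\<forall>\<alpha>\<in>degs R. \<forall>\<beta>\<in>degs R. \<psi> (\<alpha> + \<beta>) = \<psi> \<alpha> + \<psi> \<beta>) \<and>
        (\<forall>\<alpha>\<in>degs R. part S (\<psi> \<alpha>) = \<phi> ` part R \<alpha>))"

text \<open>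
  Existence of an extension \<open>R \<subseteq> T\<close> as a graded divided, integral, homogeneous unibranched extension
  with \<open>T\<close> living in the types given by the second argument. Since these types need not be those of
  \<open>R\<close>, the inclusion is that of an isomorphic copy \<open>R'\<close> of \<open>R\<close>. No type can range over all extensions,
  so ``there is an extension'' means: there are types for which this predicate holds.
\<close>

definition has_divided_extension ::
  "('a::comm_ring_1, 'g::comm_monoid_add) graded \<Rightarrow>
   ('b::comm_ring_1, 'l::comm_monoid_add) graded itself \<Rightarrow> bool" where
  "has_divided_extension R U \<longleftrightarrow>
     (\<exists>(R'::('b, 'l) graded) (T::('b, 'l) graded).
        graded_isomorphic R R' \<and> graded_extension R' T \<and> graded_divided T \<and>
        integral_extension R' T \<and> homogeneous_unibranched R' T)"

end

theory Submission
  imports Defs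
begin

text \<open>
  Everything rests on one observation: in the situation of the theorem, a fraction \<open>p / a\<close>, with \<open>p\<close> a
  homogeneous element of a homogeneous prime \<open>P\<close> and \<open>a\<close> a homogeneous element outside \<open>P\<close>, is integral
  over \<open>R\<close>. Going-down forces this, and a divided integral unibranched extension provides it.

  From an extension to going-down. If \<open>T\<close> is divided and \<open>Q\<close> is the prime of \<open>T\<close> over \<open>P\<close>, then \<open>a\<close>
  divides \<open>p\<close> in \<open>T\<close>, say \<open>p = a m\<close>, and \<open>m\<close> lies in \<open>Q\<close>. Homogeneous primes of a divided domain are
  comparable, and \<open>Q\<close> is the only one over \<open>P\<close>, so \<open>Q\<close> is the smallest homogeneous prime of \<open>T\<close>
  containing \<open>P\<close>. Hence \<open>m\<close> is nilpotent modulo the ideal of elements that are integral over the ideal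
  \<open>P\<close>, and so \<open>m\<close> itself satisfies a monic equation whose lower coefficients lie in \<open>P\<close>
  (\<open>divided_extension_integrally_divided\<close>). Clearing denominators gives an equation in \<open>R\<close> between \<open>p\<close>
  and \<open>a\<close>, which no longer mentions \<open>T\<close> and is transported along isomorphisms. Now let \<open>T\<close> be a
  homogeneous overring, \<open>P\<^sub>0 \<subseteq> P\<close> primes of \<open>R\<close> and \<open>Q\<close> a prime of \<open>T\<close> over \<open>P\<close>. The required prime
  below \<open>Q\<close> over \<open>P\<^sub>0\<close> exists unless some product \<open>a q\<close>, with \<open>a\<close> in \<open>R\<close> outside \<open>P\<^sub>0\<close> and \<open>q\<close> in \<open>T\<close>
  outside \<open>Q\<close>, lies in \<open>P\<^sub>0 T\<close>. But then \<open>q\<close> is a combination of fractions \<open>p / a\<close> with \<open>p\<close> in \<open>P\<^sub>0\<close>, hence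
  integral over the ideal \<open>Q\<close>, hence in \<open>Q\<close> (\<open>integrally_divided_gGD\<close>).

  From going-down to an overring. Put \<open>y = a / p\<close> and let \<open>M\<close> be the maximal homogeneous ideal. If
  \<open>p / a\<close> is not integral, then \<open>M\<close> and \<open>y\<close> generate a proper ideal of \<open>R[y]\<close>, so some homogeneous prime
  contains both; going down to \<open>P\<close> gives a prime over \<open>P\<close> that contains \<open>y p = a\<close>, which is absurd
  (\<open>gGD_quotient_integral\<close>). In particular the homogeneous primes of \<open>R\<close> form a chain
  (\<open>gGD_spec_chain\<close>). Let \<open>T\<close> be spanned by the homogeneous \<open>x\<close> integral over \<open>R\<close> such that for each
  \<open>P\<close> there are \<open>s\<close> outside \<open>P\<close> and \<open>r\<close> in \<open>R\<close> with \<open>s x - r\<close> integral over the ideal \<open>P\<close>. Whether such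
  an \<open>x\<close> lies in a prime over \<open>P\<close> is decided by whether \<open>r\<close> lies in \<open>P\<close>, so \<open>T\<close> is unibranched; and
  going-down shows that \<open>T\<close> contains the quotients demanded of a divided domain
  (\<open>gGD_divided_overring\<close>).

  Two tools serve both halves. Integrality over an ideal is closed under sums and under products with
  integral elements. Homogeneous primes are obtained as the homogeneous parts of ordinary primes; that
  such a part is again prime is where the torsionless grading enters (\<open>homogeneous_prime_exists\<close>).
\<close>

section \<open>Additive spans, subrings and ideals\<close>

text \<open>
  The additive submonoid generated by a set, inductively rather than by indexed sums: ideal generation,
  generation by homogeneous elements and monic equations all become membership in such spans, and
  closure properties are proved by induction. When \<open>X\<close> is closed under negation this is the generated
  subgroup.
\<close>

inductive_set aspan :: "'a::comm_monoid_add set \<Rightarrow> 'a set" for X where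
  aspan_0: "0 \<in> aspan X"
| aspan_step: "x \<in> X \<Longrightarrow> y \<in> aspan X \<Longrightarrow> x + y \<in> aspan X"

lemma aspan_base: "x \<in> X \<Longrightarrow> x \<in> aspan X"
  using aspan_step[OF _ aspan_0] by fastforce

lemma aspan_empty: "aspan {} = {0}"
  by (auto intro: aspan_0 elim: aspan.cases)

lemma aspan_add: "x \<in> aspan X \<Longrightarrow> y \<in> aspan X \<Longrightarrow> x + y \<in> aspan X"
  by (induction x rule: aspan.induct) (auto simp: add.assoc intro: aspan.intros)

lemma aspan_sum: "(\<And>i. i \<in> A \<Longrightarrow> f i \<in> aspan X) \<Longrightarrow> sum f A \<in> aspan X"
  by (induction A rule: infinite_finite_induct) (auto intro: aspan_0 aspan_add)

lemma aspan_least: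
  assumes "x \<in> aspan X" "X \<subseteq> B" "0 \<in> B" "\<And>x y. x \<in> B \<Longrightarrow> y \<in> B \<Longrightarrow> x + y \<in> B"
  shows "x \<in> B"
  using assms(1) by induction (use assms(2-) in auto)

lemma aspan_mono: "X \<subseteq> Y \<Longrightarrow> aspan X \<subseteq> aspan Y"
  using aspan_least[of _ X "aspan Y"] by (blast intro: aspan_base aspan_0 aspan_add)

lemma aspan_mult:
  fixes a :: "'a::comm_ring_1"
  assumes "x \<in> aspan X" "\<And>x. x \<in> X \<Longrightarrow> a * x \<in> aspan Y"
  shows "a * x \<in> aspan Y"
  using assms(1) by induction (auto simp: distrib_left intro: aspan_0 aspan_add assms(2))

lemma aspan_mult_closed:
  fixes X :: "'a::comm_ring_1 set"
  assumes X: "\<And>x y. x \<in> X \<Longrightarrow> y \<in> X \<Longrightarrow> x * y \<in> X"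
    and x: "x \<in> aspan X" and y: "y \<in> aspan X"
  shows "x * y \<in> aspan X"
proof -
  have "y * a \<in> aspan X" if "a \<in> X" for a
    using aspan_mult[OF y, of a X] X that by (simp add: mult.commute aspan_base)
  then show ?thesis
    using aspan_mult[OF x, of y X] by (simp add: mult.commute)
qed

lemma aspan_uminus:
  fixes X :: "'a::comm_ring_1 set"
  assumes "x \<in> aspan X" "\<And>x. x \<in> X \<Longrightarrow> - x \<in> X"
  shows "- x \<in> aspan X"
  using aspan_mult[OF assms(1), of "-1" X] assms(2) by (simp add: aspan_base)

definition is_subring :: "'a::comm_ring_1 set \<Rightarrow> bool" where
  "is_subring A \<longleftrightarrow> 1 \<in> A \<and> (\<forall>x\<in>A. \<forall>y\<in>A. x - y \<in> A) \<and> (\<forall>x\<in>A. \<forall>y\<in>A. x * y \<in> A)"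

definition is_ideal :: "'a::comm_ring_1 set \<Rightarrow> 'a set \<Rightarrow> bool" where
  "is_ideal A I \<longleftrightarrow>
     I \<subseteq> A \<and> 0 \<in> I \<and> (\<forall>x\<in>I. \<forall>y\<in>I. x + y \<in> I) \<and> (\<forall>a\<in>A. \<forall>x\<in>I. a * x \<in> I)"

lemma subring_1: "is_subring A \<Longrightarrow> 1 \<in> A"
  and subring_diff: "is_subring A \<Longrightarrow> x \<in> A \<Longrightarrow> y \<in> A \<Longrightarrow> x - y \<in> A"
  and subring_mult: "is_subring A \<Longrightarrow> x \<in> A \<Longrightarrow> y \<in> A \<Longrightarrow> x * y \<in> A"
  by (auto simp: is_subring_def)

lemma subring_0: "is_subring A \<Longrightarrow> 0 \<in> A"
  using subring_diff[of A 1 1] by (simp add: subring_1)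

lemma subring_uminus: "is_subring A \<Longrightarrow> x \<in> A \<Longrightarrow> - x \<in> A"
  using subring_diff[of A 0 x] by (simp add: subring_0)

lemma subring_add: "is_subring A \<Longrightarrow> x \<in> A \<Longrightarrow> y \<in> A \<Longrightarrow> x + y \<in> A"
  using subring_diff[of A x "- y"] by (simp add: subring_uminus)

lemma subring_sum: "is_subring A \<Longrightarrow> (\<And>i. i \<in> F \<Longrightarrow> f i \<in> A) \<Longrightarrow> sum f F \<in> A"
  by (induction F rule: infinite_finite_induct) (auto intro: subring_0 subring_add)

lemma subring_power: "is_subring A \<Longrightarrow> x \<in> A \<Longrightarrow> x ^ n \<in> A"
  by (induction n) (auto intro: subring_1 subring_mult)

lemma subring_aspan: "is_subring A \<Longrightarrow> X \<subseteq> A \<Longrightarrow> aspan X \<subseteq> A"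
  using aspan_least[of _ X A] by (blast intro: subring_0 subring_add)

lemma ideal_subset: "is_ideal A I \<Longrightarrow> x \<in> I \<Longrightarrow> x \<in> A"
  and ideal_0: "is_ideal A I \<Longrightarrow> 0 \<in> I"
  and ideal_add: "is_ideal A I \<Longrightarrow> x \<in> I \<Longrightarrow> y \<in> I \<Longrightarrow> x + y \<in> I"
  and ideal_mult: "is_ideal A I \<Longrightarrow> a \<in> A \<Longrightarrow> x \<in> I \<Longrightarrow> a * x \<in> I"
  by (auto simp: is_ideal_def)

lemma ideal_uminus: "is_subring A \<Longrightarrow> is_ideal A I \<Longrightarrow> x \<in> I \<Longrightarrow> - x \<in> I"
  using ideal_mult[of A I "-1" x] by (simp add: subring_1 subring_uminus)

lemma ideal_diff: "is_subring A \<Longrightarrow> is_ideal A I \<Longrightarrow> x \<in> I \<Longrightarrow> y \<in> I \<Longrightarrow> x - y \<in> I"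
  using ideal_add[of A I x "- y"] by (simp add: ideal_uminus)

lemma ideal_sum: "is_ideal A I \<Longrightarrow> (\<And>i. i \<in> F \<Longrightarrow> f i \<in> I) \<Longrightarrow> sum f F \<in> I"
  by (induction F rule: infinite_finite_induct) (auto intro: ideal_0 ideal_add)

lemma ideal_aspan: "is_ideal A I \<Longrightarrow> X \<subseteq> I \<Longrightarrow> aspan X \<subseteq> I"
  using aspan_least[of _ X I] by (blast intro: ideal_0 ideal_add)

lemma ideal_self: "is_subring A \<Longrightarrow> is_ideal A A"
  by (auto simp: is_ideal_def intro: subring_0 subring_add subring_mult)

section \<open>Integrality over an ideal\<close>

text \<open>
  An equation \<open>z^n = c\<^sub>n\<^sub>-\<^sub>1 z^(n-1) + \<dots> + c\<^sub>0\<close> with all coefficients in \<open>I\<close>. For a subring \<open>I\<close> this is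
  integrality in the usual sense; for an ideal it is integrality over an ideal in the weak sense of
  Atiyah and Macdonald, where coefficients are taken from \<open>I\<close> and not from its powers. The exponent \<open>0\<close>
  is harmless, since the span is then zero.
\<close>

definition integral_over :: "'a::comm_ring_1 set \<Rightarrow> 'a \<Rightarrow> bool" where
  "integral_over I z \<longleftrightarrow> (\<exists>n. z ^ n \<in> aspan {c * z ^ i | c i. c \<in> I \<and> i < n})"

lemma integral_over_mono: "integral_over I z \<Longrightarrow> I \<subseteq> J \<Longrightarrow> integral_over J z"
proof -
  assume "integral_over I z" "I \<subseteq> J"
  moreover have "aspan {c * z ^ i | c i. c \<in> I \<and> i < n} \<subseteq> aspan {c * z ^ i | c i. c \<in> J \<and> i < n}"
    for n by (rule aspan_mono) (use \<open>I \<subseteq> J\<close> in auto)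
  ultimately show ?thesis unfolding integral_over_def by blast
qed

lemma integral_over_self: "x \<in> I \<Longrightarrow> integral_over I x"
  unfolding integral_over_def by (intro exI[of _ 1]) (force intro!: aspan_base)

lemma integral_over_root:
  assumes "integral_over I (z ^ N)" "N > 0"
  shows "integral_over I z"
proof -
  obtain n where n: "(z ^ N) ^ n \<in> aspan {c * (z ^ N) ^ i | c i. c \<in> I \<and> i < n}"
    using assms unfolding integral_over_def by blast
  have "{c * (z ^ N) ^ i | c i. c \<in> I \<and> i < n} \<subseteq> {c * z ^ k | c k. c \<in> I \<and> k < N * n}"
    using \<open>N > 0\<close> by (force simp flip: power_mult)
  then have "z ^ (N * n) \<in> aspan {c * z ^ k | c k. c \<in> I \<and> k < N * n}"
    using n aspan_mono[of "{c * (z ^ N) ^ i | c i. c \<in> I \<and> i < n}"] unfolding power_mult by blast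
  then show ?thesis unfolding integral_over_def by blast
qed

text \<open>
  The polynomials that may be added to \<open>X^d\<close> to form a monic polynomial of degree \<open>d\<close> with all lower
  coefficients in \<open>I\<close>.
\<close>

definition low_poly :: "'a::comm_ring_1 set \<Rightarrow> nat \<Rightarrow> 'a poly \<Rightarrow> bool" where
  "low_poly I d p \<longleftrightarrow> (\<forall>k. coeff p k \<in> I) \<and> (\<forall>k\<ge>d. coeff p k = 0)"

lemma low_poly_mult:
  assumes "is_ideal A I" "low_poly I d p" "low_poly I e q"
  shows "low_poly I (d + e) (p * q)"
  unfolding low_poly_def coeff_mult
proof (intro conjI allI impI)
  fix k
  show "(\<Sum>i\<le>k. coeff p i * coeff q (k - i)) \<in> I"
    using assms by (auto intro!: ideal_sum[of A] ideal_mult[of A] ideal_subset[of A I]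
        simp: low_poly_def)
next
  fix k assume k: "k \<ge> d + e"
  show "(\<Sum>i\<le>k. coeff p i * coeff q (k - i)) = 0"
  proof (rule sum.neutral, intro ballI)
    fix i
    have "i \<ge> d \<or> k - i \<ge> e" using k by linarith
    then show "coeff p i * coeff q (k - i) = 0"
      using assms(2,3) by (auto simp: low_poly_def)
  qed
qed

lemma low_poly_monom_mult:
  "0 \<in> I \<Longrightarrow> low_poly I e q \<Longrightarrow> low_poly I (d + e) (monom 1 d * q)"
  by (auto simp: low_poly_def coeff_monom_mult)

lemma low_poly_add: "is_ideal A I \<Longrightarrow> low_poly I d p \<Longrightarrow> low_poly I d q \<Longrightarrow> low_poly I d (p + q)"
  by (auto simp: low_poly_def intro: ideal_add)

lemma low_poly_diff:
  "is_subring A \<Longrightarrow> is_ideal A I \<Longrightarrow> low_poly I d p \<Longrightarrow> low_poly I d q \<Longrightarrow> low_poly I d (p - q)"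
  by (auto simp: low_poly_def intro: ideal_diff)

text \<open>
  The Cayley-Hamilton argument by elimination instead of a determinant. The system has a square matrix
  of polynomials in \<open>z\<close> whose diagonal entries are monic of degree \<open>d\<close>, while the off-diagonal entries
  have smaller degree. Multiplying each row by the pivot and subtracting a multiple of the pivot row
  removes one unknown and keeps that shape with \<open>2 d\<close> in place of \<open>d\<close>.
\<close>

lemma eliminate:
  assumes A: "is_subring A" and I: "is_ideal A I" and "finite F" "i0 \<notin> F"
    and "\<forall>i\<in>insert i0 F. \<forall>j\<in>insert i0 F. low_poly I d (q i j)"
    and "\<forall>i\<in>insert i0 F. z ^ d * v i + (\<Sum>j\<in>insert i0 F. poly (q i j) z * v j) = 0"
  shows "\<exists>d' p. low_poly I d' p \<and> (z ^ d' + poly p z) * v i0 = 0"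
  using \<open>finite F\<close> assms(4-)
proof (induction F arbitrary: d q rule: finite_induct)
  case empty
  then show ?case
    by (intro exI[of _ d] exI[of _ "q i0 i0"]) (simp add: distrib_right)
next
  case (insert k F)
  define G where "G = insert i0 F"
  have G: "finite G" "k \<notin> G" "insert i0 (insert k F) = insert k G" "i0 \<notin> F"
    using insert.hyps insert.prems(1) by (auto simp: G_def)
  have low: "low_poly I d (q i j)" if "i \<in> insert k G" "j \<in> insert k G" for i j
    using insert.prems(2) that G(3) by blast
  have row: "z ^ d * v i + poly (q i k) z * v k + (\<Sum>j\<in>G. poly (q i j) z * v j) = 0"
    if "i \<in> insert k G" for i
    using bspec[OF insert.prems(3)[unfolded G(3)] that] G(1,2) by (simp add: add.assoc)
  \<comment> \<open>Entry \<open>(i, j)\<close> of pivot times row \<open>i\<close> minus \<open>q i k\<close> times row \<open>k\<close>, without the leading \<open>z ^ (d + d)\<close>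
    on the diagonal.\<close>
  define q' where "q' i j =
    (if i = j then monom 1 d * q k k else 0) + (monom 1 d * q i j + q k k * q i j - q i k * q k j)"
    for i j
  have low': "low_poly I (d + d) (q' i j)" if "i \<in> G" "j \<in> G" for i j
  proof -
    have "low_poly I (d + d) (if i = j then monom 1 d * q k k else 0)"
      using low_poly_monom_mult[OF ideal_0[OF I] low[of k k]] ideal_0[OF I]
      by (auto simp: low_poly_def)
    then show ?thesis
      unfolding q'_def using that
      by (intro low_poly_add[OF I] low_poly_diff[OF A I] low_poly_mult[OF I]
          low_poly_monom_mult[OF ideal_0[OF I]] low) auto
  qed
  have row': "z ^ (d + d) * v i + (\<Sum>j\<in>G. poly (q' i j) z * v j) = 0" if i: "i \<in> G" for i
  proof -
    define S where "S l = (\<Sum>j\<in>G. poly (q l j) z * v j)" for l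
    have "(\<Sum>j\<in>G. poly (q' i j) z * v j)
        = (\<Sum>j\<in>G. (if i = j then z ^ d * poly (q k k) z * v j else 0)
            + ((z ^ d + poly (q k k) z) * (poly (q i j) z * v j)
               - poly (q i k) z * (poly (q k j) z * v j)))"
      by (rule sum.cong) (auto simp: q'_def poly_monom algebra_simps)
    also have "\<dots> = z ^ d * poly (q k k) z * v i + ((z ^ d + poly (q k k) z) * S i - poly (q i k) z * S k)"
      using i G(1) by (simp add: sum.distrib sum_subtractf S_def sum_distrib_left)
    finally have eq: "(\<Sum>j\<in>G. poly (q' i j) z * v j) = \<dots>" .
    have Si: "S i = - (z ^ d * v i + poly (q i k) z * v k)"
      using row[of i] i unfolding S_def by (metis eq_neg_iff_add_eq_0 add.commute insertI2)
    have Sk: "S k = - (z ^ d * v k + poly (q k k) z * v k)"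
      using row[of k] unfolding S_def by (metis eq_neg_iff_add_eq_0 add.commute insertI1)
    show ?thesis unfolding eq Si Sk by (simp add: algebra_simps power_add)
  qed
  show ?case
    using insert.IH[of "d + d" q'] low' row' G(4) unfolding G_def by blast
qed

lemma aspan_combination:
  assumes "x \<in> aspan {a * v f | a f. a \<in> I \<and> f \<in> F}" "finite F" "is_ideal A I"
  shows "\<exists>b. (\<forall>f. b f \<in> I) \<and> x = (\<Sum>f\<in>F. b f * v f)"
  using assms(1)
proof induction
  case aspan_0
  then show ?case by (intro exI[of _ "\<lambda>_. 0"]) (simp add: ideal_0[OF assms(3)])
next
  case (aspan_step x y)
  then obtain a f b where *: "x = a * v f" "a \<in> I" "f \<in> F" "\<forall>f. b f \<in> I" "y = (\<Sum>f\<in>F. b f * v f)"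
    by auto
  have "x + y = (\<Sum>g\<in>F. ((if g = f then a else 0) + b g) * v g)"
    using * assms(2) by (simp add: distrib_right sum.distrib if_distrib[of "\<lambda>x. x * _"] cong: if_cong)
  moreover have "\<forall>g. (if g = f then a else 0) + b g \<in> I"
    using * ideal_add[OF assms(3)] by auto
  ultimately show ?case by (intro exI[of _ "\<lambda>g. (if g = f then a else 0) + b g"]) auto
qed

text \<open>
  If \<open>z\<close> maps the module generated by the \<open>v f\<close> into \<open>I\<close> times it and \<open>1\<close> is among the generators, then
  elimination leaves one monic equation for \<open>z\<close>, applied to \<open>1\<close>.
\<close>

lemma integral_over_finite_module:
  assumes A: "is_subring A" and I: "is_ideal A I" and F: "finite F" "f0 \<in> F" "v f0 = 1"
    and "\<And>f. f \<in> F \<Longrightarrow> z * v f \<in> aspan {a * v f | a f. a \<in> I \<and> f \<in> F}"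
  shows "integral_over I z"
proof -
  have "\<forall>f. \<exists>b. f \<in> F \<longrightarrow> (\<forall>g. b g \<in> I) \<and> z * v f = (\<Sum>g\<in>F. b g * v g)"
    using aspan_combination[OF assms(6) F(1) I] by blast
  then obtain b where b: "\<And>f g. f \<in> F \<Longrightarrow> b f g \<in> I"
    "\<And>f. f \<in> F \<Longrightarrow> z * v f = (\<Sum>g\<in>F. b f g * v g)"
    by metis
  have ins: "insert f0 (F - {f0}) = F" using F by blast
  have low: "low_poly I 1 [:- b f g:]" if "f \<in> F" for f g
    using b(1)[OF that] by (auto simp: low_poly_def coeff_pCons ideal_0[OF I] ideal_uminus[OF A I] split: nat.split)
  have "\<exists>d' p. low_poly I d' p \<and> (z ^ d' + poly p z) * v f0 = 0"
    using low b(2) F by (intro eliminate[OF A I, of "F - {f0}" f0 1 "\<lambda>f g. [:- b f g:]" z v])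
      (simp_all add: ins insert_absorb sum_negf)
  then obtain d p where p: "low_poly I d p" "z ^ d + poly p z = 0" using F by auto
  have "poly p z = (\<Sum>i\<le>degree p. coeff p i * z ^ i)" by (simp add: poly_altdef)
  also have "\<dots> \<in> aspan {c * z ^ i | c i. c \<in> I \<and> i < d}"
  proof (rule aspan_sum)
    fix i
    show "coeff p i * z ^ i \<in> aspan {c * z ^ i | c i. c \<in> I \<and> i < d}"
    proof (cases "i < d")
      case True then show ?thesis using p(1) by (intro aspan_base) (auto simp: low_poly_def)
    next
      case False then show ?thesis using p(1) by (simp add: low_poly_def aspan_0)
    qed
  qed
  finally have "- poly p z \<in> aspan {c * z ^ i | c i. c \<in> I \<and> i < d}"
  proof (rule aspan_uminus)
    fix x assume "x \<in> {c * z ^ i | c i. c \<in> I \<and> i < d}"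
    then obtain c i where "x = c * z ^ i" "c \<in> I" "i < d" by blast
    moreover have "- (c * z ^ i) = (- c) * z ^ i" by simp
    ultimately show "- x \<in> {c * z ^ i | c i. c \<in> I \<and> i < d}"
      using ideal_uminus[OF A I] by blast
  qed
  moreover have "z ^ d = - poly p z" using p(2) by (simp add: eq_neg_iff_add_eq_0)
  ultimately show ?thesis unfolding integral_over_def by metis
qed

text \<open>
  For \<open>z\<close> integral of degree \<open>n\<close> and any \<open>w\<close>, the module on the monomials \<open>z^i w^j\<close> with \<open>i < n\<close>, \<open>j < m\<close>
  is mapped into itself by \<open>z\<close>: only \<open>z^n\<close> leaves the range of exponents, and it is rewritten.
\<close>

lemma power_stable:
  assumes A: "is_subring A" and K: "is_ideal A K"
    and z: "z ^ n \<in> aspan {c * z ^ i | c i. c \<in> A \<and> i < n}"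
    and x: "x \<in> aspan {a * (z ^ i * w ^ j) | a i j. a \<in> K \<and> i < n \<and> j < m}"
  shows "z * x \<in> aspan {a * (z ^ i * w ^ j) | a i j. a \<in> K \<and> i < n \<and> j < m}" (is "_ \<in> aspan ?X")
  using x
proof (rule aspan_mult)
  fix y assume "y \<in> ?X"
  then obtain a i j where y: "y = a * (z ^ i * w ^ j)" "a \<in> K" "i < n" "j < m" by blast
  show "z * y \<in> aspan ?X"
  proof (cases "Suc i < n")
    case True
    have "z * y = a * (z ^ Suc i * w ^ j)" by (simp add: y(1) mult_ac)
    then show ?thesis using True y by (intro aspan_base) blast
  next
    case False
    then have "z * y = (a * w ^ j) * z ^ n" using y(3) by (cases "n = Suc i") (auto simp: y(1) mult_ac)
    moreover have "(a * w ^ j) * z ^ n \<in> aspan ?X"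
      using z
    proof (rule aspan_mult)
      fix t assume "t \<in> {c * z ^ i | c i. c \<in> A \<and> i < n}"
      then obtain c k where t: "t = c * z ^ k" "c \<in> A" "k < n" by blast
      have "a * w ^ j * t = (c * a) * (z ^ k * w ^ j)" by (simp add: t(1) mult_ac)
      then show "a * w ^ j * t \<in> aspan ?X"
        using t y ideal_mult[OF K, of c a] by (intro aspan_base) blast
    qed
    ultimately show ?thesis by simp
  qed
qed

text \<open>
  If moreover \<open>z\<close> is integral over \<open>I\<close>, then rewriting \<open>z^n\<close> produces a coefficient from \<open>I\<close>. A single
  factor \<open>z\<close> need not do so, which is why powers appear in the next lemma.
\<close>

lemma power_absorb:
  assumes A: "is_subring A" and I: "is_ideal A I"
    and z: "z ^ n \<in> aspan {c * z ^ i | c i. c \<in> I \<and> i < n}"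
    and x: "x \<in> aspan {a * (z ^ i * w ^ j) | a i j. a \<in> A \<and> i < n \<and> j < m}"
  shows "z ^ n * x \<in> aspan {a * (z ^ i * w ^ j) | a i j. a \<in> I \<and> i < n \<and> j < m}" (is "_ \<in> aspan ?X")
  using x
proof (rule aspan_mult)
  have "aspan {c * z ^ i | c i. c \<in> I \<and> i < n} \<subseteq> aspan {c * z ^ i | c i. c \<in> A \<and> i < n}"
    by (rule aspan_mono) (use ideal_subset[OF I] in blast)
  then have zA: "z ^ n \<in> aspan {c * z ^ i | c i. c \<in> A \<and> i < n}" using z by blast
  fix y assume "y \<in> {a * (z ^ i * w ^ j) | a i j. a \<in> A \<and> i < n \<and> j < m}"
  then obtain a i j where y: "y = a * (z ^ i * w ^ j)" "a \<in> A" "i < n" "j < m" by blast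
  have "y * z ^ n \<in> aspan ?X"
    using z
  proof (rule aspan_mult)
    fix t assume "t \<in> {c * z ^ i | c i. c \<in> I \<and> i < n}"
    then obtain c k where t: "t = c * z ^ k" "c \<in> I" "k < n" by blast
    have "z ^ k * ((a * c) * (z ^ i * w ^ j)) \<in> aspan ?X" for k
    proof (induction k)
      case 0
      then show ?case using t y ideal_mult[OF I, of a c] by (auto intro!: aspan_base)
    next
      case (Suc k)
      show ?case using power_stable[OF A I zA Suc] by (simp add: mult.assoc)
    qed
    moreover have "y * t = z ^ k * ((a * c) * (z ^ i * w ^ j))" by (simp add: t(1) y(1) mult_ac)
    ultimately show "y * t \<in> aspan ?X" by simp
  qed
  then show "z ^ n * y \<in> aspan ?X" by (simp add: mult.commute)
qed

lemma integral_over_two_generators: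
  assumes A: "is_subring A" and I: "is_ideal A I"
    and z: "z ^ n \<in> aspan {c * z ^ i | c i. c \<in> A \<and> i < n}"
    and w: "w ^ m \<in> aspan {c * w ^ i | c i. c \<in> A \<and> i < m}"
    and N: "N > 0" "\<And>x. x \<in> aspan {a * (z ^ i * w ^ j) | a i j. a \<in> A \<and> i < n \<and> j < m} \<Longrightarrow>
      e ^ N * x \<in> aspan {a * (z ^ i * w ^ j) | a i j. a \<in> I \<and> i < n \<and> j < m}"
  shows "integral_over I e"
proof -
  have pos: "n > 0" "m > 0" using z w by (auto intro!: gr0I simp: aspan_empty)
  have eq: "{a * (z ^ i * w ^ j) | a i j. a \<in> K \<and> i < n \<and> j < m}
      = {a * (z ^ fst f * w ^ snd f) | a f. a \<in> K \<and> f \<in> {..<n} \<times> {..<m}}" for K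
    by force
  have "integral_over I (e ^ N)"
  proof (rule integral_over_finite_module[OF A I, of "{..<n} \<times> {..<m}" "(0, 0)" "\<lambda>f. z ^ fst f * w ^ snd f"])
    fix f assume f: "f \<in> {..<n} \<times> {..<m}"
    have "1 * (z ^ fst f * w ^ snd f) \<in> aspan {a * (z ^ i * w ^ j) | a i j. a \<in> A \<and> i < n \<and> j < m}"
      using f subring_1[OF A] by (intro aspan_base) (unfold eq, blast)
    from N(2)[OF this]
    show "e ^ N * (z ^ fst f * w ^ snd f)
        \<in> aspan {a * (z ^ fst f * w ^ snd f) | a f. a \<in> I \<and> f \<in> {..<n} \<times> {..<m}}"
      unfolding eq mult_1_left .
  qed (use pos in auto)
  then show ?thesis using integral_over_root N(1) by blast
qed

lemma integral_over_mult:
  assumes A: "is_subring A" and I: "is_ideal A I" and z: "integral_over I z" and w: "integral_over A w"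
  shows "integral_over I (z * w)"
proof -
  obtain n where n: "z ^ n \<in> aspan {c * z ^ i | c i. c \<in> I \<and> i < n}"
    using z unfolding integral_over_def by blast
  obtain m where m: "w ^ m \<in> aspan {c * w ^ i | c i. c \<in> A \<and> i < m}"
    using w unfolding integral_over_def by blast
  let ?M = "\<lambda>K. aspan {a * (z ^ i * w ^ j) | a i j. a \<in> K \<and> i < n \<and> j < m}"
  have swap: "?M K = aspan {a * (w ^ j * z ^ i) | a j i. a \<in> K \<and> j < m \<and> i < n}" for K
    by (rule arg_cong[where f = aspan]) (auto simp: mult_ac)
  have nA: "z ^ n \<in> aspan {c * z ^ i | c i. c \<in> A \<and> i < n}"
    using n aspan_mono[of "{c * z ^ i | c i. c \<in> I \<and> i < n}" "{c * z ^ i | c i. c \<in> A \<and> i < n}"]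
      ideal_subset[OF I] by blast
  have "n \<noteq> 0" using n by (auto intro!: gr0I simp: aspan_empty)
  have wM: "w ^ k * x \<in> ?M A" if x: "x \<in> ?M A" for x k
  proof (induction k)
    case (Suc k)
    then show ?case using power_stable[OF A ideal_self[OF A] m, of "w ^ k * x" z n]
      unfolding swap by (simp add: mult.assoc)
  qed (use x in simp)
  have "(z * w) ^ n * x \<in> ?M I" if "x \<in> ?M A" for x
    using power_absorb[OF A I n wM[OF that, of n]] by (simp add: power_mult_distrib mult.assoc)
  then show ?thesis
    using integral_over_two_generators[OF A I nA m] \<open>n \<noteq> 0\<close> by blast
qed

text \<open>
  In the binomial expansion of \<open>(z + w)^(n + m)\<close> each term contains \<open>z^n\<close> or \<open>w^m\<close>, so multiplication
  by this power takes the module on the monomials \<open>z^i w^j\<close> into \<open>I\<close> times itself.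
\<close>

lemma integral_over_add:
  assumes A: "is_subring A" and I: "is_ideal A I" and z: "integral_over I z" and w: "integral_over I w"
  shows "integral_over I (z + w)"
proof -
  obtain n where n: "z ^ n \<in> aspan {c * z ^ i | c i. c \<in> I \<and> i < n}"
    using z unfolding integral_over_def by blast
  obtain m where m: "w ^ m \<in> aspan {c * w ^ i | c i. c \<in> I \<and> i < m}"
    using w unfolding integral_over_def by blast
  let ?M = "\<lambda>K. aspan {a * (z ^ i * w ^ j) | a i j. a \<in> K \<and> i < n \<and> j < m}"
  have swap: "?M K = aspan {a * (w ^ j * z ^ i) | a j i. a \<in> K \<and> j < m \<and> i < n}" for K
    by (rule arg_cong[where f = aspan]) (auto simp: mult_ac)
  have "aspan {c * u ^ i | c i. c \<in> I \<and> i < k} \<subseteq> aspan {c * u ^ i | c i. c \<in> A \<and> i < k}" for u k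
    by (rule aspan_mono) (use ideal_subset[OF I] in blast)
  then have nA: "z ^ n \<in> aspan {c * z ^ i | c i. c \<in> A \<and> i < n}"
    and mA: "w ^ m \<in> aspan {c * w ^ i | c i. c \<in> A \<and> i < m}"
    using n m by blast+
  have "n \<noteq> 0" using n by (auto intro!: gr0I simp: aspan_empty)
  have zM: "z ^ k * x \<in> ?M K" if x: "x \<in> ?M K" and K: "is_ideal A K" for x k K
  proof (induction k)
    case (Suc k)
    then show ?case using power_stable[OF A K nA Suc] by (simp add: mult.assoc)
  qed (use x in simp)
  have wM: "w ^ k * x \<in> ?M K" if x: "x \<in> ?M K" and K: "is_ideal A K" for x k K
  proof (induction k)
    case (Suc k)
    then show ?case using power_stable[OF A K mA, of "w ^ k * x" z n]
      unfolding swap by (simp add: mult.assoc)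
  qed (use x in simp)
  have "(z + w) ^ (n + m) * x \<in> ?M I" if x: "x \<in> ?M A" for x
  proof -
    have zn: "z ^ n * x \<in> ?M I" by (rule power_absorb[OF A I n x])
    have wm: "w ^ m * x \<in> ?M I" using power_absorb[OF A I m, of x z n] x unfolding swap by blast
    have "of_nat l * y \<in> ?M I" if "y \<in> ?M I" for l y
      by (induction l) (auto simp: distrib_right aspan_0 intro: aspan_add that)
    moreover have "z ^ k * (w ^ (n + m - k) * x) \<in> ?M I" for k
    proof (cases "k \<ge> n")
      case True
      have "w ^ (n + m - k) * (z ^ (k - n) * (z ^ n * x)) \<in> ?M I"
        by (intro wM zM zn I)
      then show ?thesis using True by (simp add: mult_ac flip: power_add)
    next
      case False
      then have "w ^ (n + m - k) = w ^ (n - k) * w ^ m" by (simp flip: power_add)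
      moreover have "z ^ k * (w ^ (n - k) * (w ^ m * x)) \<in> ?M I"
        by (intro wM zM wm I)
      ultimately show ?thesis by (simp add: mult_ac)
    qed
    ultimately have "(\<Sum>k\<le>n + m. of_nat ((n + m) choose k) * (z ^ k * (w ^ (n + m - k) * x))) \<in> ?M I"
      by (intro aspan_sum) blast
    then show ?thesis by (simp add: binomial_ring sum_distrib_right mult.assoc)
  qed
  then show ?thesis
    using integral_over_two_generators[OF A I nA mA, of "n + m"] \<open>n \<noteq> 0\<close> by blast
qed

lemma integral_over_uminus: "is_subring A \<Longrightarrow> is_ideal A I \<Longrightarrow> integral_over I z \<Longrightarrow> integral_over I (- z)"
  using integral_over_mult[of A I z "-1"] integral_over_self[of "-1" A]
  by (simp add: subring_1 subring_uminus)

lemma integral_over_diff: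
  "is_subring A \<Longrightarrow> is_ideal A I \<Longrightarrow> integral_over I z \<Longrightarrow> integral_over I w \<Longrightarrow> integral_over I (z - w)"
  using integral_over_add[of A I z "- w"] by (simp add: integral_over_uminus)

lemma integral_over_power: "is_subring A \<Longrightarrow> integral_over A z \<Longrightarrow> integral_over A (z ^ n)"
  by (induction n) (auto intro: integral_over_self subring_1 integral_over_mult ideal_self)

lemma integral_over_0: "is_ideal A I \<Longrightarrow> integral_over I 0"
  by (simp add: integral_over_self ideal_0)

lemma integral_over_iff_sum:
  assumes "is_subring A" "is_ideal A I"
  shows "integral_over I z \<longleftrightarrow> (\<exists>n c. (\<forall>i. c i \<in> I) \<and> z ^ n + (\<Sum>i<n. c i * z ^ i) = 0)"
proof
  assume "integral_over I z"
  then obtain n where "z ^ n \<in> aspan {c * z ^ i | c i. c \<in> I \<and> i < n}"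
    unfolding integral_over_def by blast
  then have "z ^ n \<in> aspan {a * (\<lambda>i. z ^ i) f | a f. a \<in> I \<and> f \<in> {..<n}}" by simp
  from aspan_combination[OF this _ assms(2)]
  obtain b where "\<forall>f. b f \<in> I" "z ^ n = (\<Sum>f<n. b f * z ^ f)" by auto
  then show "\<exists>n c. (\<forall>i. c i \<in> I) \<and> z ^ n + (\<Sum>i<n. c i * z ^ i) = 0"
    using ideal_uminus[OF assms]
    by (intro exI[of _ n] exI[of _ "\<lambda>i. - b i"]) (auto simp: sum_negf)
next
  assume "\<exists>n c. (\<forall>i. c i \<in> I) \<and> z ^ n + (\<Sum>i<n. c i * z ^ i) = 0"
  then obtain n c where c: "\<And>i. c i \<in> I" "z ^ n + (\<Sum>i<n. c i * z ^ i) = 0" by blast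
  have "z ^ n = (\<Sum>i<n. (- c i) * z ^ i)" using c(2) by (simp add: sum_negf eq_neg_iff_add_eq_0)
  also have "\<dots> \<in> aspan {c * z ^ i | c i. c \<in> I \<and> i < n}"
    using ideal_uminus[OF assms c(1)] by (intro aspan_sum aspan_base) blast
  finally show "integral_over I z" unfolding integral_over_def by blast
qed

lemma integral_over_imp_power_mem:
  assumes A: "is_subring A" and I: "is_ideal A I" and z: "integral_over I z" "z \<in> A"
  shows "\<exists>n. z ^ n \<in> I"
proof -
  obtain n where n: "z ^ n \<in> aspan {c * z ^ i | c i. c \<in> I \<and> i < n}"
    using z unfolding integral_over_def by blast
  have "c * z ^ i \<in> I" if "c \<in> I" for c i
    using ideal_mult[OF I subring_power[OF A z(2), of i] that] by (simp add: mult.commute)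
  then have "z ^ n \<in> I"
    using n ideal_aspan[OF I, of "{c * z ^ i | c i. c \<in> I \<and> i < n}"] by blast
  then show ?thesis ..
qed

section \<open>Unique sums in torsionless monoids\<close>

lemma
  fixes n :: nat
  assumes "grading_monoid \<Gamma>"
  shows monoid_0: "0 \<in> \<Gamma>"
    and monoid_add: "\<alpha> \<in> \<Gamma> \<Longrightarrow> \<beta> \<in> \<Gamma> \<Longrightarrow> \<alpha> + \<beta> \<in> \<Gamma>"
    and monoid_cancel: "\<alpha> \<in> \<Gamma> \<Longrightarrow> \<beta> \<in> \<Gamma> \<Longrightarrow> \<gamma> \<in> \<Gamma> \<Longrightarrow> \<alpha> + \<gamma> = \<beta> + \<gamma> \<Longrightarrow> \<alpha> = \<beta>"
    and monoid_torsionless: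
      "n > 0 \<Longrightarrow> \<alpha> \<in> \<Gamma> \<Longrightarrow> \<beta> \<in> \<Gamma> \<Longrightarrow> (\<Sum>i<n. \<alpha>) = (\<Sum>i<n. \<beta>) \<Longrightarrow> \<alpha> = \<beta>"
  using assms unfolding grading_monoid_def by blast+

lemma monoid_sum: "grading_monoid \<Gamma> \<Longrightarrow> (\<And>i. i \<in> F \<Longrightarrow> f i \<in> \<Gamma>) \<Longrightarrow> sum f F \<in> \<Gamma>"
  by (induction F rule: infinite_finite_induct) (auto intro: monoid_0 monoid_add)

text \<open>
  A partial order on \<open>\<Gamma>\<close>, as a set of pairs, that is compatible with addition and cancellation.
  Transitivity follows: add two comparisons and cancel the middle term.
\<close>

definition compatible_order :: "'g::comm_monoid_add set \<Rightarrow> ('g \<times> 'g) set \<Rightarrow> bool" where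
  "compatible_order \<Gamma> C \<longleftrightarrow> C \<subseteq> \<Gamma> \<times> \<Gamma> \<and> (\<forall>\<alpha>\<in>\<Gamma>. (\<alpha>, \<alpha>) \<in> C) \<and>
     (\<forall>\<alpha> \<beta> \<gamma> \<delta>. (\<alpha>, \<beta>) \<in> C \<longrightarrow> (\<gamma>, \<delta>) \<in> C \<longrightarrow> (\<alpha> + \<gamma>, \<beta> + \<delta>) \<in> C) \<and>
     (\<forall>\<alpha>\<in>\<Gamma>. \<forall>\<beta>\<in>\<Gamma>. \<forall>\<gamma>\<in>\<Gamma>. (\<alpha> + \<gamma>, \<beta> + \<gamma>) \<in> C \<longrightarrow> (\<alpha>, \<beta>) \<in> C) \<and>
     (\<forall>\<alpha> \<beta>. (\<alpha>, \<beta>) \<in> C \<longrightarrow> (\<beta>, \<alpha>) \<in> C \<longrightarrow> \<alpha> = \<beta>)"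

lemma
  assumes "compatible_order \<Gamma> C"
  shows order_carrier: "(\<alpha>, \<beta>) \<in> C \<Longrightarrow> \<alpha> \<in> \<Gamma>" "(\<alpha>, \<beta>) \<in> C \<Longrightarrow> \<beta> \<in> \<Gamma>"
    and order_refl: "\<alpha> \<in> \<Gamma> \<Longrightarrow> (\<alpha>, \<alpha>) \<in> C"
    and order_add: "(\<alpha>, \<beta>) \<in> C \<Longrightarrow> (\<gamma>, \<delta>) \<in> C \<Longrightarrow> (\<alpha> + \<gamma>, \<beta> + \<delta>) \<in> C"
    and order_cancel: "\<alpha> \<in> \<Gamma> \<Longrightarrow> \<beta> \<in> \<Gamma> \<Longrightarrow> \<gamma> \<in> \<Gamma> \<Longrightarrow> (\<alpha> + \<gamma>, \<beta> + \<gamma>) \<in> C \<Longrightarrow> (\<alpha>, \<beta>) \<in> C"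
    and order_antisym: "(\<alpha>, \<beta>) \<in> C \<Longrightarrow> (\<beta>, \<alpha>) \<in> C \<Longrightarrow> \<alpha> = \<beta>"
  using assms unfolding compatible_order_def by blast+

lemma order_trans:
  assumes "compatible_order \<Gamma> C" "(\<alpha>, \<beta>) \<in> C" "(\<beta>, \<gamma>) \<in> C"
  shows "(\<alpha>, \<gamma>) \<in> C"
  using order_add[OF assms] order_cancel[OF assms(1), of \<alpha> \<gamma> \<beta>] order_carrier[OF assms(1)] assms(2,3)
  by (auto simp: add.commute)

lemma order_multiple:
  "compatible_order \<Gamma> C \<Longrightarrow> 0 \<in> \<Gamma> \<Longrightarrow> (\<alpha>, \<beta>) \<in> C \<Longrightarrow> ((\<Sum>i<n. \<alpha>), (\<Sum>i<n. \<beta>)) \<in> C" for n :: nat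
  by (induction n) (auto intro: order_refl order_add)

text \<open>
  The relation generated by \<open>C\<close> and the additional comparison \<open>a \<le> b\<close>. In the quotient group it says that
  \<open>\<beta> - \<alpha>\<close> is at least \<open>n (b - a)\<close> for some \<open>n\<close>; adding \<open>n a\<close> and \<open>n b\<close> to the two sides expresses this
  inside the monoid.
\<close>

definition adjoin_comparison where
  "adjoin_comparison \<Gamma> C a b =
     {(\<alpha>, \<beta>). \<alpha> \<in> \<Gamma> \<and> \<beta> \<in> \<Gamma> \<and> (\<exists>n::nat. (\<alpha> + (\<Sum>i<n. b), \<beta> + (\<Sum>i<n. a)) \<in> C)}"

lemma multiple_add: "(\<Sum>i<n + m. (a::'g::comm_monoid_add)) = (\<Sum>i<n. a) + (\<Sum>i<m. a)" for n m :: nat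
  by (induction m) (auto simp: add_ac)

lemma multiple_mult: "(\<Sum>i<n * m. (a::'g::comm_monoid_add)) = (\<Sum>i<n. \<Sum>i<m. a)" for n m :: nat
  by (induction n) (auto simp: multiple_add add_ac)

lemma adjoin_comparison_mono:
  assumes "compatible_order \<Gamma> C" shows "C \<subseteq> adjoin_comparison \<Gamma> C a b"
  using order_carrier[OF assms] by (auto simp: adjoin_comparison_def intro!: exI[of _ 0])

lemma adjoin_comparison_mem:
  assumes "grading_monoid \<Gamma>" "compatible_order \<Gamma> C" "a \<in> \<Gamma>" "b \<in> \<Gamma>"
  shows "(a, b) \<in> adjoin_comparison \<Gamma> C a b"
proof -
  have "(a + b, b + a) \<in> C"
    using order_refl[OF assms(2) monoid_add[OF assms(1,3,4)]] by (simp add: add.commute)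
  then have "(a + (\<Sum>i<1::nat. b), b + (\<Sum>i<1::nat. a)) \<in> C" by (simp add: lessThan_Suc)
  then show ?thesis using assms(3,4) unfolding adjoin_comparison_def by blast
qed

text \<open>
  Only antisymmetry can fail for the generated relation, and adding the two offending comparisons and
  cancelling leaves a comparison of multiples of \<open>b\<close> and \<open>a\<close> in the wrong direction.
\<close>

lemma not_compatible_adjoin:
  assumes \<Gamma>: "grading_monoid \<Gamma>" and C: "compatible_order \<Gamma> C" and ab: "a \<in> \<Gamma>" "b \<in> \<Gamma>"
    and not: "\<not> compatible_order \<Gamma> (adjoin_comparison \<Gamma> C a b)"
  shows "\<exists>k>0. ((\<Sum>i<k::nat. b), (\<Sum>i<k. a)) \<in> C"
proof -
  let ?D = "adjoin_comparison \<Gamma> C a b"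
  have mul: "(\<Sum>i<n::nat. a) \<in> \<Gamma>" "(\<Sum>i<n::nat. b) \<in> \<Gamma>" for n
    by (rule monoid_sum[OF \<Gamma>], rule ab)+
  have 1: "?D \<subseteq> \<Gamma> \<times> \<Gamma>" by (auto simp: adjoin_comparison_def)
  have 2: "\<forall>\<alpha>\<in>\<Gamma>. (\<alpha>, \<alpha>) \<in> ?D"
    using adjoin_comparison_mono[OF C] order_refl[OF C] by blast
  have 3: "(\<alpha> + \<gamma>, \<beta> + \<delta>) \<in> ?D" if D: "(\<alpha>, \<beta>) \<in> ?D" "(\<gamma>, \<delta>) \<in> ?D" for \<alpha> \<beta> \<gamma> \<delta>
  proof -
    obtain n m where "(\<alpha> + (\<Sum>i<n::nat. b), \<beta> + (\<Sum>i<n. a)) \<in> C"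
      "(\<gamma> + (\<Sum>i<m::nat. b), \<delta> + (\<Sum>i<m. a)) \<in> C"
      using D by (auto simp: adjoin_comparison_def)
    from order_add[OF C this]
    have "(\<alpha> + \<gamma> + (\<Sum>i<n + m. b), \<beta> + \<delta> + (\<Sum>i<n + m. a)) \<in> C"
      by (simp add: multiple_add add_ac)
    then show ?thesis using D monoid_add[OF \<Gamma>] unfolding adjoin_comparison_def by blast
  qed
  have 4: "(\<alpha>, \<beta>) \<in> ?D" if D: "\<alpha> \<in> \<Gamma>" "\<beta> \<in> \<Gamma>" "\<gamma> \<in> \<Gamma>" "(\<alpha> + \<gamma>, \<beta> + \<gamma>) \<in> ?D" for \<alpha> \<beta> \<gamma>
  proof -
    obtain n where "(\<alpha> + \<gamma> + (\<Sum>i<n::nat. b), \<beta> + \<gamma> + (\<Sum>i<n. a)) \<in> C"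
      using D by (auto simp: adjoin_comparison_def)
    then have "((\<alpha> + (\<Sum>i<n. b)) + \<gamma>, (\<beta> + (\<Sum>i<n. a)) + \<gamma>) \<in> C"
      by (simp add: add_ac)
    from order_cancel[OF C _ _ _ this] show ?thesis
      using D mul monoid_add[OF \<Gamma>] unfolding adjoin_comparison_def by blast
  qed
  obtain \<alpha> \<beta> where *: "(\<alpha>, \<beta>) \<in> ?D" "(\<beta>, \<alpha>) \<in> ?D" "\<alpha> \<noteq> \<beta>"
    using not 1 2 3 4 unfolding compatible_order_def by blast
  then obtain n m where nm: "(\<alpha> + (\<Sum>i<n::nat. b), \<beta> + (\<Sum>i<n. a)) \<in> C"
    "(\<beta> + (\<Sum>i<m::nat. b), \<alpha> + (\<Sum>i<m. a)) \<in> C" and mem: "\<alpha> \<in> \<Gamma>" "\<beta> \<in> \<Gamma>"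
    by (auto simp: adjoin_comparison_def)
  have "n + m > 0"
  proof (rule ccontr)
    assume "\<not> n + m > 0"
    then show False using nm *(3) order_antisym[OF C] by simp
  qed
  moreover have "((\<Sum>i<n + m. b) + (\<alpha> + \<beta>), (\<Sum>i<n + m. a) + (\<alpha> + \<beta>)) \<in> C"
    using order_add[OF C nm] by (simp add: multiple_add add_ac)
  then have "((\<Sum>i<n + m. b), (\<Sum>i<n + m. a)) \<in> C"
    by (intro order_cancel[OF C mul(2) mul(1) monoid_add[OF \<Gamma> mem]])
  ultimately show ?thesis by blast
qed

text \<open>
  If neither \<open>a \<le> b\<close> nor \<open>b \<le> a\<close> can be added, then \<open>k b \<le> k a\<close> and \<open>l a \<le> l b\<close> for positive \<open>k\<close> and \<open>l\<close>,
  so \<open>k l a = k l b\<close>, and torsionlessness gives \<open>a = b\<close>.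
\<close>

lemma compare_pair:
  assumes \<Gamma>: "grading_monoid \<Gamma>" and C: "compatible_order \<Gamma> C" and ab: "a \<in> \<Gamma>" "b \<in> \<Gamma>"
  shows "\<exists>D. compatible_order \<Gamma> D \<and> C \<subseteq> D \<and> ((a, b) \<in> D \<or> (b, a) \<in> D)"
proof (rule ccontr)
  assume no: "\<not> ?thesis"
  have "\<not> compatible_order \<Gamma> (adjoin_comparison \<Gamma> C a b)"
    using no adjoin_comparison_mono[OF C] adjoin_comparison_mem[OF \<Gamma> C ab] by blast
  from not_compatible_adjoin[OF \<Gamma> C ab this]
  obtain k where k: "k > 0" "((\<Sum>i<k::nat. b), (\<Sum>i<k. a)) \<in> C" by blast
  have "\<not> compatible_order \<Gamma> (adjoin_comparison \<Gamma> C b a)"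
    using no adjoin_comparison_mono[OF C] adjoin_comparison_mem[OF \<Gamma> C ab(2,1)] by blast
  from not_compatible_adjoin[OF \<Gamma> C ab(2,1) this]
  obtain l where l: "l > 0" "((\<Sum>i<l::nat. a), (\<Sum>i<l. b)) \<in> C" by blast
  have "((\<Sum>i<l * k. b), (\<Sum>i<l * k. a)) \<in> C" "((\<Sum>i<k * l. a), (\<Sum>i<k * l. b)) \<in> C"
    unfolding multiple_mult using k l by (auto intro!: order_multiple[OF C monoid_0[OF \<Gamma>]])
  then have "(\<Sum>i<k * l. a) = (\<Sum>i<k * l. b)"
    using order_antisym[OF C] by (simp add: mult.commute)
  then have "a = b" using monoid_torsionless[OF \<Gamma> _ ab, of "k * l"] k(1) l(1) by simp
  then show False using no C order_refl[OF C] ab by blast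
qed

text \<open>
  Starting from equality, finitely many pairs are made comparable one after another. This finite version
  of the existence of a total order is enough for comparing the degrees of two given elements.
\<close>

lemma compare_finite:
  assumes \<Gamma>: "grading_monoid \<Gamma>" and "finite F" "F \<subseteq> \<Gamma> \<times> \<Gamma>"
  shows "\<exists>C. compatible_order \<Gamma> C \<and> (\<forall>(a, b)\<in>F. (a, b) \<in> C \<or> (b, a) \<in> C)"
  using assms(2,3)
proof (induction F rule: finite_induct)
  case empty
  have "compatible_order \<Gamma> (Id_on \<Gamma>)"
    using monoid_add[OF \<Gamma>] monoid_cancel[OF \<Gamma>] unfolding compatible_order_def by blast
  then show ?case by blast
next
  case (insert p F)
  then obtain C where C: "compatible_order \<Gamma> C" "\<forall>(a, b)\<in>F. (a, b) \<in> C \<or> (b, a) \<in> C" by blast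
  obtain a b where p: "p = (a, b)" "a \<in> \<Gamma>" "b \<in> \<Gamma>" using insert.prems by auto
  obtain D where "compatible_order \<Gamma> D" "C \<subseteq> D" "(a, b) \<in> D \<or> (b, a) \<in> D"
    using compare_pair[OF \<Gamma> C(1) p(2,3)] by blast
  then show ?case using C(2) p(1) by blast
qed

lemma finite_maximum:
  assumes C: "compatible_order \<Gamma> C" and "finite A" "A \<noteq> {}" "\<forall>a\<in>A. \<forall>b\<in>A. (a, b) \<in> C \<or> (b, a) \<in> C"
  shows "\<exists>m\<in>A. \<forall>a\<in>A. (a, m) \<in> C"
  using assms(2-)
proof (induction A rule: finite_ne_induct)
  case (singleton x)
  then show ?case by blast
next
  case (insert x A)
  then obtain m where "m \<in> A" "\<forall>a\<in>A. (a, m) \<in> C" by blast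
  then show ?case
    using insert.prems order_trans[OF C] by (cases "(x, m) \<in> C") blast+
qed

text \<open>
  The sum of the largest elements of \<open>A\<close> and \<open>B\<close> has no other representation.
\<close>

lemma unique_sum:
  assumes \<Gamma>: "grading_monoid \<Gamma>" and A: "finite A" "A \<noteq> {}" "A \<subseteq> \<Gamma>" and B: "finite B" "B \<noteq> {}" "B \<subseteq> \<Gamma>"
  shows "\<exists>a\<in>A. \<exists>b\<in>B. \<forall>a'\<in>A. \<forall>b'\<in>B. a' + b' = a + b \<longrightarrow> a' = a \<and> b' = b"
proof -
  obtain C where C: "compatible_order \<Gamma> C"
    and total: "\<forall>(a, b)\<in>(A \<union> B) \<times> (A \<union> B). (a, b) \<in> C \<or> (b, a) \<in> C"
    using compare_finite[OF \<Gamma>, of "(A \<union> B) \<times> (A \<union> B)"] A B by blast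
  obtain a where a: "a \<in> A" "\<And>a'. a' \<in> A \<Longrightarrow> (a', a) \<in> C"
    using finite_maximum[OF C A(1,2)] total by blast
  obtain b where b: "b \<in> B" "\<And>b'. b' \<in> B \<Longrightarrow> (b', b) \<in> C"
    using finite_maximum[OF C B(1,2)] total by blast
  have "a' = a \<and> b' = b" if "a' \<in> A" "b' \<in> B" and eq: "a' + b' = a + b" for a' b'
  proof -
    have mem: "a \<in> \<Gamma>" "b \<in> \<Gamma>" "a' \<in> \<Gamma>" "b' \<in> \<Gamma>" using that a(1) b(1) A(3) B(3) by auto
    have "(a + b', a + b) \<in> C"
      using order_add[OF C order_refl[OF C mem(1)] b(2)[OF that(2)]] .
    then have "(a, a') \<in> C"
      using order_cancel[OF C mem(1,3,4)] eq by simp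
    then have "a' = a" using order_antisym[OF C a(2)[OF that(1)]] by simp
    moreover from this have "b' = b"
      using monoid_cancel[OF \<Gamma> mem(4,2,1)] eq by (simp add: add.commute)
    ultimately show ?thesis by simp
  qed
  then show ?thesis using a(1) b(1) by blast
qed

section \<open>Homogeneous components and homogeneous ideals\<close>

lemma ring_of_simps [simp]:
  "carrier (ring_of R) = elts R" "x \<otimes>\<^bsub>ring_of R\<^esub> y = x * y" "x \<oplus>\<^bsub>ring_of R\<^esub> y = x + y"
  "\<one>\<^bsub>ring_of R\<^esub> = 1" "\<zero>\<^bsub>ring_of R\<^esub> = 0"
  by (auto simp: ring_of_def)

lemma ring_of_minus:
  assumes "cring (ring_of R)" "x \<in> elts R"
  shows "\<ominus>\<^bsub>ring_of R\<^esub> x = - x"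
proof -
  interpret cring "ring_of R" by fact
  have "x + \<ominus>\<^bsub>ring_of R\<^esub> x = 0" using r_neg[of x] assms(2) by simp
  then show ?thesis by (simp add: eq_neg_iff_add_eq_0 add.commute)
qed

lemma cring_ring_of_iff: "cring (ring_of R) \<longleftrightarrow> is_subring (elts R)"
proof
  assume R: "cring (ring_of R)"
  interpret cring "ring_of R" by fact
  have "x - y \<in> elts R" if "x \<in> elts R" "y \<in> elts R" for x y
    using a_closed[of x "\<ominus>\<^bsub>ring_of R\<^esub> y"] a_inv_closed[of y] that ring_of_minus[OF R] by simp
  then show "is_subring (elts R)"
    using one_closed m_closed by (auto simp: is_subring_def)
next
  assume A: "is_subring (elts R)"
  show "cring (ring_of R)"
    by (rule cringI; (rule abelian_groupI comm_monoidI)?)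
      (auto simp: algebra_simps intro: subring_0[OF A] subring_1[OF A] subring_add[OF A] subring_mult[OF A]
        bexI[of _ "- _"] subring_uminus[OF A])
qed

lemma domain_ring_of_iff:
  "domain (ring_of R) \<longleftrightarrow>
     is_subring (elts R) \<and> (\<forall>x\<in>elts R. \<forall>y\<in>elts R. x * y = 0 \<longrightarrow> x = 0 \<or> y = 0)"
  by (auto simp: domain_def domain_axioms_def cring_ring_of_iff)

lemma additive_subgroup_ring_of:
  assumes A: "is_subring (elts R)"
  shows "additive_subgroup H (ring_of R) \<longleftrightarrow>
    H \<subseteq> elts R \<and> 0 \<in> H \<and> (\<forall>x\<in>H. \<forall>y\<in>H. x + y \<in> H) \<and> (\<forall>x\<in>H. - x \<in> H)"
proof -
  have R: "cring (ring_of R)" using A by (simp add: cring_ring_of_iff)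
  have inv: "inv\<^bsub>add_monoid (ring_of R)\<^esub> x = - x" if "x \<in> elts R" for x
    using ring_of_minus[OF R that] by (simp add: a_inv_def)
  show ?thesis
  proof
    assume H: "additive_subgroup H (ring_of R)"
    then have "H \<subseteq> elts R" using additive_subgroup.a_subset[OF H] by simp
    moreover have "- x \<in> H" if "x \<in> H" for x
      using subgroup.m_inv_closed[OF additive_subgroup.a_subgroup[OF H] that] inv[of x] that
        \<open>H \<subseteq> elts R\<close> by (simp add: subset_iff)
    ultimately show "H \<subseteq> elts R \<and> 0 \<in> H \<and> (\<forall>x\<in>H. \<forall>y\<in>H. x + y \<in> H) \<and> (\<forall>x\<in>H. - x \<in> H)"
      using additive_subgroup.zero_closed[OF H] additive_subgroup.a_closed[OF H] by simp
  next
    assume H: "H \<subseteq> elts R \<and> 0 \<in> H \<and> (\<forall>x\<in>H. \<forall>y\<in>H. x + y \<in> H) \<and> (\<forall>x\<in>H. - x \<in> H)"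
    show "additive_subgroup H (ring_of R)"
      by (rule additive_subgroupI, rule subgroup.intro) (use H inv in \<open>auto simp: subset_iff\<close>)
  qed
qed

lemma ideal_ring_of:
  assumes A: "is_subring (elts R)"
  shows "ideal I (ring_of R) \<longleftrightarrow> is_ideal (elts R) I"
proof -
  have R: "cring (ring_of R)" using A by (simp add: cring_ring_of_iff)
  then have "ring (ring_of R)" by (simp add: cring_def)
  then have "ideal I (ring_of R) \<longleftrightarrow> additive_subgroup I (ring_of R) \<and>
      (\<forall>a\<in>I. \<forall>x\<in>elts R. x * a \<in> I \<and> a * x \<in> I)"
    by (auto simp: ideal_def ideal_axioms_def)
  then show ?thesis
    unfolding additive_subgroup_ring_of[OF A]
    using ideal_uminus[OF A, of I] unfolding is_ideal_def ring_of_simps by (metis mult.commute)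
qed

lemma
  assumes "graded_domain R"
  shows graded_subring: "is_subring (elts R)"
    and graded_no_zero_divisors: "x \<in> elts R \<Longrightarrow> y \<in> elts R \<Longrightarrow> x * y = 0 \<Longrightarrow> x = 0 \<or> y = 0"
    and graded_degs: "grading_monoid (degs R)"
  using assms by (auto simp: graded_domain_def domain_ring_of_iff)

lemma
  assumes "graded_domain R" "\<alpha> \<in> degs R"
  shows part_subset: "a \<in> part R \<alpha> \<Longrightarrow> a \<in> elts R"
    and part_0: "0 \<in> part R \<alpha>"
    and part_add: "a \<in> part R \<alpha> \<Longrightarrow> b \<in> part R \<alpha> \<Longrightarrow> a + b \<in> part R \<alpha>"
    and part_uminus: "a \<in> part R \<alpha> \<Longrightarrow> - a \<in> part R \<alpha>"
proof -
  have "additive_subgroup (part R \<alpha>) (ring_of R)"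
    using assms unfolding graded_domain_def by blast
  then have "part R \<alpha> \<subseteq> elts R \<and> 0 \<in> part R \<alpha> \<and>
      (\<forall>x\<in>part R \<alpha>. \<forall>y\<in>part R \<alpha>. x + y \<in> part R \<alpha>) \<and> (\<forall>x\<in>part R \<alpha>. - x \<in> part R \<alpha>)"
    unfolding additive_subgroup_ring_of[OF graded_subring[OF assms(1)]] .
  then show "a \<in> part R \<alpha> \<Longrightarrow> a \<in> elts R" "0 \<in> part R \<alpha>"
    "a \<in> part R \<alpha> \<Longrightarrow> b \<in> part R \<alpha> \<Longrightarrow> a + b \<in> part R \<alpha>" "a \<in> part R \<alpha> \<Longrightarrow> - a \<in> part R \<alpha>"
    by blast+
qed

lemma part_mult:
  "graded_domain R \<Longrightarrow> \<alpha> \<in> degs R \<Longrightarrow> \<beta> \<in> degs R \<Longrightarrow> a \<in> part R \<alpha> \<Longrightarrow> b \<in> part R \<beta> \<Longrightarrow>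
    a * b \<in> part R (\<alpha> + \<beta>)"
  by (simp add: graded_domain_def)

definition component :: "('a::comm_ring_1, 'g) graded \<Rightarrow> 'a \<Rightarrow> 'g \<Rightarrow> 'a" where
  "component R x = (THE c. is_decomposition R x c)"

lemma comp_decomposition:
  assumes "graded_domain R" "x \<in> elts R" shows "is_decomposition R x (component R x)"
proof -
  have "\<exists>!c. is_decomposition R x c" using assms by (simp add: graded_domain_def)
  then show ?thesis unfolding component_def by (rule theI')
qed

lemma comp_eqI:
  assumes "graded_domain R" "x \<in> elts R" "is_decomposition R x c" shows "component R x = c"
proof -
  have "\<exists>!c. is_decomposition R x c" using assms(1,2) by (simp add: graded_domain_def)
  then show ?thesis using comp_decomposition[OF assms(1,2)] assms(3) by blast
qed

lemma
  assumes "graded_domain R" "x \<in> elts R"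
  shows comp_part: "\<alpha> \<in> degs R \<Longrightarrow> component R x \<alpha> \<in> part R \<alpha>"
    and comp_outside: "\<alpha> \<notin> degs R \<Longrightarrow> component R x \<alpha> = 0"
    and comp_finite: "finite {\<alpha>. component R x \<alpha> \<noteq> 0}"
    and sum_comp: "(\<Sum>\<alpha> | component R x \<alpha> \<noteq> 0. component R x \<alpha>) = x"
  using comp_decomposition[OF assms] by (auto simp: is_decomposition_def)

lemma comp_degs: "graded_domain R \<Longrightarrow> x \<in> elts R \<Longrightarrow> component R x \<alpha> \<noteq> 0 \<Longrightarrow> \<alpha> \<in> degs R"
  using comp_outside by blast

lemma homogI: "\<alpha> \<in> degs R \<Longrightarrow> a \<in> part R \<alpha> \<Longrightarrow> a \<in> homog R"
  by (auto simp: homog_def)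

lemma homogE:
  assumes "a \<in> homog R" obtains \<alpha> where "\<alpha> \<in> degs R" "a \<in> part R \<alpha>"
  using assms by (auto simp: homog_def)

lemma homog_subset: "graded_domain R \<Longrightarrow> a \<in> homog R \<Longrightarrow> a \<in> elts R"
  by (auto elim!: homogE intro: part_subset)

lemma homog_0: "graded_domain R \<Longrightarrow> 0 \<in> homog R"
  using part_0[of R 0] monoid_0[of "degs R"] by (blast intro: homogI graded_degs)

lemma homog_mult: "graded_domain R \<Longrightarrow> a \<in> homog R \<Longrightarrow> b \<in> homog R \<Longrightarrow> a * b \<in> homog R"
  by (elim homogE) (rule homogI[OF monoid_add[OF graded_degs] part_mult])

lemma homog_uminus: "graded_domain R \<Longrightarrow> a \<in> homog R \<Longrightarrow> - a \<in> homog R"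
  by (auto elim!: homogE intro: homogI part_uminus)

lemma comp_homog: "graded_domain R \<Longrightarrow> x \<in> elts R \<Longrightarrow> component R x \<alpha> \<in> homog R"
  by (cases "\<alpha> \<in> degs R") (auto intro: homogI comp_part simp: comp_outside homog_0)

lemma comp_elts: "graded_domain R \<Longrightarrow> x \<in> elts R \<Longrightarrow> component R x \<alpha> \<in> elts R"
  by (rule homog_subset[OF _ comp_homog])

lemma sum_comp_superset:
  assumes "graded_domain R" "x \<in> elts R" "finite F" "{\<alpha>. component R x \<alpha> \<noteq> 0} \<subseteq> F"
  shows "(\<Sum>\<alpha>\<in>F. component R x \<alpha>) = x"
  using sum.mono_neutral_left[OF assms(3,4), of "component R x"] sum_comp[OF assms(1,2)] by auto

lemma comp_add:
  assumes R: "graded_domain R" and x: "x \<in> elts R" and y: "y \<in> elts R"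
  shows "component R (x + y) \<alpha> = component R x \<alpha> + component R y \<alpha>"
proof -
  let ?c = "\<lambda>\<alpha>. component R x \<alpha> + component R y \<alpha>"
  let ?F = "{\<alpha>. component R x \<alpha> \<noteq> 0} \<union> {\<alpha>. component R y \<alpha> \<noteq> 0}"
  have F: "finite ?F" using comp_finite[OF R] x y by blast
  have sub: "{\<alpha>. ?c \<alpha> \<noteq> 0} \<subseteq> ?F" by auto
  have "(\<Sum>\<alpha> | ?c \<alpha> \<noteq> 0. ?c \<alpha>) = (\<Sum>\<alpha>\<in>?F. ?c \<alpha>)"
    by (rule sum.mono_neutral_left[OF F sub]) auto
  also have "\<dots> = x + y"
    unfolding sum.distrib using sum_comp_superset[OF R x F] sum_comp_superset[OF R y F] by auto
  finally have "is_decomposition R (x + y) ?c"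
    using finite_subset[OF sub F] part_add[OF R] comp_part[OF R] comp_outside[OF R] x y
    by (auto simp: is_decomposition_def)
  then have "component R (x + y) = ?c"
    by (rule comp_eqI[OF R subring_add[OF graded_subring[OF R] x y]])
  then show ?thesis by simp
qed

lemma comp_of_homog:
  assumes R: "graded_domain R" and a: "\<alpha> \<in> degs R" "a \<in> part R \<alpha>"
  shows "component R a \<beta> = (if \<beta> = \<alpha> then a else 0)"
proof -
  let ?c = "\<lambda>\<beta>. if \<beta> = \<alpha> then a else 0"
  have "{\<beta>. ?c \<beta> \<noteq> 0} = (if a = 0 then {} else {\<alpha>})" by auto
  then have "is_decomposition R a ?c"
    using a part_0[OF R] by (auto simp: is_decomposition_def)
  then have "component R a = ?c" by (rule comp_eqI[OF R part_subset[OF R a]])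
  then show ?thesis by simp
qed

lemma comp_0: "graded_domain R \<Longrightarrow> component R 0 \<alpha> = 0"
  using comp_of_homog[of R 0 0] part_0[of R 0] monoid_0[of "degs R"] graded_degs[of R] by auto

lemma comp_sum:
  assumes R: "graded_domain R" and "\<And>i. i \<in> F \<Longrightarrow> f i \<in> elts R"
  shows "component R (sum f F) \<alpha> = (\<Sum>i\<in>F. component R (f i) \<alpha>)"
  using assms(2)
  by (induction F rule: infinite_finite_induct)
    (auto simp: comp_0[OF R] comp_add[OF R] subring_sum[OF graded_subring[OF R]])

lemma mem_aspan_comp:
  assumes R: "graded_domain R" and x: "x \<in> elts R" and "\<And>\<alpha>. component R x \<alpha> \<in> X"
  shows "x \<in> aspan X"
proof -
  have "(\<Sum>\<alpha> | component R x \<alpha> \<noteq> 0. component R x \<alpha>) \<in> aspan X"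
    by (intro aspan_sum aspan_base assms)
  then show ?thesis by (simp add: sum_comp[OF R x])
qed

lemma elts_eq_aspan: "graded_domain R \<Longrightarrow> elts R = aspan (homog R)"
  using mem_aspan_comp[of R _ "homog R"] comp_homog[of R] homog_subset[of R]
    subring_aspan[OF graded_subring, of R "homog R"] by blast

text \<open>
  A component of a sum of homogeneous elements of \<open>B\<close> collects those summands that have the given degree,
  so it lies in \<open>B\<close>.
\<close>

lemma comp_closed:
  assumes R: "graded_domain R" and x: "x \<in> aspan (B \<inter> homog R)" and B: "0 \<in> B" "\<And>x y. x \<in> B \<Longrightarrow> y \<in> B \<Longrightarrow> x + y \<in> B"
  shows "component R x \<alpha> \<in> B"
  using x
proof induction
  case aspan_0
  then show ?case by (simp add: comp_0[OF R] B)
next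
  case (aspan_step x y)
  then obtain \<beta> where x: "x \<in> B" "\<beta> \<in> degs R" "x \<in> part R \<beta>" by (auto elim: homogE)
  have "y \<in> elts R"
    using aspan_step(2) subring_aspan[OF graded_subring[OF R], of "B \<inter> homog R"] homog_subset[OF R] by blast
  then show ?case
    using x aspan_step.IH B part_subset[OF R x(2,3)] by (simp add: comp_add[OF R] comp_of_homog[OF R x(2,3)])
qed

text \<open>
  Take a nonzero component \<open>x\<close> of \<open>1\<close>, of degree \<open>\<alpha>\<close>, and compare the components of degree \<open>\<alpha>\<close> in
  \<open>x = x 1\<close>. By cancellation in the monoid only the component \<open>e\<close> of \<open>1\<close> in degree \<open>0\<close> contributes on
  the right, so \<open>x = x e\<close> and \<open>e = 1\<close>.
\<close>

lemma one_part_zero: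
  assumes R: "graded_domain R"
  shows "1 \<in> part R 0"
proof -
  have \<Gamma>: "grading_monoid (degs R)" by (rule graded_degs[OF R])
  have one: "1 \<in> elts R" by (rule subring_1[OF graded_subring[OF R]])
  let ?c = "component R 1"
  have "\<exists>\<alpha>. ?c \<alpha> \<noteq> 0"
  proof (rule ccontr)
    assume "\<not> ?thesis"
    then show False using sum_comp[OF R one] by simp
  qed
  then obtain \<alpha> where \<alpha>: "?c \<alpha> \<noteq> 0" by blast
  have \<alpha>d: "\<alpha> \<in> degs R" using comp_degs[OF R one \<alpha>] .
  let ?x = "?c \<alpha>"
  have x: "?x \<in> part R \<alpha>" "?x \<in> elts R" using comp_part[OF R one \<alpha>d] comp_elts[OF R one] by auto
  have product: "component R (?x * ?c \<beta>) \<alpha> = (if \<beta> = 0 then ?x * ?c 0 else 0)" if "?c \<beta> \<noteq> 0" for \<beta>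
  proof -
    have \<beta>: "\<beta> \<in> degs R" by (rule comp_degs[OF R one that])
    have "component R (?x * ?c \<beta>) \<alpha> = (if \<alpha> = \<alpha> + \<beta> then ?x * ?c \<beta> else 0)"
      by (rule comp_of_homog[OF R monoid_add[OF \<Gamma> \<alpha>d \<beta>] part_mult[OF R \<alpha>d \<beta> x(1) comp_part[OF R one \<beta>]]])
    moreover have "\<alpha> = \<alpha> + \<beta> \<longleftrightarrow> \<beta> = 0"
      using monoid_cancel[OF \<Gamma> \<beta> monoid_0[OF \<Gamma>] \<alpha>d] by (auto simp: add.commute)
    ultimately show ?thesis by simp
  qed
  have "?x = component R (?x * 1) \<alpha>" using comp_of_homog[OF R \<alpha>d x(1)] by simp
  also have "?x * 1 = (\<Sum>\<beta> | ?c \<beta> \<noteq> 0. ?x * ?c \<beta>)"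
    using sum_comp[OF R one] by (simp flip: sum_distrib_left)
  also have "component R \<dots> \<alpha> = (\<Sum>\<beta> | ?c \<beta> \<noteq> 0. component R (?x * ?c \<beta>) \<alpha>)"
    by (rule comp_sum[OF R]) (auto intro!: subring_mult[OF graded_subring[OF R]] comp_elts[OF R one])
  also have "\<dots> = (\<Sum>\<beta> | ?c \<beta> \<noteq> 0. if \<beta> = 0 then ?x * ?c 0 else 0)"
    by (rule sum.cong) (auto simp: product)
  also have "\<dots> = ?x * ?c 0"
    using comp_finite[OF R one] by (simp add: sum.delta)
  finally have "?x * (1 - ?c 0) = 0" by (simp add: right_diff_distrib)
  then have "1 - ?c 0 = 0"
    using graded_no_zero_divisors[OF R x(2), of "1 - ?c 0"] \<alpha>
      subring_diff[OF graded_subring[OF R] one comp_elts[OF R one]] by blast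
  then have "?c 0 = 1" by simp
  then show ?thesis using comp_part[OF R one monoid_0[OF \<Gamma>]] by simp
qed

lemma homog_1: "graded_domain R \<Longrightarrow> 1 \<in> homog R"
  by (blast intro: homogI one_part_zero monoid_0 graded_degs)

lemma aspan_homog_ideal:
  assumes R: "graded_domain R" and I: "is_ideal (elts R) I"
  shows "is_ideal (elts R) (aspan (I \<inter> homog R))" and "aspan (I \<inter> homog R) \<subseteq> I"
proof -
  show sub: "aspan (I \<inter> homog R) \<subseteq> I" by (rule ideal_aspan[OF I]) blast
  have "a * x \<in> aspan (I \<inter> homog R)" if "a \<in> elts R" "x \<in> aspan (I \<inter> homog R)" for a x
    using that(2)
  proof (rule aspan_mult)
    fix y assume y: "y \<in> I \<inter> homog R"
    have "a \<in> aspan (homog R)" using that(1) elts_eq_aspan[OF R] by blast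
    then have "y * a \<in> aspan (I \<inter> homog R)"
    proof (rule aspan_mult)
      fix b assume "b \<in> homog R"
      then show "y * b \<in> aspan (I \<inter> homog R)"
        using y ideal_mult[OF I homog_subset[OF R]] homog_mult[OF R]
        by (intro aspan_base) (auto simp: mult.commute)
    qed
    then show "a * y \<in> aspan (I \<inter> homog R)" by (simp add: mult.commute)
  qed
  then show "is_ideal (elts R) (aspan (I \<inter> homog R))"
    using sub ideal_subset[OF I] unfolding is_ideal_def[of _ "aspan _"] by (blast intro: aspan_0 aspan_add)
qed

text \<open>
  Multiples of homogeneous generators split into homogeneous multiples, so an ideal with homogeneous
  generators is even additively spanned by its homogeneous elements. This form is used from here on.
\<close>

lemma homogeneous_ideal_iff:
  assumes R: "graded_domain R"
  shows "homogeneous_ideal R I \<longleftrightarrow> is_ideal (elts R) I \<and> I \<subseteq> aspan (I \<inter> homog R)"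
proof -
  have A: "is_subring (elts R)" by (rule graded_subring[OF R])
  interpret cring "ring_of R" using A by (simp add: cring_ring_of_iff)
  show ?thesis
  proof
    assume "homogeneous_ideal R I"
    then obtain S where S: "S \<subseteq> homog R" "I = genideal (ring_of R) S" and I: "is_ideal (elts R) I"
      unfolding homogeneous_ideal_def ideal_ring_of[OF A] by blast
    have "S \<subseteq> I" unfolding S(2) by (rule genideal_self) (use S(1) homog_subset[OF R] in auto)
    then have "S \<subseteq> aspan (I \<inter> homog R)" using S(1) aspan_base by blast
    then have "genideal (ring_of R) S \<subseteq> aspan (I \<inter> homog R)"
      by (intro genideal_minimal) (auto simp: ideal_ring_of[OF A] aspan_homog_ideal(1)[OF R I])
    then show "is_ideal (elts R) I \<and> I \<subseteq> aspan (I \<inter> homog R)" using S(2) I by simp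
  next
    assume I: "is_ideal (elts R) I \<and> I \<subseteq> aspan (I \<inter> homog R)"
    have gen: "is_ideal (elts R) (genideal (ring_of R) (I \<inter> homog R))"
      using genideal_ideal[of "I \<inter> homog R"] homog_subset[OF R] by (auto simp: ideal_ring_of[OF A])
    have "I \<inter> homog R \<subseteq> genideal (ring_of R) (I \<inter> homog R)"
      by (rule genideal_self) (use homog_subset[OF R] in auto)
    then have "aspan (I \<inter> homog R) \<subseteq> genideal (ring_of R) (I \<inter> homog R)"
      by (rule ideal_aspan[OF gen])
    moreover have "genideal (ring_of R) (I \<inter> homog R) \<subseteq> I"
      by (rule genideal_minimal) (use I in \<open>auto simp: ideal_ring_of[OF A]\<close>)
    ultimately show "homogeneous_ideal R I"
      using I unfolding homogeneous_ideal_def ideal_ring_of[OF A] by blast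
  qed
qed

lemma spec_h_iff:
  assumes R: "graded_domain R"
  shows "P \<in> spec_h R \<longleftrightarrow> is_ideal (elts R) P \<and> 1 \<notin> P \<and>
    (\<forall>x\<in>elts R. \<forall>y\<in>elts R. x * y \<in> P \<longrightarrow> x \<in> P \<or> y \<in> P) \<and> P \<subseteq> aspan (P \<inter> homog R)"
proof -
  have A: "is_subring (elts R)" by (rule graded_subring[OF R])
  have "elts R \<noteq> P \<longleftrightarrow> 1 \<notin> P" if "is_ideal (elts R) P"
    using ideal_mult[OF that, of _ 1] ideal_subset[OF that] subring_1[OF A] by auto
  then show ?thesis
    using A by (auto simp: spec_h_def homogeneous_ideal_iff[OF R] primeideal_def primeideal_axioms_def
        ideal_ring_of[OF A] cring_ring_of_iff)
qed

lemma
  assumes "graded_domain R" "P \<in> spec_h R"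
  shows spec_ideal: "is_ideal (elts R) P"
    and spec_one: "1 \<notin> P"
    and spec_prime: "x \<in> elts R \<Longrightarrow> y \<in> elts R \<Longrightarrow> x * y \<in> P \<Longrightarrow> x \<in> P \<or> y \<in> P"
    and spec_span: "P \<subseteq> aspan (P \<inter> homog R)"
  using assms(2) unfolding spec_h_iff[OF assms(1)] by blast+

lemma spec_comp:
  assumes R: "graded_domain R" and P: "P \<in> spec_h R" and x: "x \<in> P"
  shows "component R x \<alpha> \<in> P"
  using comp_closed[OF R, of x P] spec_span[OF R P] x ideal_0[OF spec_ideal[OF R P]]
    ideal_add[OF spec_ideal[OF R P]] by blast

lemma spec_power:
  assumes R: "graded_domain R" and P: "P \<in> spec_h R" and "x \<in> elts R" "x ^ n \<in> P"
  shows "x \<in> P"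
  using assms(4)
proof (induction n)
  case 0
  then show ?case using spec_one[OF R P] by simp
next
  case (Suc n)
  then show ?case
    using spec_prime[OF R P assms(3) subring_power[OF graded_subring[OF R] assms(3)]] by auto
qed

text \<open>
  Inclusions between a homogeneous prime and an ideal, of the same ring or of an extension, can be
  checked on homogeneous elements.
\<close>

lemma spec_homog_subset:
  assumes R: "graded_domain R" and P: "P \<in> spec_h R" and "is_ideal A Q" "P \<inter> homog R \<subseteq> Q"
  shows "P \<subseteq> Q"
  using spec_span[OF R P] ideal_aspan[OF assms(3,4)] by blast

text \<open>
  An integral equation over \<open>I \<subseteq> P\<close> puts a power of \<open>z\<close> into \<open>P\<close>.
\<close>

lemma integral_over_spec:
  assumes R: "graded_domain R" and P: "P \<in> spec_h R" and "integral_over I z" "I \<subseteq> P" "z \<in> elts R"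
  shows "z \<in> P"
  using integral_over_imp_power_mem[OF graded_subring[OF R] spec_ideal[OF R P]
      integral_over_mono[OF assms(3,4)] assms(5)] spec_power[OF R P assms(5)] by blast

section \<open>Existence of homogeneous primes\<close>

lemma chain_union_ideal:
  assumes "\<C> \<noteq> {}" "\<And>X Y. X \<in> \<C> \<Longrightarrow> Y \<in> \<C> \<Longrightarrow> X \<subseteq> Y \<or> Y \<subseteq> X" "\<And>X. X \<in> \<C> \<Longrightarrow> is_ideal A X"
  shows "is_ideal A (\<Union>\<C>)"
  unfolding is_ideal_def
proof (intro conjI ballI)
  show "\<Union>\<C> \<subseteq> A" using ideal_subset[OF assms(3)] by blast
  show "0 \<in> \<Union>\<C>" using assms(1,3) by (auto simp: is_ideal_def)
  show "a * x \<in> \<Union>\<C>" if "a \<in> A" "x \<in> \<Union>\<C>" for a x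
    using that ideal_mult[OF assms(3)] by blast
  show "x + y \<in> \<Union>\<C>" if xy: "x \<in> \<Union>\<C>" "y \<in> \<Union>\<C>" for x y
  proof -
    obtain X Y where "X \<in> \<C>" "Y \<in> \<C>" "x \<in> X" "y \<in> Y" using xy by blast
    moreover from this have "X \<subseteq> Y \<or> Y \<subseteq> X" using assms(2) by blast
    ultimately obtain Z where "Z \<in> \<C>" "x \<in> Z" "y \<in> Z" by blast
    then show ?thesis using ideal_add[OF assms(3)] by blast
  qed
qed

lemma prime_ideal_exists:
  assumes A: "is_subring A" and I: "is_ideal A I" and S: "S \<subseteq> A" "1 \<in> S" "\<And>x y. x \<in> S \<Longrightarrow> y \<in> S \<Longrightarrow> x * y \<in> S"
    and disj: "I \<inter> S = {}"
  shows "\<exists>Q. is_ideal A Q \<and> I \<subseteq> Q \<and> Q \<inter> S = {} \<and> (\<forall>x\<in>A. \<forall>y\<in>A. x * y \<in> Q \<longrightarrow> x \<in> Q \<or> y \<in> Q)"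
proof -
  let ?\<A> = "{J. is_ideal A J \<and> I \<subseteq> J \<and> J \<inter> S = {}}"
  have "\<exists>Q\<in>?\<A>. \<forall>X\<in>?\<A>. Q \<subseteq> X \<longrightarrow> X = Q"
  proof (rule subset_Zorn_nonempty)
    show "?\<A> \<noteq> {}" using I disj by blast
    fix \<C> assume C: "\<C> \<noteq> {}" "subset.chain ?\<A> \<C>"
    then have "is_ideal A (\<Union>\<C>)"
      by (intro chain_union_ideal) (auto simp: subset_chain_def)
    then show "\<Union>\<C> \<in> ?\<A>" using C by (auto simp: subset_chain_def)
  qed
  then obtain Q where QA: "Q \<in> ?\<A>" and maximal: "\<forall>X\<in>?\<A>. Q \<subseteq> X \<longrightarrow> X = Q" ..
  from QA have Q: "is_ideal A Q" "I \<subseteq> Q" "Q \<inter> S = {}" by simp_all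
  have max: "X = Q" if "is_ideal A X" "I \<subseteq> X" "X \<inter> S = {}" "Q \<subseteq> X" for X
    using bspec[OF maximal, of X] that by simp
  have meet: "\<exists>q\<in>Q. \<exists>a\<in>A. q + a * x \<in> S" if x: "x \<in> A" "x \<notin> Q" for x
  proof (rule ccontr)
    assume no: "\<not> ?thesis"
    let ?X = "{q + a * x | q a. q \<in> Q \<and> a \<in> A}"
    have "is_ideal A ?X"
      unfolding is_ideal_def
    proof (intro conjI ballI subsetI)
      show "y \<in> A" if "y \<in> ?X" for y
        using that x(1) ideal_subset[OF Q(1)] by (auto intro!: subring_add[OF A] subring_mult[OF A])
      have "0 = 0 + 0 * x" by simp
      then show "0 \<in> ?X" using ideal_0[OF Q(1)] subring_0[OF A] by blast
      show "y + z \<in> ?X" if yz: "y \<in> ?X" "z \<in> ?X" for y z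
      proof -
        obtain p a q b where *: "y = p + a * x" "z = q + b * x" "p \<in> Q" "q \<in> Q" "a \<in> A" "b \<in> A" using yz by blast
        have "y + z = (p + q) + (a + b) * x" by (simp add: * algebra_simps)
        then show ?thesis using * ideal_add[OF Q(1)] subring_add[OF A] by blast
      qed
      show "b * y \<in> ?X" if bm: "b \<in> A" "y \<in> ?X" for b y
      proof -
        obtain p a where *: "y = p + a * x" "p \<in> Q" "a \<in> A" using bm by blast
        have "b * y = b * p + (b * a) * x" by (simp add: * algebra_simps)
        then show ?thesis using * bm(1) ideal_mult[OF Q(1)] subring_mult[OF A] by blast
      qed
    qed
    moreover have "Q \<subseteq> ?X"
    proof
      fix q assume "q \<in> Q"
      moreover have "q = q + 0 * x" by simp
      ultimately show "q \<in> ?X" using subring_0[OF A] by blast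
    qed
    moreover have "?X \<inter> S = {}" using no by blast
    ultimately have "?X = Q" using Q(2) by (intro max) (simp_all add: subset_trans[OF Q(2)])
    moreover have "x \<in> ?X" using ideal_0[OF Q(1)] subring_1[OF A] by force
    ultimately show False using x(2) by blast
  qed
  have "x \<in> Q \<or> y \<in> Q" if xy: "x \<in> A" "y \<in> A" "x * y \<in> Q" for x y
  proof (rule ccontr)
    assume no: "\<not> ?thesis"
    obtain p a where p: "p \<in> Q" "a \<in> A" "p + a * x \<in> S" using meet[OF xy(1)] no by blast
    obtain q b where q: "q \<in> Q" "b \<in> A" "q + b * y \<in> S" using meet[OF xy(2)] no by blast
    have "q + b * y \<in> A" "a * x \<in> A" "a * b \<in> A"
      using p q xy S(1) subring_mult[OF A] by auto
    then have "(q + b * y) * p + ((a * x) * q + (a * b) * (x * y)) \<in> Q"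
      using p(1) q(1) xy(3) ideal_mult[OF Q(1)] ideal_add[OF Q(1)] by simp
    moreover have "(p + a * x) * (q + b * y) = (q + b * y) * p + ((a * x) * q + (a * b) * (x * y))"
      by (simp add: algebra_simps)
    ultimately show False using S(3)[OF p(3) q(3)] Q(3) by auto
  qed
  then show ?thesis using Q by blast
qed

text \<open>
  Suppose \<open>x y\<close> lies in the homogeneous part of \<open>Q\<close>, but neither factor does. Among the degrees in which
  \<open>x\<close> and \<open>y\<close> have components outside \<open>Q\<close>, choose a pair \<open>\<alpha>\<close>, \<open>\<beta>\<close> whose sum is attained only once.
  Modulo \<open>Q\<close>, the component of \<open>x y\<close> in degree \<open>\<alpha> + \<beta>\<close> is then the product of the components of \<open>x\<close>
  and \<open>y\<close> in these degrees, which is not in \<open>Q\<close>.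
\<close>

lemma homogeneous_core_prime:
  assumes R: "graded_domain R" and Q: "is_ideal (elts R) Q" "1 \<notin> Q"
    and prime: "\<And>x y. x \<in> elts R \<Longrightarrow> y \<in> elts R \<Longrightarrow> x * y \<in> Q \<Longrightarrow> x \<in> Q \<or> y \<in> Q"
  shows "aspan (Q \<inter> homog R) \<in> spec_h R"
proof -
  let ?P = "aspan (Q \<inter> homog R)"
  note A = graded_subring[OF R]
  have P: "is_ideal (elts R) ?P" "?P \<subseteq> Q" using aspan_homog_ideal[OF R Q(1)] by blast+
  have compP: "component R z \<alpha> \<in> Q" if "z \<in> ?P" for z \<alpha>
    by (rule comp_closed[OF R that ideal_0[OF Q(1)] ideal_add[OF Q(1)]])
  have inP: "z \<in> ?P" if "z \<in> elts R" "\<And>\<alpha>. component R z \<alpha> \<in> Q" for z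
    using that comp_homog[OF R] by (intro mem_aspan_comp[OF R]) auto
  have "x \<in> ?P \<or> y \<in> ?P" if x: "x \<in> elts R" and y: "y \<in> elts R" and xy: "x * y \<in> ?P" for x y
  proof (rule ccontr)
    assume "\<not> ?thesis"
    then have ne: "{\<alpha>. component R x \<alpha> \<notin> Q} \<noteq> {}" "{\<alpha>. component R y \<alpha> \<notin> Q} \<noteq> {}"
      using inP x y by blast+
    have fin: "finite {\<alpha>. component R z \<alpha> \<notin> Q}" "{\<alpha>. component R z \<alpha> \<notin> Q} \<subseteq> degs R" if "z \<in> elts R" for z
      using comp_finite[OF R that] comp_outside[OF R that] ideal_0[OF Q(1)]
      by (auto elim!: finite_subset[rotated]) (metis)+
    obtain \<alpha> \<beta> where ab: "component R x \<alpha> \<notin> Q" "component R y \<beta> \<notin> Q"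
      and uniq: "\<And>\<alpha>' \<beta>'. component R x \<alpha>' \<notin> Q \<Longrightarrow> component R y \<beta>' \<notin> Q \<Longrightarrow> \<alpha>' + \<beta>' = \<alpha> + \<beta> \<Longrightarrow> \<alpha>' = \<alpha> \<and> \<beta>' = \<beta>"
      using unique_sum[OF graded_degs[OF R] fin(1)[OF x] ne(1) fin(2)[OF x] fin(1)[OF y] ne(2) fin(2)[OF y]]
      by blast
    let ?X = "{\<alpha>. component R x \<alpha> \<noteq> 0}" and ?Y = "{\<alpha>. component R y \<alpha> \<noteq> 0}"
    define t where "t p = component R (component R x (fst p) * component R y (snd p)) (\<alpha> + \<beta>)" for p
    have t: "t p = (if \<alpha> + \<beta> = fst p + snd p then component R x (fst p) * component R y (snd p) else 0)"
      if "p \<in> ?X \<times> ?Y" for p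
      unfolding t_def using that comp_degs[OF R x] comp_degs[OF R y]
      by (intro comp_of_homog[OF R] monoid_add[OF graded_degs[OF R]] part_mult[OF R] comp_part[OF R] x y) auto
    have F: "finite (?X \<times> ?Y)" using comp_finite[OF R] x y by blast
    have in_F: "(\<alpha>, \<beta>) \<in> ?X \<times> ?Y" using ab ideal_0[OF Q(1)] by auto
    have "x * y = (\<Sum>\<alpha>\<in>?X. component R x \<alpha>) * (\<Sum>\<beta>\<in>?Y. component R y \<beta>)"
      by (simp only: sum_comp[OF R x] sum_comp[OF R y])
    also have "\<dots> = (\<Sum>p\<in>?X \<times> ?Y. component R x (fst p) * component R y (snd p))"
      by (simp add: sum_product sum.cartesian_product case_prod_unfold)
    finally have "x * y = \<dots>" .
    then have "component R (x * y) (\<alpha> + \<beta>) = (\<Sum>p\<in>?X \<times> ?Y. t p)"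
      unfolding t_def by (simp add: comp_sum[OF R] subring_mult[OF A] comp_elts[OF R x] comp_elts[OF R y])
    also have "\<dots> = t (\<alpha>, \<beta>) + (\<Sum>p\<in>?X \<times> ?Y - {(\<alpha>, \<beta>)}. t p)"
      by (rule sum.remove[OF F in_F])
    finally have "t (\<alpha>, \<beta>) = component R (x * y) (\<alpha> + \<beta>) - (\<Sum>p\<in>?X \<times> ?Y - {(\<alpha>, \<beta>)}. t p)" by simp
    moreover have "t p \<in> Q" if "p \<in> ?X \<times> ?Y - {(\<alpha>, \<beta>)}" for p
    proof (cases "\<alpha> + \<beta> = fst p + snd p")
      case True
      then have "component R x (fst p) \<in> Q \<or> component R y (snd p) \<in> Q"
        using uniq[of "fst p" "snd p"] that by (auto simp: prod_eq_iff)
      then have "component R x (fst p) * component R y (snd p) \<in> Q"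
      proof
        assume "component R x (fst p) \<in> Q"
        from ideal_mult[OF Q(1) comp_elts[OF R y, of "snd p"] this] show ?thesis by (simp add: mult.commute)
      next
        assume "component R y (snd p) \<in> Q"
        from ideal_mult[OF Q(1) comp_elts[OF R x] this] show ?thesis .
      qed
      then show ?thesis using t[of p] that True by simp
    next
      case False
      then show ?thesis using t[of p] that ideal_0[OF Q(1)] by simp
    qed
    ultimately have "t (\<alpha>, \<beta>) \<in> Q"
      using compP[OF xy] by (auto intro!: ideal_diff[OF A Q(1)] ideal_sum[OF Q(1)])
    then have "component R x \<alpha> * component R y \<beta> \<in> Q" using t[OF in_F] by simp
    then show False using prime ab comp_elts[OF R] x y by blast
  qed
  moreover have "?P \<inter> homog R = Q \<inter> homog R" using P(2) aspan_base by blast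
  ultimately show ?thesis
    unfolding spec_h_iff[OF R] using P Q(2) by auto
qed

text \<open>
  The homogeneous part of an ordinary prime containing \<open>I\<close> and avoiding \<open>S\<close>. It is applied to ideals of
  elements integral over a prime, which are not visibly generated by homogeneous elements; so only the
  homogeneous elements of \<open>I\<close> are claimed to lie in the new prime.
\<close>

lemma homogeneous_prime_exists:
  assumes R: "graded_domain R" and I: "is_ideal (elts R) I"
    and S: "S \<subseteq> elts R" "1 \<in> S" "\<And>x y. x \<in> S \<Longrightarrow> y \<in> S \<Longrightarrow> x * y \<in> S" and disj: "I \<inter> S = {}"
  shows "\<exists>Q\<in>spec_h R. I \<inter> homog R \<subseteq> Q \<and> Q \<inter> S = {}"
proof -
  obtain Q where Q: "is_ideal (elts R) Q" "I \<subseteq> Q" "Q \<inter> S = {}"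
    "\<forall>x\<in>elts R. \<forall>y\<in>elts R. x * y \<in> Q \<longrightarrow> x \<in> Q \<or> y \<in> Q"
    using prime_ideal_exists[OF graded_subring[OF R] I S disj] by blast
  have "1 \<notin> Q" using Q(3) S(2) by blast
  then have "aspan (Q \<inter> homog R) \<in> spec_h R"
    using homogeneous_core_prime[OF R Q(1)] Q(4) by blast
  moreover have "aspan (Q \<inter> homog R) \<subseteq> Q" by (rule aspan_homog_ideal(2)[OF R Q(1)])
  ultimately show ?thesis using Q(2,3) by (intro bexI[of _ "aspan (Q \<inter> homog R)"]) (auto intro: aspan_base)
qed

section \<open>Extensions of graded domains\<close>

lemma subring_ring_of:
  assumes A: "is_subring (elts R)"
  shows "subring B (ring_of R) \<longleftrightarrow> B \<subseteq> elts R \<and> is_subring B"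
proof -
  have R: "cring (ring_of R)" using A by (simp add: cring_ring_of_iff)
  interpret cring "ring_of R" by fact
  have inv: "\<ominus>\<^bsub>ring_of R\<^esub> x = - x" if "x \<in> elts R" for x by (rule ring_of_minus[OF R that])
  show ?thesis
  proof
    assume B: "subring B (ring_of R)"
    have sub: "B \<subseteq> elts R" using subringE(1)[OF B] by simp
    have "- x \<in> B" if "x \<in> B" for x
      using subringE(5)[OF B that] inv[of x] that sub by (simp add: subset_iff)
    then have "x - y \<in> B" if "x \<in> B" "y \<in> B" for x y
      using subringE(7)[OF B that(1), of "- y"] that by simp
    then show "B \<subseteq> elts R \<and> is_subring B"
      using sub subringE(3)[OF B] subringE(6)[OF B] by (simp add: is_subring_def)
  next
    assume B: "B \<subseteq> elts R \<and> is_subring B"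
    show "subring B (ring_of R)"
      using B inv by (intro subringI) (auto simp: subset_iff subring_uminus subring_1 subring_mult subring_add)
  qed
qed

lemma
  assumes "graded_extension R T"
  shows ext_base: "graded_domain R" and ext_top: "graded_domain T"
    and ext_elts: "x \<in> elts R \<Longrightarrow> x \<in> elts T"
    and ext_degs: "\<alpha> \<in> degs R \<Longrightarrow> \<alpha> \<in> degs T"
    and ext_part: "\<alpha> \<in> degs R \<Longrightarrow> a \<in> part R \<alpha> \<Longrightarrow> a \<in> part T \<alpha>"
  using assms subring_ring_of[OF graded_subring, of T] unfolding graded_extension_def by blast+

lemma ext_homog: "graded_extension R T \<Longrightarrow> a \<in> homog R \<Longrightarrow> a \<in> homog T"
  by (auto elim!: homogE intro: homogI ext_degs ext_part)

lemma ext_component: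
  assumes ext: "graded_extension R T" and x: "x \<in> elts R"
  shows "component T x = component R x"
proof -
  note R = ext_base[OF ext] and T = ext_top[OF ext]
  have "component R x \<alpha> \<in> part T \<alpha>" if "\<alpha> \<in> degs T" for \<alpha>
    using that ext_part[OF ext _ comp_part[OF R x]] comp_outside[OF R x] part_0[OF T that]
    by (cases "\<alpha> \<in> degs R") auto
  moreover have "component R x \<alpha> = 0" if "\<alpha> \<notin> degs T" for \<alpha>
    using that ext_degs[OF ext] comp_outside[OF R x] by blast
  ultimately have "is_decomposition T x (component R x)"
    using comp_finite[OF R x] sum_comp[OF R x] by (simp add: is_decomposition_def)
  then show ?thesis by (rule comp_eqI[OF T ext_elts[OF ext x]])
qed

lemma spec_contraction:
  assumes ext: "graded_extension R T" and Q: "Q \<in> spec_h T"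
  shows "Q \<inter> elts R \<in> spec_h R"
proof -
  note R = ext_base[OF ext] and T = ext_top[OF ext]
  have "is_ideal (elts R) (Q \<inter> elts R)"
    using spec_ideal[OF T Q] graded_subring[OF R] ext_elts[OF ext]
    by (auto simp: is_ideal_def intro: subring_0 subring_add subring_mult)
  moreover have "Q \<inter> elts R \<subseteq> aspan (Q \<inter> elts R \<inter> homog R)"
  proof
    fix x assume x: "x \<in> Q \<inter> elts R"
    then have "component R x \<alpha> \<in> Q" for \<alpha>
      using spec_comp[OF T Q, of x] ext_component[OF ext, of x] by auto
    then show "x \<in> aspan (Q \<inter> elts R \<inter> homog R)"
      using x comp_homog[OF R] comp_elts[OF R] by (intro mem_aspan_comp[OF R]) auto
  qed
  ultimately show ?thesis
    using spec_one[OF T Q] spec_prime[OF T Q] ext_elts[OF ext] unfolding spec_h_iff[OF R] by blast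
qed

lemma integral_extension_iff:
  assumes "is_subring (elts R)"
  shows "integral_extension R T \<longleftrightarrow> (\<forall>t\<in>elts T. integral_over (elts R) t)"
proof -
  have "(\<exists>p. lead_coeff p = 1 \<and> (\<forall>i. coeff p i \<in> elts R) \<and> poly p t = 0) \<longleftrightarrow> integral_over (elts R) t" for t
    unfolding integral_over_iff_sum[OF assms ideal_self[OF assms]]
  proof
    assume "\<exists>p. lead_coeff p = 1 \<and> (\<forall>i. coeff p i \<in> elts R) \<and> poly p t = 0"
    then obtain p where p: "lead_coeff p = 1" "\<forall>i. coeff p i \<in> elts R" "poly p t = 0" by blast
    then have "t ^ degree p + (\<Sum>i<degree p. coeff p i * t ^ i) = 0"
      by (simp add: poly_altdef lessThan_Suc_atMost[symmetric] add.commute)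
    then show "\<exists>n c. (\<forall>i. c i \<in> elts R) \<and> t ^ n + (\<Sum>i<n. c i * t ^ i) = 0" using p(2) by blast
  next
    assume "\<exists>n c. (\<forall>i. c i \<in> elts R) \<and> t ^ n + (\<Sum>i<n. c i * t ^ i) = 0"
    then obtain n c where c: "\<And>i. c i \<in> elts R" "t ^ n + (\<Sum>i<n. c i * t ^ i) = 0" by blast
    define p where "p = monom 1 n + (\<Sum>i<n. monom (c i) i)"
    have co: "coeff p k = (if k = n then 1 else if k < n then c k else 0)" for k
      by (auto simp: p_def coeff_sum)
    have "degree p = n"
      by (rule antisym[OF degree_le le_degree]) (auto simp: co)
    moreover have "poly p t = 0" using c(2) by (simp add: p_def poly_monom poly_sum)
    ultimately show "\<exists>p. lead_coeff p = 1 \<and> (\<forall>i. coeff p i \<in> elts R) \<and> poly p t = 0"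
      using c(1) subring_0[OF assms] subring_1[OF assms] by (intro exI[of _ p]) (auto simp: co)
  qed
  then show ?thesis by (simp add: integral_extension_def)
qed

lemma integral_ideal:
  assumes A: "is_subring A" and I: "is_ideal A I" and B: "is_subring B" "\<And>b. b \<in> B \<Longrightarrow> integral_over A b"
    and "I \<subseteq> B"
  shows "is_ideal B {b \<in> B. integral_over I b}"
  unfolding is_ideal_def
  using integral_over_add[OF A I] integral_over_0[OF I] subring_0[OF B(1)] subring_add[OF B(1)] subring_mult[OF B(1)]
    integral_over_mult[OF A I] B(2)
  by (auto simp: mult.commute[of _ "_ :: 'a"]) (metis mult.commute)

text \<open>
  The elements of \<open>T\<close> that are integral over \<open>P\<close> form an ideal that meets \<open>R\<close> only in \<open>P\<close>.
\<close>

lemma integral_lying_over: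
  assumes ext: "graded_extension R T" and int: "\<And>t. t \<in> elts T \<Longrightarrow> integral_over (elts R) t"
    and P: "P \<in> spec_h R"
  shows "\<exists>Q\<in>spec_h T. Q \<inter> elts R = P"
proof -
  note R = ext_base[OF ext] and T = ext_top[OF ext]
  note A = graded_subring[OF R] and B = graded_subring[OF T]
  note PI = spec_ideal[OF R P]
  let ?I = "{t \<in> elts T. integral_over P t}"
  have I: "is_ideal (elts T) ?I"
    using ideal_subset[OF PI] ext_elts[OF ext] by (intro integral_ideal[OF A PI B int]) auto
  have "?I \<inter> (elts R - P) = {}"
    using integral_over_spec[OF R P] by blast
  moreover have "x * y \<in> elts R - P" if "x \<in> elts R - P" "y \<in> elts R - P" for x y
    using that spec_prime[OF R P, of x y] subring_mult[OF A] by blast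
  moreover have "1 \<in> elts R - P" using subring_1[OF A] spec_one[OF R P] by blast
  ultimately obtain Q where Q: "Q \<in> spec_h T" "?I \<inter> homog T \<subseteq> Q" "Q \<inter> (elts R - P) = {}"
    using homogeneous_prime_exists[OF T I, of "elts R - P"] ext_elts[OF ext] by blast
  have "P \<subseteq> Q"
  proof (rule spec_homog_subset[OF R P spec_ideal[OF T Q(1)]])
    show "P \<inter> homog R \<subseteq> Q"
      using Q(2) ext_homog[OF ext] homog_subset[OF T] integral_over_self by blast
  qed
  then have "Q \<inter> elts R = P" using Q(3) ideal_subset[OF PI] by blast
  then show ?thesis using Q(1) by blast
qed

section \<open>Homogeneous overrings\<close>

lemma hquot_degs: "degs (hquot R) = {\<alpha> - \<beta> | \<alpha> \<beta>. \<alpha> \<in> degs R \<and> \<beta> \<in> degs R}"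
  by (simp add: hquot_def)

lemma hquot_part_0: "0 \<in> part (hquot R) \<gamma>"
  by (simp add: hquot_def)

lemma hquot_partI:
  "\<alpha> \<in> degs R \<Longrightarrow> \<beta> \<in> degs R \<Longrightarrow> a \<in> part R \<alpha> \<Longrightarrow> b \<in> part R \<beta> \<Longrightarrow> b \<noteq> 0 \<Longrightarrow> a / b \<in> part (hquot R) (\<alpha> - \<beta>)"
  by (cases "a = 0") (auto simp: hquot_def)

lemma hquot_partE:
  assumes "x \<in> part (hquot R) \<gamma>" "x \<noteq> 0"
  obtains \<alpha> \<beta> a b where "\<alpha> \<in> degs R" "\<beta> \<in> degs R" "a \<in> part R \<alpha>" "b \<in> part R \<beta>" "a \<noteq> 0" "b \<noteq> 0"
    "\<gamma> = \<alpha> - \<beta>" "x = a / b"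
  using assms by (auto simp: hquot_def)

lemma hquot_eltsE:
  assumes "x \<in> elts (hquot R)"
  obtains \<beta> a b where "\<beta> \<in> degs R" "a \<in> elts R" "b \<in> part R \<beta>" "b \<noteq> 0" "x = a / b"
  using assms by (auto simp: hquot_def nz_homog_def homog_def)

lemma hquot_eltsI:
  "\<beta> \<in> degs R \<Longrightarrow> a \<in> elts R \<Longrightarrow> b \<in> part R \<beta> \<Longrightarrow> b \<noteq> 0 \<Longrightarrow> a / b \<in> elts (hquot R)"
  by (auto simp: hquot_def nz_homog_def homog_def)

lemma hquot_subring:
  assumes R: "graded_domain R"
  shows "is_subring (elts (hquot R))"
  unfolding is_subring_def
proof (intro conjI ballI)
  note A = graded_subring[OF R] and \<Gamma> = graded_degs[OF R]
  show "1 \<in> elts (hquot R)"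
    using hquot_eltsI[OF monoid_0[OF \<Gamma>] subring_1[OF A] one_part_zero[OF R]] by simp
  fix x y assume "x \<in> elts (hquot R)" "y \<in> elts (hquot R)"
  then obtain \<beta> a b \<beta>' a' b' where x: "\<beta> \<in> degs R" "a \<in> elts R" "b \<in> part R \<beta>" "b \<noteq> 0" "x = a / b"
    and y: "\<beta>' \<in> degs R" "a' \<in> elts R" "b' \<in> part R \<beta>'" "b' \<noteq> 0" "y = a' / b'"
    by (metis hquot_eltsE)
  have mem: "b \<in> elts R" "b' \<in> elts R" using part_subset[OF R] x y by blast+
  have "x - y = (a * b' - a' * b) / (b * b')" "x * y = (a * a') / (b * b')"
    using x y by (auto simp: field_simps)
  then show "x - y \<in> elts (hquot R)" "x * y \<in> elts (hquot R)"
    using x y mem hquot_eltsI[OF monoid_add[OF \<Gamma> x(1) y(1)] _ part_mult[OF R x(1) y(1) x(3) y(3)]]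
    by (auto intro!: subring_diff[OF A] subring_mult[OF A])
qed

lemma hquot_part_elts:
  assumes R: "graded_domain R" and a: "a \<in> part (hquot R) \<gamma>"
  shows "a \<in> elts (hquot R)"
proof (cases "a = 0")
  case True
  then show ?thesis using subring_0[OF hquot_subring[OF R]] by simp
next
  case False
  then show ?thesis using a by (elim hquot_partE) (auto intro: hquot_eltsI part_subset[OF R])
qed

lemma hquot_part_add:
  assumes R: "graded_domain R" and x: "x \<in> part (hquot R) \<gamma>" and y: "y \<in> part (hquot R) \<gamma>"
  shows "x + y \<in> part (hquot R) \<gamma>"
proof (cases "x = 0 \<or> y = 0")
  case True
  then show ?thesis using x y by auto
next
  case False
  obtain \<alpha> \<beta> a b where x: "\<alpha> \<in> degs R" "\<beta> \<in> degs R" "a \<in> part R \<alpha>" "b \<in> part R \<beta>" "b \<noteq> 0"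
    "\<gamma> = \<alpha> - \<beta>" "x = a / b"
    using hquot_partE[OF x] False by metis
  obtain \<alpha>' \<beta>' a' b' where y: "\<alpha>' \<in> degs R" "\<beta>' \<in> degs R" "a' \<in> part R \<alpha>'" "b' \<in> part R \<beta>'" "b' \<noteq> 0"
    "\<gamma> = \<alpha>' - \<beta>'" "y = a' / b'"
    using hquot_partE[OF y] False by metis
  note add = monoid_add[OF graded_degs[OF R]]
  have deg: "\<alpha>' + \<beta> = \<alpha> + \<beta>'" using x(6) y(6) by (simp add: algebra_simps)
  have "a * b' + a' * b \<in> part R (\<alpha> + \<beta>')"
    using part_mult[OF R x(1) y(2) x(3) y(4)] part_mult[OF R y(1) x(2) y(3) x(4)]
    unfolding deg by (rule part_add[OF R add[OF x(1) y(2)]])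
  then have "(a * b' + a' * b) / (b * b') \<in> part (hquot R) ((\<alpha> + \<beta>') - (\<beta> + \<beta>'))"
    using x y part_mult[OF R] add by (intro hquot_partI) auto
  moreover have "(\<alpha> + \<beta>') - (\<beta> + \<beta>') = \<gamma>" using x(6) by simp
  moreover have "x + y = (a * b' + a' * b) / (b * b')" using x y by (simp add: field_simps)
  ultimately show ?thesis by simp
qed

lemma hquot_part_uminus:
  assumes R: "graded_domain R" and x: "x \<in> part (hquot R) \<gamma>"
  shows "- x \<in> part (hquot R) \<gamma>"
proof (cases "x = 0")
  case True
  then show ?thesis using x by simp
next
  case False
  obtain \<alpha> \<beta> a b where x: "\<alpha> \<in> degs R" "\<beta> \<in> degs R" "a \<in> part R \<alpha>" "b \<in> part R \<beta>" "b \<noteq> 0"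
    "\<gamma> = \<alpha> - \<beta>" "x = a / b"
    using hquot_partE[OF x False] by metis
  then show ?thesis
    using hquot_partI[OF x(1,2) part_uminus[OF R x(1,3)] x(4,5)] by simp
qed

lemma hquot_part_mult:
  assumes R: "graded_domain R" and x: "x \<in> part (hquot R) \<gamma>" and y: "y \<in> part (hquot R) \<delta>"
  shows "x * y \<in> part (hquot R) (\<gamma> + \<delta>)"
proof (cases "x = 0 \<or> y = 0")
  case True
  then show ?thesis using hquot_part_0 by auto
next
  case False
  obtain \<alpha> \<beta> a b where x: "\<alpha> \<in> degs R" "\<beta> \<in> degs R" "a \<in> part R \<alpha>" "b \<in> part R \<beta>" "b \<noteq> 0"
    "\<gamma> = \<alpha> - \<beta>" "x = a / b"
    using hquot_partE[OF x] False by metis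
  obtain \<alpha>' \<beta>' a' b' where y: "\<alpha>' \<in> degs R" "\<beta>' \<in> degs R" "a' \<in> part R \<alpha>'" "b' \<in> part R \<beta>'" "b' \<noteq> 0"
    "\<delta> = \<alpha>' - \<beta>'" "y = a' / b'"
    using hquot_partE[OF y] False by metis
  have "(a * a') / (b * b') \<in> part (hquot R) ((\<alpha> + \<alpha>') - (\<beta> + \<beta>'))"
    using x y part_mult[OF R] monoid_add[OF graded_degs[OF R]] by (intro hquot_partI) auto
  moreover have "(\<alpha> + \<alpha>') - (\<beta> + \<beta>') = \<gamma> + \<delta>" using x(6) y(6) by simp
  ultimately show ?thesis using x(7) y(7) by simp
qed

lemma hquot_part_inverse:
  assumes x: "x \<in> part (hquot R) \<gamma>"
  shows "inverse x \<in> part (hquot R) (- \<gamma>)"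
proof (cases "x = 0")
  case True
  then show ?thesis using hquot_part_0 by auto
next
  case False
  obtain \<alpha> \<beta> a b where x: "\<alpha> \<in> degs R" "\<beta> \<in> degs R" "a \<in> part R \<alpha>" "b \<in> part R \<beta>" "a \<noteq> 0"
    "\<gamma> = \<alpha> - \<beta>" "x = a / b"
    using hquot_partE[OF x False] by metis
  then show ?thesis using hquot_partI[OF x(2,1,4,3)] by simp
qed

lemma hquot_degs_monoid:
  assumes "grading_monoid (degs R)"
  shows "grading_monoid (degs (hquot R))"
  unfolding grading_monoid_def
proof (intro conjI allI ballI impI)
  note \<Gamma> = assms
  have sub: "\<alpha> \<in> degs (hquot R)" if "\<alpha> \<in> degs R" for \<alpha>
  proof -
    have "\<alpha> = \<alpha> - 0" by simp
    then show ?thesis unfolding hquot_degs using that monoid_0[OF \<Gamma>] by blast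
  qed
  show "0 \<in> degs (hquot R)" using sub monoid_0[OF \<Gamma>] by blast
  show "degs (hquot R) \<noteq> {0}" using sub \<Gamma> unfolding grading_monoid_def by blast
next
  fix \<gamma> \<delta> assume "\<gamma> \<in> degs (hquot R)" "\<delta> \<in> degs (hquot R)"
  then obtain \<alpha> \<beta> \<alpha>' \<beta>' where *: "\<alpha> \<in> degs R" "\<beta> \<in> degs R" "\<alpha>' \<in> degs R" "\<beta>' \<in> degs R"
    "\<gamma> = \<alpha> - \<beta>" "\<delta> = \<alpha>' - \<beta>'" by (auto simp: hquot_degs)
  have "\<gamma> + \<delta> = (\<alpha> + \<alpha>') - (\<beta> + \<beta>')" by (simp add: *)
  then show "\<gamma> + \<delta> \<in> degs (hquot R)" unfolding hquot_degs using * monoid_add[OF assms] by blast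
next
  fix n :: nat and \<gamma> \<delta>
  assume "\<gamma> \<in> degs (hquot R)" "\<delta> \<in> degs (hquot R)" and n: "0 < n \<and> (\<Sum>i<n. \<gamma>) = (\<Sum>i<n. \<delta>)"
  then obtain \<alpha> \<beta> \<alpha>' \<beta>' where *: "\<alpha> \<in> degs R" "\<beta> \<in> degs R" "\<alpha>' \<in> degs R" "\<beta>' \<in> degs R"
    "\<gamma> = \<alpha> - \<beta>" "\<delta> = \<alpha>' - \<beta>'" by (auto simp: hquot_degs)
  have "(\<Sum>i<n. \<alpha> + \<beta>') = (\<Sum>i<n. \<alpha>' + \<beta>)"
    using n unfolding *(5,6) sum_subtractf sum.distrib by (simp add: algebra_simps)
  then have "\<alpha> + \<beta>' = \<alpha>' + \<beta>"
    using monoid_torsionless[OF assms, of n] n * monoid_add[OF assms] by blast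
  then show "\<gamma> = \<delta>" by (simp add: * algebra_simps)
qed auto

text \<open>
  A homogeneous denominator shared by finitely many homogeneous fractions; multiplying by it shifts all
  degrees by the same amount, which keeps different degrees apart.
\<close>

lemma common_denominator:
  assumes R: "graded_domain R" and "finite F" "\<And>\<gamma>. \<gamma> \<in> F \<Longrightarrow> d \<gamma> \<in> part (hquot R) \<gamma> \<and> d \<gamma> \<noteq> 0"
  shows "\<exists>\<beta>\<in>degs R. \<exists>b\<in>part R \<beta>. b \<noteq> 0 \<and> (\<forall>\<gamma>\<in>F. \<gamma> + \<beta> \<in> degs R \<and> b * d \<gamma> \<in> part R (\<gamma> + \<beta>))"
  using assms(2,3)
proof (induction F rule: finite_induct)
  case empty
  then show ?case using monoid_0[OF graded_degs[OF R]] one_part_zero[OF R] by (auto intro!: bexI[of _ 0] bexI[of _ 1])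
next
  case (insert \<delta> F)
  note add = monoid_add[OF graded_degs[OF R]] and mult = part_mult[OF R]
  obtain \<beta> b where b: "\<beta> \<in> degs R" "b \<in> part R \<beta>" "b \<noteq> 0"
    "\<And>\<gamma>. \<gamma> \<in> F \<Longrightarrow> \<gamma> + \<beta> \<in> degs R \<and> b * d \<gamma> \<in> part R (\<gamma> + \<beta>)"
    using insert by blast
  obtain \<alpha>' \<beta>' a' b' where d: "\<alpha>' \<in> degs R" "\<beta>' \<in> degs R" "a' \<in> part R \<alpha>'" "b' \<in> part R \<beta>'" "b' \<noteq> 0"
    "\<delta> = \<alpha>' - \<beta>'" "d \<delta> = a' / b'"
    using hquot_partE[of "d \<delta>" R \<delta>] insert.prems[of \<delta>] by (metis insertI1)
  have "\<gamma> + (\<beta> + \<beta>') \<in> degs R \<and> (b * b') * d \<gamma> \<in> part R (\<gamma> + (\<beta> + \<beta>'))" if \<gamma>: "\<gamma> \<in> insert \<delta> F" for \<gamma>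
  proof (cases "\<gamma> = \<delta>")
    case True
    have "\<delta> + (\<beta> + \<beta>') = \<beta> + \<alpha>'" "(b * b') * d \<delta> = b * a'" using d by (auto simp: algebra_simps)
    then show ?thesis using add[OF b(1) d(1)] mult[OF b(1) d(1) b(2) d(3)] unfolding True by (simp only:)
  next
    case False
    then have *: "\<gamma> + \<beta> \<in> degs R" "b * d \<gamma> \<in> part R (\<gamma> + \<beta>)" using b(4) \<gamma> by auto
    have eq: "\<gamma> + (\<beta> + \<beta>') = (\<gamma> + \<beta>) + \<beta>'" "(b * b') * d \<gamma> = (b * d \<gamma>) * b'" by (auto simp: algebra_simps)
    show ?thesis unfolding eq using add[OF *(1) d(2)] mult[OF *(1) d(2) *(2) d(4)] by blast
  qed
  then show ?case
    using add[OF b(1) d(2)] mult[OF b(1) d(2) b(2) d(4)] b(3) d(5)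
    by (intro bexI[of _ "\<beta> + \<beta>'"] bexI[of _ "b * b'"]) auto
qed

text \<open>
  After multiplication by a common denominator, a relation between homogeneous fractions of different
  degrees is a relation between homogeneous elements of \<open>R\<close> of different degrees.
\<close>

lemma hquot_independent:
  assumes R: "graded_domain R" and F: "finite F" "\<And>\<gamma>. \<gamma> \<in> F \<Longrightarrow> d \<gamma> \<in> part (hquot R) \<gamma> \<and> d \<gamma> \<noteq> 0"
    and zero: "(\<Sum>\<gamma>\<in>F. d \<gamma>) = 0"
  shows "F = {}"
proof (rule ccontr)
  assume "F \<noteq> {}"
  then obtain \<delta> where \<delta>: "\<delta> \<in> F" by blast
  obtain \<beta> b where b: "\<beta> \<in> degs R" "b \<in> part R \<beta>" "b \<noteq> 0"
    "\<And>\<gamma>. \<gamma> \<in> F \<Longrightarrow> \<gamma> + \<beta> \<in> degs R \<and> b * d \<gamma> \<in> part R (\<gamma> + \<beta>)"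
    using common_denominator[OF R F] by blast
  have "(\<Sum>\<gamma>\<in>F. b * d \<gamma>) = 0" using zero by (simp flip: sum_distrib_left)
  then have "0 = component R (\<Sum>\<gamma>\<in>F. b * d \<gamma>) (\<delta> + \<beta>)" by (simp add: comp_0[OF R])
  also have "\<dots> = (\<Sum>\<gamma>\<in>F. component R (b * d \<gamma>) (\<delta> + \<beta>))"
    using b(4) part_subset[OF R] by (intro comp_sum[OF R]) blast
  also have "\<dots> = (\<Sum>\<gamma>\<in>F. if \<gamma> = \<delta> then b * d \<gamma> else 0)"
  proof (rule sum.cong)
    fix \<gamma> assume "\<gamma> \<in> F"
    then have "component R (b * d \<gamma>) (\<delta> + \<beta>) = (if \<delta> + \<beta> = \<gamma> + \<beta> then b * d \<gamma> else 0)"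
      using b(4) by (intro comp_of_homog[OF R]) auto
    then show "component R (b * d \<gamma>) (\<delta> + \<beta>) = (if \<gamma> = \<delta> then b * d \<gamma> else 0)" by auto
  qed simp
  also have "\<dots> = b * d \<delta>" using F(1) \<delta> by simp
  finally show False using b(3) F(2)[OF \<delta>] by simp
qed

lemma hquot_decomposition:
  assumes R: "graded_domain R" and x: "x \<in> elts (hquot R)"
  shows "\<exists>!c. is_decomposition (hquot R) x c"
proof (rule ex_ex1I)
  obtain \<beta> a b where ab: "\<beta> \<in> degs R" "a \<in> elts R" "b \<in> part R \<beta>" "b \<noteq> 0" "x = a / b"
    by (rule hquot_eltsE[OF x])
  \<comment> \<open>Division by \<open>b\<close> lowers degrees by \<open>\<beta>\<close>.\<close>
  let ?c = "\<lambda>\<gamma>. component R a (\<gamma> + \<beta>) / b"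
  have "?c \<gamma> \<in> part (hquot R) \<gamma>" for \<gamma>
  proof (cases "\<gamma> + \<beta> \<in> degs R")
    case True
    then show ?thesis using hquot_partI[OF True ab(1) comp_part[OF R ab(2) True] ab(3,4)] by simp
  next
    case False
    then show ?thesis by (simp add: comp_outside[OF R ab(2)] hquot_part_0)
  qed
  moreover have "?c \<gamma> = 0" if "\<gamma> \<notin> degs (hquot R)" for \<gamma>
  proof -
    have "\<gamma> = (\<gamma> + \<beta>) - \<beta>" by simp
    then have "\<gamma> + \<beta> \<notin> degs R" using that ab(1) unfolding hquot_degs by blast
    then show ?thesis by (simp add: comp_outside[OF R ab(2)])
  qed
  moreover have supp: "{\<gamma>. ?c \<gamma> \<noteq> 0} = (\<lambda>\<alpha>. \<alpha> - \<beta>) ` {\<alpha>. component R a \<alpha> \<noteq> 0}"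
    using ab(4) by (force simp: image_iff intro: exI[of _ "x + \<beta>" for x])
  moreover have "(\<Sum>\<gamma> | ?c \<gamma> \<noteq> 0. ?c \<gamma>) = x"
  proof -
    have "(\<Sum>\<gamma> | ?c \<gamma> \<noteq> 0. ?c \<gamma>) = (\<Sum>\<alpha> | component R a \<alpha> \<noteq> 0. component R a \<alpha> / b)"
      unfolding supp by (subst sum.reindex) (auto simp: inj_on_def)
    also have "\<dots> = x" using sum_comp[OF R ab(2)] by (simp add: ab(5) flip: sum_divide_distrib)
    finally show ?thesis .
  qed
  ultimately have "is_decomposition (hquot R) x ?c"
    using comp_finite[OF R ab(2)] by (simp add: is_decomposition_def)
  then show "\<exists>c. is_decomposition (hquot R) x c" by blast
next
  fix c d assume c: "is_decomposition (hquot R) x c" and d: "is_decomposition (hquot R) x d"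
  have part: "e \<gamma> \<in> part (hquot R) \<gamma>" if "is_decomposition (hquot R) x e" for e \<gamma>
    using that hquot_part_0[of R \<gamma>] unfolding is_decomposition_def by metis
  let ?F = "{\<gamma>. c \<gamma> \<noteq> 0} \<union> {\<gamma>. d \<gamma> \<noteq> 0}"
  have F: "finite ?F" using c d by (simp add: is_decomposition_def)
  have sum: "(\<Sum>\<gamma>\<in>?F. e \<gamma>) = x" if "e = c \<or> e = d" for e
  proof -
    have "(\<Sum>\<gamma>\<in>?F. e \<gamma>) = (\<Sum>\<gamma> | e \<gamma> \<noteq> 0. e \<gamma>)"
      using that by (intro sum.mono_neutral_right[OF F]) auto
    then show ?thesis using that c d by (auto simp: is_decomposition_def)
  qed
  have "(\<Sum>\<gamma>\<in>?F. c \<gamma> - d \<gamma>) = 0" using sum[of c] sum[of d] by (simp add: sum_subtractf)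
  moreover have "(\<Sum>\<gamma>\<in>?F. c \<gamma> - d \<gamma>) = (\<Sum>\<gamma> | c \<gamma> - d \<gamma> \<noteq> 0. c \<gamma> - d \<gamma>)"
    by (rule sum.mono_neutral_right[OF F]) auto
  moreover have "finite {\<gamma>. c \<gamma> - d \<gamma> \<noteq> 0}" by (rule finite_subset[OF _ F]) auto
  moreover have "c \<gamma> - d \<gamma> \<in> part (hquot R) \<gamma>" for \<gamma>
    using hquot_part_add[OF R part[OF c] hquot_part_uminus[OF R part[OF d]]] by simp
  ultimately have "{\<gamma>. c \<gamma> - d \<gamma> \<noteq> 0} = {}"
    by (intro hquot_independent[OF R, of _ "\<lambda>\<gamma>. c \<gamma> - d \<gamma>"]) auto
  then show "c = d" by auto
qed

lemma hquot_graded_domain: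
  assumes R: "graded_domain R"
  shows "graded_domain (hquot R)"
proof -
  note A = hquot_subring[OF R]
  have "additive_subgroup (part (hquot R) \<gamma>) (ring_of (hquot R))" for \<gamma>
    unfolding additive_subgroup_ring_of[OF A]
    using hquot_part_elts[OF R] hquot_part_0 hquot_part_add[OF R] hquot_part_uminus[OF R] by blast
  then show ?thesis
    unfolding graded_domain_def domain_ring_of_iff
    using A hquot_degs_monoid[OF graded_degs[OF R]] hquot_part_mult[OF R] hquot_decomposition[OF R]
    by auto
qed

lemma
  assumes T: "homogeneous_overring R T" and R: "graded_domain R"
  shows overring_subring: "is_subring (elts T)"
    and overring_base: "x \<in> elts R \<Longrightarrow> x \<in> elts T"
    and overring_degs: "degs T = degs (hquot R)"
    and overring_part: "part T \<alpha> = elts T \<inter> part (hquot R) \<alpha>"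
    and overring_homog: "homog T = elts T \<inter> homog (hquot R)"
  using T unfolding homogeneous_overring_def subring_ring_of[OF hquot_subring[OF R]] by (auto simp: homog_def)

lemma overring_graded_domain:
  assumes T: "homogeneous_overring R T" and R: "graded_domain R"
  shows "graded_domain T"
proof -
  note H = hquot_graded_domain[OF R] and A = overring_subring[OF T R]
  note deg = overring_degs[OF T R] and part = overring_part[OF T R]
  have "additive_subgroup (part T \<gamma>) (ring_of T)" if "\<gamma> \<in> degs T" for \<gamma>
    unfolding additive_subgroup_ring_of[OF A] part
    using subring_0[OF A] subring_add[OF A] subring_uminus[OF A] hquot_part_0 hquot_part_add[OF R]
      hquot_part_uminus[OF R] by blast
  moreover have "\<forall>x\<in>elts T. \<exists>!c. is_decomposition T x c"
    using T by (simp add: homogeneous_overring_def)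
  ultimately show ?thesis
    unfolding graded_domain_def domain_ring_of_iff deg
    using A graded_degs[OF H] hquot_part_mult[OF R] subring_mult[OF A] by (auto simp: part)
qed

lemma overring_extension:
  assumes T: "homogeneous_overring R T" and R: "graded_domain R"
  shows "graded_extension R T"
proof -
  have T': "graded_domain T" by (rule overring_graded_domain[OF T R])
  note \<Gamma> = graded_degs[OF R]
  have "\<alpha> \<in> degs T" "part R \<alpha> \<subseteq> part T \<alpha>" if \<alpha>: "\<alpha> \<in> degs R" for \<alpha>
  proof -
    have "\<alpha> = \<alpha> - 0" by simp
    then show "\<alpha> \<in> degs T"
      unfolding overring_degs[OF T R] hquot_degs using \<alpha> monoid_0[OF \<Gamma>] by blast
    show "part R \<alpha> \<subseteq> part T \<alpha>"
    proof
      fix a assume a: "a \<in> part R \<alpha>"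
      have "a / 1 \<in> part (hquot R) (\<alpha> - 0)"
        by (rule hquot_partI[OF \<alpha> monoid_0[OF \<Gamma>] a one_part_zero[OF R]]) simp
      then show "a \<in> part T \<alpha>"
        using overring_base[OF T R part_subset[OF R \<alpha> a]] by (simp add: overring_part[OF T R])
    qed
  qed
  then show ?thesis
    unfolding graded_extension_def subring_ring_of[OF graded_subring[OF T']]
    using R T' overring_base[OF T R] graded_subring[OF R] by blast
qed

lemma hquot_extension:
  assumes R: "graded_domain R"
  shows "graded_extension R (hquot R)"
proof -
  have "subring (elts (hquot R)) (ring_of (hquot R))"
    by (simp add: subring_ring_of hquot_subring[OF R])
  moreover have "elts R \<subseteq> elts (hquot R)"
    using hquot_eltsI[OF monoid_0[OF graded_degs[OF R]] _ one_part_zero[OF R]] by fastforce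
  moreover have "part (hquot R) = (\<lambda>\<alpha>. elts (hquot R) \<inter> part (hquot R) \<alpha>)"
  proof
    fix \<alpha>
    show "part (hquot R) \<alpha> = elts (hquot R) \<inter> part (hquot R) \<alpha>"
      using hquot_part_elts[OF R] by blast
  qed
  ultimately have "homogeneous_overring R (hquot R)"
    using hquot_decomposition[OF R] by (simp add: homogeneous_overring_def)
  then show ?thesis using R by (rule overring_extension)
qed

lemma homog_hquot_divide:
  assumes R: "graded_domain R" and x: "x \<in> homog (hquot R)" "y \<in> homog (hquot R)"
  shows "x / y \<in> homog (hquot R)"
proof -
  note H = hquot_graded_domain[OF R]
  obtain \<gamma> where \<gamma>: "\<gamma> \<in> degs (hquot R)" "y \<in> part (hquot R) \<gamma>" using x(2) by (auto elim: homogE)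
  then obtain \<alpha> \<beta> where "\<alpha> \<in> degs R" "\<beta> \<in> degs R" "- \<gamma> = \<beta> - \<alpha>" by (auto simp: hquot_degs)
  then have "- \<gamma> \<in> degs (hquot R)" unfolding hquot_degs by blast
  then have "inverse y \<in> homog (hquot R)" using hquot_part_inverse[OF \<gamma>(2)] by (rule homogI)
  then show ?thesis using homog_mult[OF H x(1)] by (simp add: divide_inverse)
qed

text \<open>
  The overrings constructed below are given by a multiplicatively closed set of homogeneous fractions that contains the
  homogeneous elements of \<open>R\<close>; their additive span is then automatically graded.
\<close>

definition spanned_overring :: "('a::field, 'g::ab_group_add) graded \<Rightarrow> 'a set \<Rightarrow> ('a, 'g) graded" where
  "spanned_overring R X =
     \<lparr>elts = aspan X, degs = degs (hquot R), part = (\<lambda>\<alpha>. aspan X \<inter> part (hquot R) \<alpha>)\<rparr>"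

lemma spanned_overring_elts [simp]: "elts (spanned_overring R X) = aspan X"
  by (simp add: spanned_overring_def)

lemma spanned_overring:
  assumes R: "graded_domain R" and X: "X \<subseteq> homog (hquot R)" "homog R \<subseteq> X" "\<And>x y. x \<in> X \<Longrightarrow> y \<in> X \<Longrightarrow> x * y \<in> X"
  shows "homogeneous_overring R (spanned_overring R X)"
proof -
  let ?B = "aspan X" and ?T = "spanned_overring R X"
  note H = hquot_graded_domain[OF R] and HS = hquot_subring[OF R]
  \<comment> \<open>The span is closed under negation, because \<open>-1\<close> is homogeneous and hence in \<open>X\<close>.\<close>
  have m1: "-1 \<in> X" using homog_uminus[OF R homog_1[OF R]] X(2) by auto
  have "x - y \<in> ?B" if "x \<in> ?B" "y \<in> ?B" for x y
    using aspan_add[OF that(1) aspan_mult_closed[OF X(3) aspan_base[OF m1] that(2)]] by simp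
  moreover have "1 \<in> ?B" using homog_1[OF R] X(2) by (blast intro: aspan_base)
  ultimately have B: "is_subring ?B"
    unfolding is_subring_def using aspan_mult_closed[OF X(3)] by blast
  have sub: "?B \<subseteq> elts (hquot R)"
    using X(1) homog_subset[OF H] by (intro subring_aspan[OF HS]) blast
  have "\<exists>!c. is_decomposition ?T x c" if x: "x \<in> ?B" for x
  proof (rule ex_ex1I)
    have xH: "x \<in> elts (hquot R)" using x sub by blast
    have "component (hquot R) x \<alpha> \<in> ?B" for \<alpha>
      by (rule comp_closed[OF H]) (use x X(1) aspan_mono[of X "?B \<inter> homog (hquot R)"] in
          \<open>auto intro: aspan_base aspan_0 aspan_add\<close>)
    then show "\<exists>c. is_decomposition ?T x c"
      using comp_decomposition[OF H xH]
      by (intro exI[of _ "component (hquot R) x"]) (auto simp: is_decomposition_def spanned_overring_def)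
    fix c d assume "is_decomposition ?T x c" "is_decomposition ?T x d"
    then have "is_decomposition (hquot R) x c" "is_decomposition (hquot R) x d"
      by (auto simp: is_decomposition_def spanned_overring_def)
    then show "c = d" using comp_eqI[OF H xH] by metis
  qed
  moreover have "elts R \<subseteq> ?B" using elts_eq_aspan[OF R] aspan_mono[OF X(2)] by blast
  ultimately show ?thesis
    unfolding homogeneous_overring_def subring_ring_of[OF HS] spanned_overring_elts
    using B sub by (auto simp: spanned_overring_def)
qed

section \<open>Divided extensions yield going-down\<close>

text \<open>
  The fraction \<open>p / a\<close> is integral over the ideal \<open>P\<close>, with denominators cleared. Free of division and of
  any overring, this condition makes sense for a copy of \<open>R\<close> in an arbitrary commutative ring and can be
  carried over along an isomorphism.
\<close>

definition integrally_divided :: "('a::comm_ring_1, 'g) graded \<Rightarrow> bool" where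
  "integrally_divided R \<longleftrightarrow>
     (\<forall>P\<in>spec_h R. \<forall>a\<in>homog R - P. \<forall>p\<in>homog R \<inter> P.
        \<exists>n c. (\<forall>i. c i \<in> P) \<and> p ^ n + (\<Sum>i<n. c i * a ^ (n - i) * p ^ i) = 0)"

text \<open>
  A homogeneous element of \<open>Q\<close> outside \<open>P\<close> divides each homogeneous element of \<open>P\<close>.
\<close>

lemma divided_spec_comparable:
  assumes T: "graded_divided T" and P: "P \<in> spec_h T" and Q: "Q \<in> spec_h T"
  shows "P \<subseteq> Q \<or> Q \<subseteq> P"
proof (rule disjCI)
  have gd: "graded_domain T" using T by (simp add: graded_divided_def)
  assume "\<not> Q \<subseteq> P"
  then obtain x where x: "x \<in> Q" "x \<in> homog T" "x \<notin> P"
    using spec_homog_subset[OF gd Q spec_ideal[OF gd P]] by blast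
  show "P \<subseteq> Q"
  proof (rule spec_homog_subset[OF gd P spec_ideal[OF gd Q]], rule subsetI)
    fix y assume y: "y \<in> P \<inter> homog T"
    have "x \<in> nz_homog T - P"
      using x ideal_0[OF spec_ideal[OF gd P]] by (auto simp: nz_homog_def)
    then have "x divides\<^bsub>ring_of T\<^esub> y"
      using T P y unfolding graded_divided_def homogeneous_divided_def by blast
    then obtain c where "c \<in> elts T" "y = x * c" by (auto simp: factor_def)
    then show "y \<in> Q"
      using ideal_mult[OF spec_ideal[OF gd Q], of c x] x(1) by (simp add: mult.commute)
  qed
qed

text \<open>
  With \<open>p = a m\<close> and \<open>Q\<close> the prime over \<open>P\<close>, the quotient \<open>m\<close> lies in \<open>Q\<close>. Were it not integral over \<open>P\<close>,
  some prime \<open>N\<close> of \<open>T\<close> would contain \<open>P\<close> but not \<open>m\<close>. Comparability puts \<open>N\<close> inside \<open>Q\<close>, so \<open>N\<close> lies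
  over \<open>P\<close> too and equals \<open>Q\<close>, a contradiction.
\<close>

lemma divided_extension_integrally_divided:
  assumes ext: "graded_extension R T" and T: "graded_divided T"
    and int: "integral_extension R T" and uni: "homogeneous_unibranched R T"
  shows "integrally_divided R"
  unfolding integrally_divided_def
proof (intro ballI)
  note R = ext_base[OF ext] and Tg = ext_top[OF ext]
  note A = graded_subring[OF R] and B = graded_subring[OF Tg]
  fix P a p assume P: "P \<in> spec_h R" and a: "a \<in> homog R - P" and p: "p \<in> homog R \<inter> P"
  have bij: "bij_betw (\<lambda>Q. Q \<inter> elts R) (spec_h T) (spec_h R)"
    using uni by (simp add: homogeneous_unibranched_def)
  then have "P \<in> (\<lambda>Q. Q \<inter> elts R) ` spec_h T" using P by (simp add: bij_betw_def)
  then obtain Q where Q: "Q \<in> spec_h T" "Q \<inter> elts R = P" by blast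
  note PI = spec_ideal[OF R P]
  have aR: "a \<in> elts R" "a \<notin> Q" using a Q(2) homog_subset[OF R] by blast+
  have "a \<in> nz_homog T - Q"
    using a aR ideal_0[OF spec_ideal[OF Tg Q(1)]] ext_homog[OF ext] by (auto simp: nz_homog_def)
  moreover have "p \<in> homog T \<inter> Q" using p Q(2) ext_homog[OF ext] by blast
  ultimately have "a divides\<^bsub>ring_of T\<^esub> p"
    using T Q(1) unfolding graded_divided_def homogeneous_divided_def by blast
  then obtain m where m: "m \<in> elts T" "p = a * m" by (auto simp: factor_def)
  have mQ: "m \<in> Q"
    using spec_prime[OF Tg Q(1) ext_elts[OF ext aR(1)] m(1)] p Q(2) aR(2) m(2) by blast
  have "integral_over P m"
  proof (rule ccontr)
    assume no: "\<not> integral_over P m"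
    let ?I = "{t \<in> elts T. integral_over P t}"
    have PT: "P \<subseteq> elts T" using ideal_subset[OF PI] ext_elts[OF ext] by blast
    have I: "is_ideal (elts T) ?I"
      using int PT by (intro integral_ideal[OF A PI B]) (auto simp: integral_extension_iff[OF A])
    \<comment> \<open>For \<open>k = 0\<close> this says that \<open>1\<close> is not integral over \<open>P\<close>, as \<open>P\<close> is proper.\<close>
    have "\<not> integral_over P (m ^ k)" for k
      using no integral_over_root[of P m k] integral_over_spec[OF R P, of P 1] spec_one[OF R P] subring_1[OF A]
      by (cases "k = 0") auto
    then have "?I \<inter> range (\<lambda>k. m ^ k) = {}" by blast
    moreover have "x * y \<in> range (\<lambda>k. m ^ k)" if "x \<in> range (\<lambda>k. m ^ k)" "y \<in> range (\<lambda>k. m ^ k)" for x y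
      using that by (auto simp flip: power_add)
    moreover have "1 \<in> range (\<lambda>k. m ^ k)" by (metis power_0 rangeI)
    ultimately obtain N where N: "N \<in> spec_h T" "?I \<inter> homog T \<subseteq> N" "N \<inter> range (\<lambda>k. m ^ k) = {}"
      using homogeneous_prime_exists[OF Tg I, of "range (\<lambda>k. m ^ k)"] subring_power[OF B m(1)] by blast
    have mN: "m \<notin> N" using N(3) by (metis disjoint_iff power_one_right rangeI)
    have PN: "P \<subseteq> N"
      using N(2) ext_homog[OF ext] PT integral_over_self
      by (intro spec_homog_subset[OF R P spec_ideal[OF Tg N(1)]]) blast
    have "N \<subseteq> Q" using divided_spec_comparable[OF T N(1) Q(1)] mQ mN by blast
    then have "N \<inter> elts R = Q \<inter> elts R" using PN Q(2) ideal_subset[OF PI] by blast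
    then have "N = Q" using bij N(1) Q(1) by (auto simp: bij_betw_def inj_on_def)
    then show False using mQ mN by blast
  qed
  then obtain n c where c: "\<And>i. c i \<in> P" "m ^ n + (\<Sum>i<n. c i * m ^ i) = 0"
    unfolding integral_over_iff_sum[OF A PI] by blast
  have "p ^ n + (\<Sum>i<n. c i * a ^ (n - i) * p ^ i) = a ^ n * (m ^ n + (\<Sum>i<n. c i * m ^ i))"
  proof -
    have "c i * a ^ (n - i) * p ^ i = a ^ n * (c i * m ^ i)" if "i < n" for i
    proof -
      have "a ^ n = a ^ (n - i) * a ^ i" using that by (simp flip: power_add)
      then show ?thesis by (simp add: m(2) power_mult_distrib mult_ac)
    qed
    then show ?thesis by (simp add: m(2) power_mult_distrib distrib_left sum_distrib_left)
  qed
  then show "\<exists>n c. (\<forall>i. c i \<in> P) \<and> p ^ n + (\<Sum>i<n. c i * a ^ (n - i) * p ^ i) = 0"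
    using c by auto
qed

lemma integrally_divided_isomorphic:
  assumes iso: "graded_isomorphic R R'" and R: "graded_domain R" and R': "graded_domain R'"
    and div: "integrally_divided R'"
  shows "integrally_divided R"
proof -
  obtain \<phi> \<psi> where \<phi>: "\<phi> \<in> ring_iso (ring_of R) (ring_of R')" and \<psi>: "bij_betw \<psi> (degs R) (degs R')"
    and part: "\<forall>\<alpha>\<in>degs R. part R' (\<psi> \<alpha>) = \<phi> ` part R \<alpha>"
    using iso unfolding graded_isomorphic_def by blast
  note A = graded_subring[OF R] and A' = graded_subring[OF R']
  have mem: "\<phi> x \<in> elts R'" if "x \<in> elts R" for x
    using ring_iso_memE(1)[OF \<phi>] that by simp
  have mult: "\<phi> (x * y) = \<phi> x * \<phi> y" and add: "\<phi> (x + y) = \<phi> x + \<phi> y"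
    if "x \<in> elts R" "y \<in> elts R" for x y
    using ring_iso_memE(2,3)[OF \<phi>] that by auto
  have one: "\<phi> 1 = 1" using ring_iso_memE(4)[OF \<phi>] by simp
  have bij: "bij_betw \<phi> (elts R) (elts R')" using ring_iso_memE(5)[OF \<phi>] by simp
  then have inj: "x = y" if "\<phi> x = \<phi> y" "x \<in> elts R" "y \<in> elts R" for x y
    using that by (auto simp: bij_betw_def inj_on_def)
  have surj: "\<exists>x\<in>elts R. y = \<phi> x" if "y \<in> elts R'" for y
    using bij that by (auto simp: bij_betw_def)
  have zero: "\<phi> 0 = 0" using add[of 0 0] subring_0[OF A] by simp
  have power: "\<phi> (x ^ n) = \<phi> x ^ n" if "x \<in> elts R" for x n
    by (induction n) (auto simp: one mult that subring_power[OF A])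
  have sum: "\<phi> (sum f F) = (\<Sum>i\<in>F. \<phi> (f i))" if "\<And>i. f i \<in> elts R" for f and F :: "nat set"
    by (induction F rule: infinite_finite_induct) (auto simp: zero add that subring_sum[OF A])
  have homog: "\<phi> x \<in> homog R'" if "x \<in> homog R" for x
    using that part \<psi> by (auto elim!: homogE intro!: homogI simp: bij_betw_def)
  have spec: "\<phi> ` P \<in> spec_h R'" if P: "P \<in> spec_h R" for P
    unfolding spec_h_iff[OF R']
  proof (intro conjI ballI impI)
    note PI = spec_ideal[OF R P]
    have sub: "x \<in> elts R" if "x \<in> P" for x using ideal_subset[OF PI that] .
    have pre: "x \<in> P" if x: "\<phi> x \<in> \<phi> ` P" "x \<in> elts R" for x
    proof -
      obtain y where y: "y \<in> P" "\<phi> x = \<phi> y" using x(1) by blast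
      show ?thesis using inj[OF y(2) x(2) sub[OF y(1)]] y(1) by simp
    qed
    show "is_ideal (elts R') (\<phi> ` P)"
      unfolding is_ideal_def
    proof (intro conjI ballI)
      show "\<phi> ` P \<subseteq> elts R'" using mem sub by blast
      show "0 \<in> \<phi> ` P" using zero ideal_0[OF PI] by (metis imageI)
      show "x + y \<in> \<phi> ` P" if xy: "x \<in> \<phi> ` P" "y \<in> \<phi> ` P" for x y
      proof -
        obtain a b where ab: "x = \<phi> a" "y = \<phi> b" "a \<in> P" "b \<in> P" using xy by blast
        have "x + y = \<phi> (a + b)" using ab add[OF sub sub] by simp
        then show ?thesis using ideal_add[OF PI ab(3,4)] by blast
      qed
      show "r * y \<in> \<phi> ` P" if ry: "r \<in> elts R'" "y \<in> \<phi> ` P" for r y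
      proof -
        obtain a b where ab: "r = \<phi> a" "y = \<phi> b" "a \<in> elts R" "b \<in> P" using ry surj by blast
        have "r * y = \<phi> (a * b)" using ab mult[OF _ sub] by simp
        then show ?thesis using ideal_mult[OF PI ab(3,4)] by blast
      qed
    qed
    show "1 \<notin> \<phi> ` P" using pre[of 1] one spec_one[OF R P] subring_1[OF A] by auto
    show "x \<in> \<phi> ` P \<or> y \<in> \<phi> ` P" if xy: "x \<in> elts R'" "y \<in> elts R'" "x * y \<in> \<phi> ` P" for x y
    proof -
      obtain a b where ab: "x = \<phi> a" "y = \<phi> b" "a \<in> elts R" "b \<in> elts R" using xy surj by metis
      have "a * b \<in> P" using pre[of "a * b"] xy(3) ab mult subring_mult[OF A] by simp
      then show ?thesis using spec_prime[OF R P ab(3,4)] ab by blast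
    qed
    show "\<phi> ` P \<subseteq> aspan (\<phi> ` P \<inter> homog R')"
    proof
      fix y assume "y \<in> \<phi> ` P"
      then obtain x where x: "x \<in> aspan (P \<inter> homog R)" and y: "y = \<phi> x" using spec_span[OF R P] by blast
      from x have "x \<in> elts R \<and> \<phi> x \<in> aspan (\<phi> ` P \<inter> homog R')"
      proof induction
        case aspan_0
        then show ?case using zero subring_0[OF A] by (simp add: aspan.aspan_0)
      next
        case (aspan_step u v)
        then show ?case
          using sub add[of u v] homog subring_add[OF A] by (auto intro!: aspan.aspan_step)
      qed
      then show "y \<in> aspan (\<phi> ` P \<inter> homog R')" using y by simp
    qed
  qed
  show ?thesis
    unfolding integrally_divided_def
  proof (intro ballI)
    fix P a p assume P: "P \<in> spec_h R" and a: "a \<in> homog R - P" and p: "p \<in> homog R \<inter> P"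
    note PI = spec_ideal[OF R P]
    have aR: "a \<in> elts R" and pR: "p \<in> elts R" using a p homog_subset[OF R] by blast+
    have "\<phi> a \<notin> \<phi> ` P" using a aR inj[of a] ideal_subset[OF PI] by blast
    then have "\<exists>n c. (\<forall>i. c i \<in> \<phi> ` P) \<and> \<phi> p ^ n + (\<Sum>i<n. c i * \<phi> a ^ (n - i) * \<phi> p ^ i) = 0"
      using div spec[OF P] homog a p unfolding integrally_divided_def by blast
    then obtain n c where c: "\<forall>i. c i \<in> \<phi> ` P" "\<phi> p ^ n + (\<Sum>i<n. c i * \<phi> a ^ (n - i) * \<phi> p ^ i) = 0"
      by blast
    have "\<forall>i. \<exists>x. x \<in> P \<and> c i = \<phi> x" using c(1) by blast
    then obtain d where d: "\<And>i. d i \<in> P" "\<And>i. c i = \<phi> (d i)" by metis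
    have dR: "d i \<in> elts R" for i using ideal_subset[OF PI d(1)] .
    let ?f = "\<lambda>i. d i * a ^ (n - i) * p ^ i"
    have f: "?f i \<in> elts R" for i by (intro subring_mult[OF A] subring_power[OF A] dR aR pR)
    have "\<phi> (p ^ n + (\<Sum>i<n. ?f i)) = \<phi> p ^ n + (\<Sum>i<n. \<phi> (?f i))"
      using add[OF subring_power[OF A pR] subring_sum[OF A, of "{..<n}" ?f, OF f]] sum[of ?f "{..<n}", OF f]
        power[OF pR] by simp
    also have "\<dots> = 0"
      using c(2) by (simp add: mult power dR aR pR subring_mult[OF A] subring_power[OF A] d(2))
    finally have "\<phi> (p ^ n + (\<Sum>i<n. ?f i)) = \<phi> 0" using zero by simp
    then have "p ^ n + (\<Sum>i<n. ?f i) = 0"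
      by (rule inj) (intro subring_add[OF A] subring_power[OF A] subring_sum[OF A] subring_0[OF A] f pR)+
    then show "\<exists>n c. (\<forall>i. c i \<in> P) \<and> p ^ n + (\<Sum>i<n. c i * a ^ (n - i) * p ^ i) = 0"
      using d(1) by blast
  qed
qed

lemma integrally_divided_quotient:
  fixes R :: "('a::field, 'g) graded"
  assumes R: "is_subring (elts R)" and P: "is_ideal (elts R) P" and a: "a \<noteq> 0" and c: "\<And>i. c i \<in> P" 
    and eq: "p ^ n + (\<Sum>i<n. c i * a ^ (n - i) * p ^ i) = 0"
  shows "integral_over P (p / a)"
proof -
  have "(p / a) ^ n + (\<Sum>i<n. c i * (p / a) ^ i) = (p ^ n + (\<Sum>i<n. c i * a ^ (n - i) * p ^ i)) / a ^ n"
  proof -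
    have "c i * (p / a) ^ i = c i * a ^ (n - i) * p ^ i / a ^ n" if "i < n" for i
    proof -
      have "a ^ n = a ^ (n - i) * a ^ i" using that by (simp flip: power_add)
      then show ?thesis using a by (simp add: power_divide)
    qed
    then show ?thesis by (simp add: add_divide_distrib sum_divide_distrib power_divide)
  qed
  then show ?thesis
    unfolding integral_over_iff_sum[OF R P] using c eq by (intro exI[of _ n] exI[of _ c]) auto
qed

text \<open>
  The prime below \<open>Q\<close> is sought among those that contain \<open>P\<^sub>0 T\<close> and avoid all products \<open>a q\<close> of a homogeneous
  \<open>a\<close> in \<open>R\<close> outside \<open>P\<^sub>0\<close> and a homogeneous \<open>q\<close> in \<open>T\<close> outside \<open>Q\<close>: avoiding the \<open>a\<close> makes it lie over
  \<open>P\<^sub>0\<close>, and avoiding the \<open>q\<close> makes it lie inside \<open>Q\<close>.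
\<close>

lemma integrally_divided_gGD:
  assumes R: "graded_domain R" and div: "integrally_divided R"
  shows "gGD_domain R"
  unfolding gGD_domain_def gGD_def
proof (intro conjI allI impI ballI)
  show "graded_domain R" by fact
next
  fix T P\<^sub>0 P Q
  assume over: "homogeneous_overring R T" and P0: "P\<^sub>0 \<in> spec_h R" and Q: "Q \<in> spec_h T"
    and PQ: "P\<^sub>0 \<subseteq> P \<and> Q \<inter> elts R = P"
  note ext = overring_extension[OF over R]
  note T = ext_top[OF ext]
  note B = graded_subring[OF T] and A = graded_subring[OF R]
  note QI = spec_ideal[OF T Q] and PI = spec_ideal[OF R P0]
  let ?X = "{p * s | p s. p \<in> homog R \<inter> P\<^sub>0 \<and> s \<in> elts T}"
  let ?S = "{a * q | a q. a \<in> homog R - P\<^sub>0 \<and> q \<in> homog T - Q}"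
  have P0Q: "P\<^sub>0 \<subseteq> Q" using PQ by blast
  have XT: "?X \<subseteq> elts T" using ext_elts[OF ext] homog_subset[OF R] subring_mult[OF B] by blast
  have mX: "b * x \<in> ?X" if bx: "b \<in> elts T" "x \<in> ?X" for b x
  proof -
    obtain p s where ps: "x = p * s" "p \<in> homog R \<inter> P\<^sub>0" "s \<in> elts T" using bx by blast
    have "b * x = p * (b * s)" by (simp add: ps(1) mult_ac)
    then show ?thesis using ps subring_mult[OF B bx(1)] by blast
  qed
  have I: "is_ideal (elts T) (aspan ?X)"
    unfolding is_ideal_def using subring_aspan[OF B XT] aspan_mult[of _ ?X _ ?X] mX aspan_base[of _ ?X]
    by (auto intro: aspan_0 aspan_add)
  have one: "1 \<in> homog R - P\<^sub>0" "1 \<in> homog T - Q"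
    using homog_1[OF R] homog_1[OF T] spec_one[OF R P0] spec_one[OF T Q] by auto
  have ST: "?S \<subseteq> elts T"
    using ext_elts[OF ext] homog_subset[OF R] homog_subset[OF T] subring_mult[OF B] by blast
  have mS: "x * y \<in> ?S" if xy: "x \<in> ?S" "y \<in> ?S" for x y
  proof -
    obtain a q b r where *: "x = a * q" "y = b * r" "a \<in> homog R - P\<^sub>0" "b \<in> homog R - P\<^sub>0"
      "q \<in> homog T - Q" "r \<in> homog T - Q" using xy by blast
    have "a * b \<in> homog R - P\<^sub>0"
      using *(3,4) homog_mult[OF R] spec_prime[OF R P0] homog_subset[OF R] by blast
    moreover have "q * r \<in> homog T - Q"
      using *(5,6) homog_mult[OF T] spec_prime[OF T Q] homog_subset[OF T] by blast
    moreover have "x * y = (a * b) * (q * r)" by (simp add: * mult_ac)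
    ultimately show ?thesis by blast
  qed
  have "aspan ?X \<inter> ?S = {}"
  proof (rule ccontr)
    assume "\<not> ?thesis"
    then obtain x where x: "x \<in> aspan ?X" "x \<in> ?S" by blast
    obtain a q where a: "a \<in> homog R - P\<^sub>0" and q: "q \<in> homog T - Q" and "x = a * q"
      using x(2) by blast
    then have aq: "a * q \<in> aspan ?X" using x(1) by simp
    have a0: "a \<noteq> 0" using a ideal_0[OF PI] by blast
    have frac: "integral_over Q (p / a)" if p: "p \<in> homog R \<inter> P\<^sub>0" for p
    proof -
      obtain n c where "\<And>i. c i \<in> P\<^sub>0" "p ^ n + (\<Sum>i<n. c i * a ^ (n - i) * p ^ i) = 0"
        using div P0 a p unfolding integrally_divided_def by blast
      from integrally_divided_quotient[OF A PI a0 this] show ?thesis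
        using P0Q by (rule integral_over_mono)
    qed
    have "integral_over Q (x / a)" if "x \<in> aspan ?X" for x
      using that
    proof induction
      case aspan_0
      then show ?case using integral_over_0[OF QI] by simp
    next
      case (aspan_step x y)
      then obtain p s where ps: "x = p * s" "p \<in> homog R \<inter> P\<^sub>0" "s \<in> elts T" by blast
      have "integral_over Q (p / a * s)"
        by (rule integral_over_mult[OF B QI frac[OF ps(2)] integral_over_self[OF ps(3)]])
      then have "integral_over Q (x / a)" by (simp add: ps(1))
      then show ?case using integral_over_add[OF B QI _ aspan_step.IH] by (simp add: add_divide_distrib)
    qed
    from this[OF aq] have "integral_over Q q" using a0 by simp
    then show False using integral_over_spec[OF T Q, of Q q] q homog_subset[OF T] by blast
  qed
  moreover have "1 \<in> ?S" using one by force
  ultimately have "\<exists>Q0\<in>spec_h T. aspan ?X \<inter> homog T \<subseteq> Q0 \<and> Q0 \<inter> ?S = {}"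
    by (intro homogeneous_prime_exists[OF T I ST _ mS])
  then obtain Q0 where Q0: "Q0 \<in> spec_h T" "aspan ?X \<inter> homog T \<subseteq> Q0" "Q0 \<inter> ?S = {}"
    by (elim bexE conjE)
  have avoid: "a * q \<notin> Q0" if "a \<in> homog R - P\<^sub>0" "q \<in> homog T - Q" for a q
  proof
    assume "a * q \<in> Q0"
    moreover have "a * q \<in> ?S" using that by blast
    ultimately have "a * q \<in> Q0 \<inter> ?S" by (rule IntI)
    then show False unfolding Q0(3) by simp
  qed
  have sub1: "P\<^sub>0 \<subseteq> Q0"
  proof (rule spec_homog_subset[OF R P0 spec_ideal[OF T Q0(1)]], rule subsetI)
    fix p assume p: "p \<in> P\<^sub>0 \<inter> homog R"
    then have "p * 1 \<in> ?X" using subring_1[OF B] by blast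
    from aspan_base[OF this] have "p \<in> aspan ?X" by simp
    moreover have "p \<in> homog T" using p ext_homog[OF ext] by simp
    ultimately show "p \<in> Q0" using Q0(2) by (meson IntI subsetD)
  qed
  have sub2: "Q0 \<inter> elts R \<subseteq> P\<^sub>0"
  proof (rule spec_homog_subset[OF R spec_contraction[OF ext Q0(1)] PI], rule subsetI)
    fix a assume a: "a \<in> Q0 \<inter> elts R \<inter> homog R"
    show "a \<in> P\<^sub>0"
    proof (rule ccontr)
      assume "a \<notin> P\<^sub>0"
      then show False using a avoid[OF _ one(2), of a] by simp
    qed
  qed
  have "Q0 \<subseteq> Q"
  proof (rule spec_homog_subset[OF T Q0(1) QI], rule subsetI)
    fix q assume q: "q \<in> Q0 \<inter> homog T"
    show "q \<in> Q"
    proof (rule ccontr)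
      assume "q \<notin> Q"
      then show False using q avoid[OF one(1), of q] by simp
    qed
  qed
  then show "\<exists>Q\<^sub>0\<in>spec_h T. Q\<^sub>0 \<subseteq> Q \<and> Q\<^sub>0 \<inter> elts R = P\<^sub>0"
    using Q0(1) sub1 sub2 ideal_subset[OF PI] by blast
qed

lemma divided_extension_gGD:
  fixes R :: "('a::field, 'g::ab_group_add) graded"
  assumes R: "graded_domain R"
    and "has_divided_extension R TYPE(('b::comm_ring_1, 'l::comm_monoid_add) graded)"
  shows "gGD_domain R"
proof -
  obtain R' T :: "('b, 'l) graded" where *: "graded_isomorphic R R'" "graded_extension R' T"
    "graded_divided T" "integral_extension R' T" "homogeneous_unibranched R' T"
    using assms(2) unfolding has_divided_extension_def by blast
  have "integrally_divided R"
    by (rule integrally_divided_isomorphic[OF *(1) R ext_base[OF *(2)]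
          divided_extension_integrally_divided[OF *(2-5)]])
  then show ?thesis by (rule integrally_divided_gGD[OF R])
qed

section \<open>Going-down yields a divided overring\<close>

text \<open>
  Uniqueness is used in a stronger form: by Zorn's lemma each proper homogeneous ideal is contained in a
  maximal one, hence in \<open>M\<close>.
\<close>

lemma unique_maximal_homogeneous:
  assumes R: "graded_domain R" and max: "\<exists>!M. maximal_homogeneous_ideal R M"
  obtains M where "homogeneous_ideal R M" "1 \<notin> M" "\<And>J. homogeneous_ideal R J \<Longrightarrow> 1 \<notin> J \<Longrightarrow> J \<subseteq> M"
proof -
  have proper: "J \<noteq> elts R \<longleftrightarrow> 1 \<notin> J" if "homogeneous_ideal R J" for J
  proof -
    have J: "is_ideal (elts R) J" using that by (simp add: homogeneous_ideal_iff[OF R])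
    show ?thesis
      using ideal_mult[OF J, of _ 1] ideal_subset[OF J] subring_1[OF graded_subring[OF R]] by auto
  qed
  obtain M where M: "maximal_homogeneous_ideal R M"
    and uniq: "\<And>N. maximal_homogeneous_ideal R N \<Longrightarrow> N = M" using max by blast
  have "J \<subseteq> M" if J: "homogeneous_ideal R J" "1 \<notin> J" for J
  proof -
    let ?\<A> = "{I. homogeneous_ideal R I \<and> 1 \<notin> I \<and> J \<subseteq> I}"
    have "\<exists>N\<in>?\<A>. \<forall>X\<in>?\<A>. N \<subseteq> X \<longrightarrow> X = N"
    proof (rule subset_Zorn_nonempty)
      show "?\<A> \<noteq> {}" using J by blast
      fix \<C> assume C: "\<C> \<noteq> {}" "subset.chain ?\<A> \<C>"
      have mem: "homogeneous_ideal R I" "1 \<notin> I" "J \<subseteq> I" if "I \<in> \<C>" for I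
        using C(2) that by (auto simp: subset_chain_def)
      have "is_ideal (elts R) (\<Union>\<C>)"
        using C mem(1) by (intro chain_union_ideal) (auto simp: subset_chain_def homogeneous_ideal_iff[OF R])
      moreover have "\<Union>\<C> \<subseteq> aspan (\<Union>\<C> \<inter> homog R)"
      proof
        fix x assume "x \<in> \<Union>\<C>"
        then obtain I where I: "I \<in> \<C>" "x \<in> I" by blast
        then have "x \<in> aspan (I \<inter> homog R)" using mem(1) by (auto simp: homogeneous_ideal_iff[OF R])
        then show "x \<in> aspan (\<Union>\<C> \<inter> homog R)"
          using aspan_mono[of "I \<inter> homog R" "\<Union>\<C> \<inter> homog R"] I(1) by blast
      qed
      ultimately have "homogeneous_ideal R (\<Union>\<C>)" by (simp add: homogeneous_ideal_iff[OF R])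
      moreover have "J \<subseteq> \<Union>\<C>" using mem(3) C(1) by blast
      ultimately show "\<Union>\<C> \<in> ?\<A>" using mem(2) by blast
    qed
    then obtain N where "N \<in> ?\<A>" and N: "\<forall>X\<in>?\<A>. N \<subseteq> X \<longrightarrow> X = N" ..
    then have *: "homogeneous_ideal R N" "1 \<notin> N" "J \<subseteq> N" by simp_all
    have "maximal_homogeneous_ideal R N"
      unfolding maximal_homogeneous_ideal_def
    proof (intro conjI allI impI)
      fix X assume X: "homogeneous_ideal R X \<and> X \<noteq> elts R \<and> N \<subseteq> X"
      then have "X \<in> ?\<A>" using proper *(3) by auto
      then show "X = N" using N X by blast
    qed (use * proper in auto)
    then show ?thesis using uniq *(3) by blast
  qed
  moreover have "homogeneous_ideal R M" "1 \<notin> M"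
    using M proper unfolding maximal_homogeneous_ideal_def by auto
  ultimately show ?thesis by (rule that[rotated 2])
qed

lemma homogeneous_unit:
  assumes R: "graded_domain R" and w: "w \<in> homog R" "w \<notin> M"
    and M: "\<And>J. homogeneous_ideal R J \<Longrightarrow> 1 \<notin> J \<Longrightarrow> J \<subseteq> M"
  shows "\<exists>r\<in>elts R. w * r = 1"
proof (rule ccontr)
  assume no: "\<not> ?thesis"
  note A = graded_subring[OF R]
  let ?J = "{w * r | r. r \<in> elts R}"
  have "0 = w * 0" "w = w * 1" by simp_all
  then have J0: "0 \<in> ?J" and Jw: "w \<in> ?J" using subring_0[OF A] subring_1[OF A] by blast+
  have "is_ideal (elts R) ?J"
    unfolding is_ideal_def
  proof (intro conjI ballI)
    show "?J \<subseteq> elts R" using homog_subset[OF R w(1)] subring_mult[OF A] by blast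
    show "x + y \<in> ?J" if xy: "x \<in> ?J" "y \<in> ?J" for x y
    proof -
      obtain r s where "x = w * r" "y = w * s" "r \<in> elts R" "s \<in> elts R" using xy by blast
      moreover from this have "x + y = w * (r + s)" by (simp add: distrib_left)
      ultimately show ?thesis using subring_add[OF A] by blast
    qed
    show "a * x \<in> ?J" if ax: "a \<in> elts R" "x \<in> ?J" for a x
    proof -
      obtain r where "x = w * r" "r \<in> elts R" using ax by blast
      moreover from this have "a * x = w * (a * r)" by (simp add: mult_ac)
      ultimately show ?thesis using subring_mult[OF A ax(1)] by blast
    qed
  qed (rule J0)
  moreover have "?J \<subseteq> aspan (?J \<inter> homog R)"
  proof
    fix x assume "x \<in> ?J"
    then obtain r where r: "x = w * r" "r \<in> elts R" by blast
    have "r \<in> aspan (homog R)" using r(2) elts_eq_aspan[OF R] by simp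
    then have "w * r \<in> aspan (?J \<inter> homog R)"
    proof (rule aspan_mult)
      fix a assume "a \<in> homog R"
      then show "w * a \<in> aspan (?J \<inter> homog R)"
        using homog_mult[OF R w(1)] homog_subset[OF R] by (intro aspan_base) blast
    qed
    then show "x \<in> aspan (?J \<inter> homog R)" using r(1) by simp
  qed
  moreover have "1 \<notin> ?J"
  proof
    assume "1 \<in> ?J"
    then obtain r where "1 = w * r" "r \<in> elts R" by blast
    then show False using no by metis
  qed
  ultimately have "?J \<subseteq> M" using M by (simp add: homogeneous_ideal_iff[OF R])
  then show False using w(2) Jw by blast
qed

text \<open>
  Homogeneous generators of the extension by \<open>y\<close> of the ring spanned by \<open>X\<close>, a set that is
  multiplicatively closed whenever \<open>X\<close> is.
\<close>

definition adjoin :: "'a::comm_ring_1 set \<Rightarrow> 'a \<Rightarrow> 'a set" where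
  "adjoin X y = {t * y ^ n | t n. t \<in> X}"

lemma adjoin_subset: "X \<subseteq> adjoin X y"
  unfolding adjoin_def by (force intro: exI[of _ 0])

lemma adjoin_gen: "1 \<in> X \<Longrightarrow> y \<in> adjoin X y"
  unfolding adjoin_def by (force intro: exI[of _ 1])

lemma adjoin_overring:
  assumes R: "graded_domain R" and X: "X \<subseteq> homog (hquot R)" "homog R \<subseteq> X" "\<And>x y. x \<in> X \<Longrightarrow> y \<in> X \<Longrightarrow> x * y \<in> X"
    and y: "y \<in> homog (hquot R)"
  shows "homogeneous_overring R (spanned_overring R (adjoin X y))"
proof (rule spanned_overring[OF R])
  note H = hquot_graded_domain[OF R]
  have "y ^ n \<in> homog (hquot R)" for n
    by (induction n) (auto intro: homog_1[OF H] homog_mult[OF H] y)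
  then show "adjoin X y \<subseteq> homog (hquot R)" using X(1) homog_mult[OF H] by (auto simp: adjoin_def)
  show "homog R \<subseteq> adjoin X y" using X(2) adjoin_subset by blast
  fix u v assume "u \<in> adjoin X y" "v \<in> adjoin X y"
  then obtain s m t n where uv: "u = s * y ^ m" "v = t * y ^ n" "s \<in> X" "t \<in> X" by (auto simp: adjoin_def)
  have "u * v = (s * t) * y ^ (m + n)" by (simp add: uv power_add mult_ac)
  then show "u * v \<in> adjoin X y" using X(3)[OF uv(3,4)] unfolding adjoin_def by blast
qed

text \<open>
  Here \<open>x = f\<close> is a polynomial in \<open>1 / x\<close>, and multiplication by a large power of \<open>x\<close> turns this into an
  integral equation.
\<close>

lemma integral_if_inverse_unit:
  fixes x :: "'a::field"
  assumes x: "x \<noteq> 0" and f: "f \<in> aspan (adjoin X (inverse x))" and one: "inverse x * f = 1"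
  shows "integral_over (aspan X) x"
proof -
  have "\<exists>N. \<forall>M\<ge>N. x ^ M * f \<in> aspan {c * x ^ i | c i. c \<in> aspan X \<and> i < Suc M}"
    using f
  proof induction
    case aspan_0
    then show ?case by (auto intro: aspan.aspan_0)
  next
    case (aspan_step u v)
    then obtain t n N where u: "u = t * inverse x ^ n" "t \<in> X"
      and N: "\<And>M. M \<ge> N \<Longrightarrow> x ^ M * v \<in> aspan {c * x ^ i | c i. c \<in> aspan X \<and> i < Suc M}"
      by (auto simp: adjoin_def)
    have "x ^ M * (u + v) \<in> aspan {c * x ^ i | c i. c \<in> aspan X \<and> i < Suc M}" if M: "M \<ge> max n N" for M
    proof -
      have "x ^ M = x ^ (M - n) * x ^ n" using M by (simp flip: power_add)
      then have "x ^ M * u = t * x ^ (M - n)" using x by (simp add: u(1) power_inverse field_simps)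
      also have "\<dots> \<in> aspan {c * x ^ i | c i. c \<in> aspan X \<and> i < Suc M}"
        using aspan_base[OF u(2)] by (intro aspan_base) (auto intro!: exI[of _ t] exI[of _ "M - n"])
      finally show ?thesis using N[of M] M by (simp add: distrib_left aspan_add)
    qed
    then show ?case by blast
  qed
  then obtain N where N: "x ^ N * f \<in> aspan {c * x ^ i | c i. c \<in> aspan X \<and> i < Suc N}" by blast
  have "f = x" using one x by (simp add: field_simps)
  then have "x ^ Suc N \<in> aspan {c * x ^ i | c i. c \<in> aspan X \<and> i < Suc N}"
    using N by (simp add: mult.commute)
  then show ?thesis unfolding integral_over_def by blast
qed

lemma gGD_overring:
  assumes "gGD_domain R" "homogeneous_overring R T" "P\<^sub>0 \<in> spec_h R" "Q \<in> spec_h T" "P\<^sub>0 \<subseteq> Q"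
  shows "\<exists>Q\<^sub>0\<in>spec_h T. Q\<^sub>0 \<subseteq> Q \<and> Q\<^sub>0 \<inter> elts R = P\<^sub>0"
proof -
  have R: "graded_domain R" using assms(1) by (simp add: gGD_domain_def)
  have "Q \<inter> elts R \<in> spec_h R"
    by (rule spec_contraction[OF overring_extension[OF assms(2) R] assms(4)])
  moreover have "P\<^sub>0 \<subseteq> Q \<inter> elts R" using ideal_subset[OF spec_ideal[OF R assms(3)]] assms(5) by blast
  ultimately show ?thesis
    using assms unfolding gGD_domain_def gGD_def by blast
qed

text \<open>
  Let \<open>y = a / b\<close> and \<open>S = R[y]\<close>. If \<open>b / a\<close> is not integral, then \<open>y\<close> is not a unit of \<open>S\<close>, and even the
  ideal \<open>M + y S\<close> is proper: in an equation \<open>1 = m + y f\<close> one may pass to components of degree \<open>0\<close>, and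
  the component \<open>1 - m\<^sub>0\<close> of \<open>y f\<close> is a homogeneous element outside \<open>M\<close>, hence a unit of \<open>R\<close>, which makes
  \<open>y\<close> a unit. A homogeneous prime containing \<open>M + y S\<close> contains \<open>P\<close>, so there is one over \<open>P\<close> itself
  inside it; that one contains \<open>b\<close> and with it \<open>a = y b\<close>, contradicting the choice of \<open>a\<close>.
\<close>

lemma gGD_quotient_integral:
  assumes gd: "gGD_domain R" and max: "\<exists>!M. maximal_homogeneous_ideal R M"
    and P: "P \<in> spec_h R" and b: "b \<in> homog R \<inter> P" and a: "a \<in> homog R - P"
  shows "integral_over (elts R) (b / a)"
proof (rule ccontr)
  assume no: "\<not> ?thesis"
  have R: "graded_domain R" using gd by (simp add: gGD_domain_def)
  note A = graded_subring[OF R] and PI = spec_ideal[OF R P]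
  have a0: "a \<noteq> 0" using a ideal_0[OF PI] by blast
  have b0: "b \<noteq> 0" using no subring_0[OF A] by (auto intro: integral_over_self)
  obtain M where M: "homogeneous_ideal R M" "1 \<notin> M"
    and Mmax: "\<And>J. homogeneous_ideal R J \<Longrightarrow> 1 \<notin> J \<Longrightarrow> J \<subseteq> M"
    using unique_maximal_homogeneous[OF R max] by metis
  have MI: "is_ideal (elts R) M" "M \<subseteq> aspan (M \<inter> homog R)" using M(1) by (simp_all add: homogeneous_ideal_iff[OF R])
  \<comment> \<open>This is what \<open>M\<close> is for: whatever \<open>P\<close> is, a prime of \<open>R[y]\<close> that contains \<open>M\<close> contains \<open>P\<close>.\<close>
  have PM: "P \<subseteq> M"
    using P spec_one[OF R P] Mmax by (simp add: spec_h_def)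
  note hH = ext_homog[OF hquot_extension[OF R]]
  define y where "y = inverse (b / a)"
  have ab: "a = y * b" using a0 b0 by (simp add: y_def)
  have y: "y \<in> homog (hquot R)"
    using homog_hquot_divide[OF R hH hH, of a b] a b by (simp add: y_def)
  define S where "S = spanned_overring R (adjoin (homog R) y)"
  have over: "homogeneous_overring R S"
    unfolding S_def using hH homog_mult[OF R] y by (intro adjoin_overring[OF R]) auto
  note ext = overring_extension[OF over R]
  note SS = ext_top[OF ext]
  note B = graded_subring[OF SS]
  have Selts: "elts S = aspan (adjoin (homog R) y)" by (simp add: S_def)
  have yS: "y \<in> elts S" unfolding Selts using adjoin_gen[of "homog R" y] homog_1[OF R] by (blast intro: aspan_base)
  have nonunit: "y * f \<noteq> 1" if "f \<in> elts S" for f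
  proof
    assume "y * f = 1"
    then have "integral_over (aspan (homog R)) (b / a)"
      using that a0 b0 unfolding Selts y_def by (intro integral_if_inverse_unit) auto
    then show False using no elts_eq_aspan[OF R] by simp
  qed
  let ?I = "{m + y * f | m f. m \<in> M \<and> f \<in> elts S}"
  have MS: "m \<in> elts S" if "m \<in> M" for m using ext_elts[OF ext ideal_subset[OF MI(1) that]] .
  have I0: "0 \<in> ?I" using ideal_0[OF MI(1)] subring_0[OF B] by force
  have Iadd: "u + v \<in> ?I" if uv: "u \<in> ?I" "v \<in> ?I" for u v
  proof -
    obtain m f n g where *: "u = m + y * f" "v = n + y * g" "m \<in> M" "n \<in> M" "f \<in> elts S" "g \<in> elts S"
      using uv by blast
    have "u + v = (m + n) + y * (f + g)" by (simp add: * algebra_simps)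
    then show ?thesis using ideal_add[OF MI(1) *(3,4)] subring_add[OF B *(5,6)] by blast
  qed
  have Iy: "y * f \<in> ?I" if "f \<in> elts S" for f
  proof -
    have "y * f = 0 + y * f" by simp
    then show ?thesis using that ideal_0[OF MI(1)] by blast
  qed
  have IM: "m \<in> ?I" if "m \<in> M" for m
  proof -
    have "m = m + y * 0" by simp
    then show ?thesis using that subring_0[OF B] by blast
  qed
  have Imult: "s * m \<in> ?I" if "m \<in> M" "s \<in> aspan (adjoin (homog R) y)" for s m
    using that(2)
  proof induction
    case aspan_0
    then show ?case using I0 by simp
  next
    case (aspan_step u v)
    then obtain t n where u: "u = t * y ^ n" "t \<in> homog R" by (auto simp: adjoin_def)
    have tm: "t * m \<in> M" by (rule ideal_mult[OF MI(1) homog_subset[OF R u(2)] that(1)])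
    have "u * m \<in> ?I"
    proof (cases n)
      case 0
      then show ?thesis using IM[OF tm] by (simp add: u(1))
    next
      case (Suc k)
      then have eq: "u * m = y * (y ^ k * (t * m))" by (simp add: u(1) mult_ac)
      show ?thesis unfolding eq by (intro Iy subring_mult[OF B] subring_power[OF B yS] MS[OF tm])
    qed
    then show ?case using Iadd[OF _ aspan_step.IH] by (simp add: distrib_right)
  qed
  have I: "is_ideal (elts S) ?I"
    unfolding is_ideal_def
  proof (intro conjI ballI)
    show "?I \<subseteq> elts S" using MS yS subring_add[OF B] subring_mult[OF B] by blast
    show "s * u \<in> ?I" if su: "s \<in> elts S" "u \<in> ?I" for s u
    proof -
      obtain m f where *: "u = m + y * f" "m \<in> M" "f \<in> elts S" using su by blast
      have "s * u = s * m + y * (s * f)" by (simp add: * algebra_simps)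
      moreover have "s * m \<in> ?I" using su(1) by (intro Imult *(2)) (simp add: Selts)
      ultimately show ?thesis using Iadd[OF _ Iy[OF subring_mult[OF B su(1) *(3)]]] by simp
    qed
  qed (use I0 Iadd in blast)+
  have "1 \<notin> ?I"
  proof
    assume "1 \<in> ?I"
    then obtain m f where mf: "1 = m + y * f" "m \<in> M" "f \<in> elts S" by blast
    define m0 where "m0 = component R m 0"
    have mR: "m \<in> elts R" by (rule ideal_subset[OF MI(1) mf(2)])
    have m0: "m0 \<in> M"
      unfolding m0_def using comp_closed[OF R, of m M] MI mf(2) ideal_0[OF MI(1)] ideal_add[OF MI(1)] by blast
    have zero: "0 \<in> degs R" by (rule monoid_0[OF graded_degs[OF R]])
    have m0p: "m0 \<in> part R 0" unfolding m0_def by (rule comp_part[OF R mR zero])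
    have "component S 1 0 = component S m 0 + component S (y * f) 0"
      unfolding mf(1) by (rule comp_add[OF SS MS[OF mf(2)] subring_mult[OF B yS mf(3)]])
    moreover have "component S 1 0 = 1"
      using comp_of_homog[OF SS ext_degs[OF ext zero] one_part_zero[OF SS]] by simp
    moreover have "component S m 0 = m0" using ext_component[OF ext mR] by (simp add: m0_def)
    ultimately have "1 = m0 + component S (y * f) 0" by simp
    then have w: "1 - m0 = component S (y * f) 0" by (metis add_diff_cancel_left')
    have yhom: "y \<in> homog S" using y yS by (simp add: overring_homog[OF over R])
    \<comment> \<open>The ideal \<open>y S\<close> is generated by a homogeneous element, so it contains the component of \<open>y * f\<close>.\<close>
    let ?J = "{y * g | g. g \<in> elts S}"
    have "f \<in> aspan (homog S)" using mf(3) elts_eq_aspan[OF SS] by simp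
    then have "y * f \<in> aspan (?J \<inter> homog S)"
    proof (rule aspan_mult)
      fix g assume "g \<in> homog S"
      then show "y * g \<in> aspan (?J \<inter> homog S)"
        using homog_mult[OF SS yhom] homog_subset[OF SS] by (intro aspan_base) blast
    qed
    then have "component S (y * f) 0 \<in> ?J"
    proof (rule comp_closed[OF SS])
      have "0 = y * 0" by simp
      then show "0 \<in> ?J" using subring_0[OF B] by blast
      show "u + v \<in> ?J" if uv: "u \<in> ?J" "v \<in> ?J" for u v
      proof -
        obtain g h where "u = y * g" "v = y * h" "g \<in> elts S" "h \<in> elts S" using uv by blast
        moreover from this have "u + v = y * (g + h)" by (simp add: distrib_left)
        ultimately show ?thesis using subring_add[OF B] by blast
      qed
    qed
    then obtain g where g: "1 - m0 = y * g" "g \<in> elts S" using w by auto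
    have "1 - m0 \<in> homog R"
      using part_add[OF R zero one_part_zero[OF R] part_uminus[OF R zero m0p]] homogI[OF zero] by simp
    moreover have "1 - m0 \<notin> M" using ideal_add[OF MI(1) _ m0, of "1 - m0"] M(2) by auto
    ultimately obtain r where r: "r \<in> elts R" "(1 - m0) * r = 1"
      using homogeneous_unit[OF R _ _ Mmax] by blast
    have "y * (g * r) = 1" using r(2) unfolding g(1) by (simp add: mult.assoc)
    then show False using nonunit subring_mult[OF B g(2) ext_elts[OF ext r(1)]] by blast
  qed
  then have "\<exists>Q\<in>spec_h S. ?I \<inter> homog S \<subseteq> Q \<and> Q \<inter> {1} = {}"
    by (intro homogeneous_prime_exists[OF SS I]) (auto simp: subring_1[OF B])
  then obtain Q where Q: "Q \<in> spec_h S" "?I \<inter> homog S \<subseteq> Q" by (elim bexE conjE)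
  note QI = spec_ideal[OF SS Q(1)]
  have "M \<inter> homog R \<subseteq> Q"
  proof
    fix m assume m: "m \<in> M \<inter> homog R"
    then have "m \<in> ?I \<inter> homog S" using IM[of m] ext_homog[OF ext] by simp
    then show "m \<in> Q" using Q(2) by (rule subsetD[rotated])
  qed
  then have "P \<subseteq> Q" using PM MI(2) ideal_aspan[OF QI] by blast
  then obtain Q0 where Q0: "Q0 \<in> spec_h S" "Q0 \<inter> elts R = P"
    using gGD_overring[OF gd over P Q(1)] by blast
  have "b \<in> Q0" using b Q0(2) by blast
  then have "a \<in> Q0" unfolding ab by (rule ideal_mult[OF spec_ideal[OF SS Q0(1)] yS])
  then show False using a Q0(2) homog_subset[OF R] by blast
qed

text \<open>
  If \<open>a\<close> lies in \<open>P\<close> and \<open>b\<close> in \<open>Q\<close> but not in \<open>P\<close>, the fraction \<open>a / b\<close> is integral. Clearing denominators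
  in its equation makes a power of \<open>a\<close> divisible by \<open>b\<close>, and so \<open>a\<close> lies in \<open>Q\<close>.
\<close>

lemma gGD_spec_chain:
  assumes gd: "gGD_domain R" and max: "\<exists>!M. maximal_homogeneous_ideal R M"
    and P: "P \<in> spec_h R" and Q: "Q \<in> spec_h R"
  shows "P \<subseteq> Q \<or> Q \<subseteq> P"
proof (rule disjCI)
  have R: "graded_domain R" using gd by (simp add: gGD_domain_def)
  note A = graded_subring[OF R] and PI = spec_ideal[OF R P]
  assume "\<not> Q \<subseteq> P"
  then obtain b where b: "b \<in> Q" "b \<in> homog R" "b \<notin> P"
    using spec_homog_subset[OF R Q PI] by blast
  show "P \<subseteq> Q"
  proof (rule spec_homog_subset[OF R P spec_ideal[OF R Q]], rule subsetI)
    fix a assume a: "a \<in> P \<inter> homog R"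
    note QI = spec_ideal[OF R Q]
    have b0: "b \<noteq> 0" using b(3) ideal_0[OF PI] by blast
    have mem: "a \<in> elts R" "b \<in> elts R" using a b homog_subset[OF R] by blast+
    have "integral_over (elts R) (a / b)"
      using gGD_quotient_integral[OF gd max P, of a b] a b by blast
    then obtain n c where c: "\<And>i. c i \<in> elts R" "(a / b) ^ n + (\<Sum>i<n. c i * (a / b) ^ i) = 0"
      unfolding integral_over_iff_sum[OF A ideal_self[OF A]] by blast
    have "0 = b ^ n * ((a / b) ^ n + (\<Sum>i<n. c i * (a / b) ^ i))" using c(2) by simp
    also have "\<dots> = a ^ n + (\<Sum>i<n. c i * b ^ (n - i) * a ^ i)"
    proof -
      have "b ^ n * (c i * (a / b) ^ i) = c i * b ^ (n - i) * a ^ i" if "i < n" for i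
      proof -
        have "b ^ n = b ^ (n - i) * b ^ i" using that by (simp flip: power_add)
        then show ?thesis using b0 by (simp add: power_divide)
      qed
      then show ?thesis using b0 by (simp add: distrib_left sum_distrib_left power_divide)
    qed
    finally have "a ^ n = - (\<Sum>i<n. c i * b ^ (n - i) * a ^ i)" by (simp add: eq_neg_iff_add_eq_0)
    moreover have "c i * b ^ (n - i) * a ^ i \<in> Q" if i: "i < n" for i
    proof -
      have "b ^ (n - i) = b ^ (n - i - 1) * b" using i power_minus_mult[of "n - i" b] by simp
      then have eq: "c i * b ^ (n - i) * a ^ i = (c i * b ^ (n - i - 1) * a ^ i) * b" by (simp add: mult_ac)
      show ?thesis
        unfolding eq by (intro ideal_mult[OF QI] subring_mult[OF A] subring_power[OF A] c mem b)
    qed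
    ultimately have "a ^ n \<in> Q" by (simp only:) (intro ideal_uminus[OF A QI ideal_sum[OF QI]], simp)
    then show "a \<in> Q" by (rule spec_power[OF R Q mem(1)])
  qed
qed

text \<open>
  The second condition says that modulo each prime over \<open>P\<close> of an integral overring containing \<open>x\<close> the
  element \<open>x\<close> is the fraction \<open>r / s\<close> of elements of \<open>R\<close>, the same for all primes over \<open>P\<close>. Hence
  membership of \<open>x\<close> in such a prime is decided by \<open>r\<close>. Stating it with integrality over \<open>P\<close> instead of with
  primes makes closure under sums and products immediate.
\<close>

definition unibranched_element :: "('a::comm_ring_1, 'g) graded \<Rightarrow> 'a \<Rightarrow> bool" where
  "unibranched_element R x \<longleftrightarrow> integral_over (elts R) x \<and>
     (\<forall>P\<in>spec_h R. \<exists>s\<in>elts R - P. \<exists>r\<in>elts R. integral_over P (s * x - r))"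

lemma unibranched_element_base:
  assumes R: "graded_domain R" and x: "x \<in> elts R"
  shows "unibranched_element R x"
  unfolding unibranched_element_def
proof (intro conjI ballI)
  show "integral_over (elts R) x" by (rule integral_over_self[OF x])
  fix P assume P: "P \<in> spec_h R"
  have "integral_over P (1 * x - x)" using integral_over_0[OF spec_ideal[OF R P]] by simp
  moreover have "1 \<in> elts R - P" using spec_one[OF R P] subring_1[OF graded_subring[OF R]] by simp
  ultimately show "\<exists>s\<in>elts R - P. \<exists>r\<in>elts R. integral_over P (s * x - r)" using x by blast
qed

lemma unibranched_element_add:
  assumes R: "graded_domain R" and x: "unibranched_element R x" and y: "unibranched_element R y"
  shows "unibranched_element R (x + y)"
  unfolding unibranched_element_def
proof (intro conjI ballI)
  note A = graded_subring[OF R]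
  show "integral_over (elts R) (x + y)"
    using x y integral_over_add[OF A ideal_self[OF A]] by (simp add: unibranched_element_def)
  fix P assume P: "P \<in> spec_h R"
  note PI = spec_ideal[OF R P]
  obtain s r where s: "s \<in> elts R - P" "r \<in> elts R" "integral_over P (s * x - r)"
    using x P unfolding unibranched_element_def by blast
  obtain s' r' where s': "s' \<in> elts R - P" "r' \<in> elts R" "integral_over P (s' * y - r')"
    using y P unfolding unibranched_element_def by blast
  have "integral_over P ((s * x - r) * s' + (s' * y - r') * s)"
    using s(1) s'(1)
    by (intro integral_over_add[OF A PI] integral_over_mult[OF A PI s(3)] integral_over_mult[OF A PI s'(3)])
      (auto intro: integral_over_self)
  moreover have "(s * x - r) * s' + (s' * y - r') * s = (s * s') * (x + y) - (r * s' + r' * s)"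
    by (simp add: algebra_simps)
  moreover have "s * s' \<in> elts R - P" using s s' spec_prime[OF R P] subring_mult[OF A] by blast
  moreover have "r * s' + r' * s \<in> elts R" using s s' by (auto intro!: subring_add[OF A] subring_mult[OF A])
  ultimately show "\<exists>s\<in>elts R - P. \<exists>r\<in>elts R. integral_over P (s * (x + y) - r)" by metis
qed

lemma unibranched_element_mult:
  assumes R: "graded_domain R" and x: "unibranched_element R x" and y: "unibranched_element R y"
  shows "unibranched_element R (x * y)"
  unfolding unibranched_element_def
proof (intro conjI ballI)
  note A = graded_subring[OF R]
  have xy: "integral_over (elts R) x" "integral_over (elts R) y"
    using x y by (simp_all add: unibranched_element_def)
  then show "integral_over (elts R) (x * y)" using integral_over_mult[OF A ideal_self[OF A]] by blast
  fix P assume P: "P \<in> spec_h R"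
  note PI = spec_ideal[OF R P]
  obtain s r where s: "s \<in> elts R - P" "r \<in> elts R" "integral_over P (s * x - r)"
    using x P unfolding unibranched_element_def by blast
  obtain s' r' where s': "s' \<in> elts R - P" "r' \<in> elts R" "integral_over P (s' * y - r')"
    using y P unfolding unibranched_element_def by blast
  have "integral_over P ((s' * y - r') * (x * s) + (s * x - r) * r')"
    using s(1) s'(2)
    by (intro integral_over_add[OF A PI] integral_over_mult[OF A PI s(3)] integral_over_mult[OF A PI s'(3)]
        integral_over_mult[OF A ideal_self[OF A] xy(1)]) (auto intro: integral_over_self)
  moreover have "(s' * y - r') * (x * s) + (s * x - r) * r' = (s * s') * (x * y) - r * r'"
    by (simp add: algebra_simps)
  moreover have "s * s' \<in> elts R - P" using s s' spec_prime[OF R P] subring_mult[OF A] by blast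
  moreover have "r * r' \<in> elts R" using s s' by (auto intro!: subring_mult[OF A])
  ultimately show "\<exists>s\<in>elts R - P. \<exists>r\<in>elts R. integral_over P (s * (x * y) - r)" by metis
qed

lemma overring_overring_extension:
  assumes R: "graded_domain R" and T: "homogeneous_overring R T" and S: "homogeneous_overring R S"
    and "elts T \<subseteq> elts S"
  shows "graded_extension T S"
  using assms(4) overring_graded_domain[OF T R] overring_graded_domain[OF S R] overring_subring[OF T R]
  by (auto simp: graded_extension_def subring_ring_of[OF overring_subring[OF S R]] overring_degs[OF _ R]
      T S overring_part[OF T R] overring_part[OF S R] overring_degs[OF T R] overring_degs[OF S R])

text \<open>
  The span \<open>T\<close> of the homogeneous elements that satisfy the condition above is integral and unibranched.
  For dividedness let \<open>u\<close> lie in a prime \<open>Q\<close> of \<open>T\<close> and \<open>v\<close> outside it; then \<open>x = u / v\<close> has to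
  satisfy the condition again.

  Integrality of \<open>x\<close>: otherwise \<open>y = 1 / x\<close> lies in a homogeneous prime of \<open>R[y]\<close>, hence in one \<open>Q'\<close> of
  \<open>T[y]\<close>, which is integral over \<open>R[y]\<close>. Its contraction to \<open>R\<close> is comparable with \<open>P = Q \<inter> R\<close>. If it
  contains \<open>P\<close>, going down from \<open>Q'\<close> gives a prime over \<open>P\<close>, which contracts to \<open>Q\<close> and contains \<open>v = y u\<close>.
  If it is contained in \<open>P\<close>, going down from \<open>Q\<close> shows that \<open>Q' \<inter> T\<close>, which contains \<open>v\<close>, is inside \<open>Q\<close>.

  The condition at a prime \<open>P0\<close> of \<open>R\<close>: if \<open>P \<subseteq> P0\<close>, then \<open>x\<close> lies in all homogeneous primes of \<open>T[x]\<close>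
  containing \<open>P0\<close>, because going down to \<open>P\<close> gives a prime that contains \<open>u = x v\<close> but not \<open>v\<close>; so \<open>x\<close>
  itself is integral over \<open>P0\<close>. If \<open>P0 \<subseteq> P\<close>, then \<open>v\<close> is outside the prime over \<open>P0\<close>, and the fractions
  that represent \<open>u\<close> and \<open>v\<close> modulo \<open>P0\<close> can be divided.
\<close>

lemma gGD_divided_overring:
  assumes gd: "gGD_domain R" and max: "\<exists>!M. maximal_homogeneous_ideal R M"
  shows "\<exists>T. homogeneous_overring R T \<and> graded_divided T \<and> integral_extension R T \<and>
    homogeneous_unibranched R T"
proof -
  have R: "graded_domain R" using gd by (simp add: gGD_domain_def)
  note A = graded_subring[OF R] and H = hquot_graded_domain[OF R]
  note hH = ext_homog[OF hquot_extension[OF R]]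
  define G where "G = {x \<in> homog (hquot R). unibranched_element R x}"
  define T where "T = spanned_overring R G"
  have over: "homogeneous_overring R T"
    unfolding T_def
  proof (rule spanned_overring[OF R])
    show "G \<subseteq> homog (hquot R)" by (auto simp: G_def)
    show "homog R \<subseteq> G" using hH unibranched_element_base[OF R homog_subset[OF R]] by (auto simp: G_def)
    show "x * y \<in> G" if "x \<in> G" "y \<in> G" for x y
      using that homog_mult[OF H] unibranched_element_mult[OF R] by (auto simp: G_def)
  qed
  note ext = overring_extension[OF over R]
  note Tg = ext_top[OF ext]
  note B = graded_subring[OF Tg]
  have Telts: "elts T = aspan G" by (simp add: T_def)
  have good: "unibranched_element R t" if "t \<in> elts T" for t
    using that unfolding Telts
  proof induction
    case aspan_0
    then show ?case by (rule unibranched_element_base[OF R subring_0[OF A]])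
  next
    case (aspan_step x y)
    then show ?case by (auto simp: G_def intro: unibranched_element_add[OF R])
  qed
  have int: "integral_over (elts R) t" if "t \<in> elts T" for t
    using good[OF that] by (simp add: unibranched_element_def)
  have integral: "integral_extension R T" using int by (simp add: integral_extension_iff[OF A])
  have witness: "\<exists>s\<in>elts R - P. \<exists>r\<in>elts R. integral_over P (s * t - r) \<and>
      (\<forall>Q\<in>spec_h T. Q \<inter> elts R = P \<longrightarrow> (t \<in> Q \<longleftrightarrow> r \<in> P))"
    if t: "t \<in> elts T" and P: "P \<in> spec_h R" for t P
  proof -
    obtain s r where s: "s \<in> elts R" "s \<notin> P" "r \<in> elts R" "integral_over P (s * t - r)"
      using good[OF t] P unfolding unibranched_element_def by blast
    have "t \<in> Q \<longleftrightarrow> r \<in> P" if Q: "Q \<in> spec_h T" "Q \<inter> elts R = P" for Q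
    proof -
      note QI = spec_ideal[OF Tg Q(1)]
      have sT: "s \<in> elts T" and rT: "r \<in> elts T" using s ext_elts[OF ext] by auto
      have z: "s * t - r \<in> Q"
        using Q(2) by (intro integral_over_spec[OF Tg Q(1) s(4)] subring_diff[OF B] subring_mult[OF B] sT rT t) auto
      show ?thesis
      proof
        assume "t \<in> Q"
        then have "s * t - (s * t - r) \<in> Q" by (intro ideal_diff[OF B QI] ideal_mult[OF QI sT] z)
        then show "r \<in> P" using Q(2) s(3) by auto
      next
        assume "r \<in> P"
        then have "(s * t - r) + r \<in> Q" using Q(2) by (intro ideal_add[OF QI z]) auto
        then have "s * t \<in> Q" by simp
        then show "t \<in> Q" using spec_prime[OF Tg Q(1) sT t] Q(2) s(1,2) by blast
      qed
    qed
    then show ?thesis using s by blast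
  qed
  have unique: "Q = Q'" if Q: "Q \<in> spec_h T" "Q' \<in> spec_h T" "Q \<inter> elts R = Q' \<inter> elts R" for Q Q'
  proof -
    have "t \<in> Q \<longleftrightarrow> t \<in> Q'" if t: "t \<in> elts T" for t
      using witness[OF t spec_contraction[OF ext Q(1)]] Q by metis
    then show ?thesis
      using ideal_subset[OF spec_ideal[OF Tg Q(1)]] ideal_subset[OF spec_ideal[OF Tg Q(2)]] by blast
  qed
  have "(\<lambda>Q. Q \<inter> elts R) ` spec_h T = spec_h R"
    using spec_contraction[OF ext] integral_lying_over[OF ext int] by (auto simp: image_iff)
  then have uni: "homogeneous_unibranched R T"
    unfolding homogeneous_unibranched_def bij_betw_def using unique by (auto simp: inj_on_def)
  have lift: "\<exists>Q0\<in>spec_h S. Q0 \<subseteq> Q' \<and> Q0 \<inter> elts T = Q"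
    if S: "homogeneous_overring R S" "elts T \<subseteq> elts S" and Q: "Q \<in> spec_h T" and Q': "Q' \<in> spec_h S"
      and PQ: "Q \<inter> elts R \<subseteq> Q'" for S Q Q'
  proof -
    obtain Q0 where Q0: "Q0 \<in> spec_h S" "Q0 \<subseteq> Q'" "Q0 \<inter> elts R = Q \<inter> elts R"
      using gGD_overring[OF gd S(1) spec_contraction[OF ext Q] Q' PQ] by blast
    have "Q0 \<inter> elts T \<in> spec_h T"
      by (rule spec_contraction[OF overring_overring_extension[OF R over S] Q0(1)])
    moreover have "(Q0 \<inter> elts T) \<inter> elts R = Q \<inter> elts R" using Q0(3) ext_elts[OF ext] by blast
    ultimately have "Q0 \<inter> elts T = Q" using unique Q by blast
    then show ?thesis using Q0 by blast
  qed
  have homT: "homog T \<subseteq> homog (hquot R)" "homog R \<subseteq> homog T"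
    "\<And>x y. x \<in> homog T \<Longrightarrow> y \<in> homog T \<Longrightarrow> x * y \<in> homog T"
    using overring_homog[OF over R] ext_homog[OF ext] homog_mult[OF Tg] by auto
  have adjT: "homogeneous_overring R (spanned_overring R (adjoin (homog T) y))"
    "elts T \<subseteq> elts (spanned_overring R (adjoin (homog T) y))"
    "y \<in> elts (spanned_overring R (adjoin (homog T) y))"
    if y: "y \<in> homog (hquot R)" for y
    using adjoin_overring[OF R homT y] aspan_mono[OF adjoin_subset[of "homog T" y]] elts_eq_aspan[OF Tg]
      aspan_base[OF adjoin_gen[OF homog_1[OF Tg], of y]] by simp_all
  have quotient: "unibranched_element R (u / v)"
    if Q: "Q \<in> spec_h T" and u: "u \<in> homog T" "u \<in> Q" and v: "v \<in> homog T" "v \<notin> Q" for Q u v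
  proof (cases "u = 0")
    case True
    then show ?thesis using unibranched_element_base[OF R subring_0[OF A]] by simp
  next
    case u0: False
    define P where "P = Q \<inter> elts R"
    have P: "P \<in> spec_h R" unfolding P_def by (rule spec_contraction[OF ext Q])
    note QI = spec_ideal[OF Tg Q]
    have v0: "v \<noteq> 0" using v(2) ideal_0[OF QI] by blast
    have uT: "u \<in> elts T" and vT: "v \<in> elts T" using u v homog_subset[OF Tg] by auto
    define x where "x = u / v"
    have x: "x \<in> homog (hquot R)" and xi: "inverse x \<in> homog (hquot R)"
      using homog_hquot_divide[OF R, of u v] homog_hquot_divide[OF R, of v u] u(1) v(1) homT(1)
      by (auto simp: x_def)
    have x0: "x \<noteq> 0" using u0 v0 by (simp add: x_def)
    have ux: "u = x * v" and vx: "v = inverse x * u" using u0 v0 by (simp_all add: x_def)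
    have xint: "integral_over (elts R) x"
    proof (rule ccontr)
      assume no: "\<not> ?thesis"
      define y where "y = inverse x"
      have y: "y \<in> homog (hquot R)" using xi by (simp add: y_def)
      let ?W = "spanned_overring R (adjoin (homog R) y)" and ?S = "spanned_overring R (adjoin (homog T) y)"
      have over0: "homogeneous_overring R ?W"
        using hH homog_mult[OF R] y by (intro adjoin_overring[OF R, of "homog R"]) auto
      note S0 = overring_graded_domain[OF over0 R] and B0 = overring_subring[OF over0 R]
      have y0: "y \<in> elts ?W" using aspan_base[OF adjoin_gen[OF homog_1[OF R], of y]] by simp
      note overS = adjT(1)[OF y]
      have "elts ?W \<subseteq> elts ?S"
        using homT(2) by (simp, intro aspan_mono) (auto simp: adjoin_def)
      from overring_overring_extension[OF R over0 overS this]
      have extS: "graded_extension ?W ?S" .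
      note S = ext_top[OF extS]
      let ?I = "{y * f | f. f \<in> elts ?W}"
      have I: "is_ideal (elts ?W) ?I"
        unfolding is_ideal_def
      proof (intro conjI ballI)
        show "?I \<subseteq> elts ?W" using subring_mult[OF B0 y0] by blast
        have "0 = y * 0" by simp
        then show "0 \<in> ?I" using subring_0[OF B0] by blast
        show "a + b \<in> ?I" if ab: "a \<in> ?I" "b \<in> ?I" for a b
        proof -
          obtain g h where gh: "a = y * g" "b = y * h" "g \<in> elts ?W" "h \<in> elts ?W" using ab by blast
          have "a + b = y * (g + h)" by (simp add: gh distrib_left)
          then show ?thesis using subring_add[OF B0 gh(3,4)] by blast
        qed
        show "c * a \<in> ?I" if ca: "c \<in> elts ?W" "a \<in> ?I" for a c
        proof -
          obtain g where g: "a = y * g" "g \<in> elts ?W" using ca by blast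
          have "c * a = y * (c * g)" by (simp add: g mult_ac)
          then show ?thesis using subring_mult[OF B0 ca(1) g(2)] by blast
        qed
      qed
      have "1 \<notin> ?I"
      proof
        assume "1 \<in> ?I"
        then obtain f where f: "f \<in> elts ?W" "y * f = 1" by force
        then have "integral_over (aspan (homog R)) x"
          using x0 unfolding y_def by (intro integral_if_inverse_unit) auto
        then show False using no elts_eq_aspan[OF R] by simp
      qed
      then have "\<exists>N\<in>spec_h ?W. ?I \<inter> homog ?W \<subseteq> N \<and> N \<inter> {1} = {}"
        by (intro homogeneous_prime_exists[OF S0 I]) (auto simp: subring_1[OF B0] simp del: spanned_overring_elts)
      then obtain N where N: "N \<in> spec_h ?W" "?I \<inter> homog ?W \<subseteq> N" by (elim bexE conjE)
      have "y * 1 \<in> ?I" using subring_1[OF B0] by blast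
      moreover have "y \<in> homog ?W" using y y0 by (simp add: overring_homog[OF over0 R])
      ultimately have "y \<in> ?I \<inter> homog ?W" by simp
      then have yN: "y \<in> N" by (rule subsetD[OF N(2)])
      have intS: "integral_over (elts ?W) t" if "t \<in> elts ?S" for t
      proof -
        have "t \<in> aspan (adjoin (homog T) y)" using that by simp
        then show ?thesis
        proof induction
          case aspan_0
          then show ?case by (rule integral_over_0[OF ideal_self[OF B0]])
        next
          case (aspan_step a b)
          then obtain c n where a: "a = c * y ^ n" "c \<in> homog T" by (auto simp: adjoin_def)
          have "integral_over (elts ?W) c"
            using integral_over_mono[OF int[OF homog_subset[OF Tg a(2)]]] overring_base[OF over0 R] by blast
          then have "integral_over (elts ?W) a"
            unfolding a(1) using subring_power[OF B0 y0]
            by (intro integral_over_mult[OF B0 ideal_self[OF B0]] integral_over_self[of "y ^ n"])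
          then show ?case using integral_over_add[OF B0 ideal_self[OF B0] _ aspan_step.IH] by blast
        qed
      qed
      obtain Q' where Q': "Q' \<in> spec_h ?S" "Q' \<inter> elts ?W = N"
        using integral_lying_over[OF extS intS N(1)] by blast
      have yQ': "y \<in> Q'" using yN Q'(2) by blast
      note exRS = overring_extension[OF overS R]
      have P': "Q' \<inter> elts R \<in> spec_h R" by (rule spec_contraction[OF exRS Q'(1)])
      have "v \<in> Q"
        using gGD_spec_chain[OF gd max P P']
      proof
        assume "P \<subseteq> Q' \<inter> elts R"
        then obtain Q0 where Q0: "Q0 \<in> spec_h ?S" "Q0 \<inter> elts T = Q"
          using lift[OF overS adjT(2)[OF y] Q Q'(1)] unfolding P_def by blast
        have "u \<in> Q0" using u(2) Q0(2) by blast
        then have "y * u \<in> Q0" by (rule ideal_mult[OF spec_ideal[OF S Q0(1)] adjT(3)[OF y]])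
        then show ?thesis using vT Q0(2) vx by (auto simp: y_def)
      next
        assume sub: "Q' \<inter> elts R \<subseteq> P"
        have extT: "graded_extension T ?S"
          by (rule overring_overring_extension[OF R over overS adjT(2)[OF y]])
        have N': "Q' \<inter> elts T \<in> spec_h T" by (rule spec_contraction[OF extT Q'(1)])
        obtain Q1 where Q1: "Q1 \<in> spec_h T" "Q1 \<subseteq> Q" "Q1 \<inter> elts R = Q' \<inter> elts R"
          using gGD_overring[OF gd over P' Q] sub unfolding P_def by blast
        have "(Q' \<inter> elts T) \<inter> elts R = Q1 \<inter> elts R" using Q1(3) ext_elts[OF ext] by blast
        then have eq: "Q' \<inter> elts T = Q1" by (rule unique[OF N' Q1(1)])
        have "u * y \<in> Q'"
          using adjT(2)[OF y] uT by (intro ideal_mult[OF spec_ideal[OF S Q'(1)] _ yQ']) blast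
        then have "v \<in> Q' \<inter> elts T" using vT vx by (simp add: y_def mult.commute)
        then show ?thesis using eq Q1(2) by blast
      qed
      then show False using v(2) by blast
    qed
    \<comment> \<open>Here \<open>x = 0 / 1\<close> modulo \<open>P0\<close> if \<open>P \<subseteq> P0\<close>, and \<open>x = (s * r') / (s' * r)\<close> if \<open>P0 \<subseteq> P\<close>, where
      \<open>v = r / s\<close> and \<open>u = r' / s'\<close>.\<close>
    have "\<exists>s\<in>elts R - P0. \<exists>r\<in>elts R. integral_over P0 (s * x - r)" if P0: "P0 \<in> spec_h R" for P0
      using gGD_spec_chain[OF gd max P P0]
    proof
      note P0I = spec_ideal[OF R P0]
      assume PP0: "P \<subseteq> P0"
      have "integral_over P0 x"
      proof (rule ccontr)
        assume no: "\<not> ?thesis"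
        let ?S = "spanned_overring R (adjoin (homog T) x)"
        note overS = adjT(1)[OF x] and TS = adjT(2)[OF x] and xS = adjT(3)[OF x]
        note exRS = overring_extension[OF overS R]
        note S = ext_top[OF exRS]
        note BS = graded_subring[OF S]
        have intS: "integral_over (elts R) t" if "t \<in> elts ?S" for t
        proof -
          have "t \<in> aspan (adjoin (homog T) x)" using that by simp
          then show ?thesis
          proof induction
            case aspan_0
            then show ?case by (rule integral_over_0[OF ideal_self[OF A]])
          next
            case (aspan_step a b)
            then obtain c n where a: "a = c * x ^ n" "c \<in> homog T" by (auto simp: adjoin_def)
            have "integral_over (elts R) a"
              unfolding a(1)
              by (intro integral_over_mult[OF A ideal_self[OF A]] integral_over_power[OF A xint]
                  int homog_subset[OF Tg a(2)])
            then show ?case using integral_over_add[OF A ideal_self[OF A] _ aspan_step.IH] by blast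
          qed
        qed
        let ?I = "{t \<in> elts ?S. integral_over P0 t}" and ?M = "range (\<lambda>k. x ^ k)"
        have P0S: "P0 \<subseteq> elts ?S" using ideal_subset[OF P0I] ext_elts[OF exRS] by blast
        have I: "is_ideal (elts ?S) ?I" by (rule integral_ideal[OF A P0I BS intS P0S])
        have "\<not> integral_over P0 (x ^ k)" for k
          using no integral_over_root[of P0 x k] integral_over_spec[OF R P0, of P0 1] spec_one[OF R P0] subring_1[OF A]
          by (cases "k = 0") auto
        then have "?I \<inter> ?M = {}" by blast
        moreover have "a * b \<in> ?M" if "a \<in> ?M" "b \<in> ?M" for a b
          using that by (auto simp flip: power_add)
        moreover have "1 \<in> ?M" by (metis power_0 rangeI)
        moreover have "?M \<subseteq> elts ?S" using subring_power[OF BS xS] by blast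
        ultimately have "\<exists>Q'\<in>spec_h ?S. ?I \<inter> homog ?S \<subseteq> Q' \<and> Q' \<inter> ?M = {}"
          by (intro homogeneous_prime_exists[OF S I])
        then obtain Q' where Q': "Q' \<in> spec_h ?S" "?I \<inter> homog ?S \<subseteq> Q'" "Q' \<inter> ?M = {}"
          by (elim bexE conjE)
        have xQ': "x \<notin> Q'" using Q'(3) by (metis disjoint_iff power_one_right rangeI)
        have "P0 \<subseteq> Q'"
        proof (rule spec_homog_subset[OF R P0 spec_ideal[OF S Q'(1)]], rule subsetI)
          fix p assume p: "p \<in> P0 \<inter> homog R"
          then have "p \<in> ?I \<inter> homog ?S" using P0S ext_homog[OF exRS, of p] integral_over_self[of p P0] by blast
          then show "p \<in> Q'" by (rule subsetD[OF Q'(2)])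
        qed
        then obtain Q0 where Q0: "Q0 \<in> spec_h ?S" "Q0 \<subseteq> Q'" "Q0 \<inter> elts T = Q"
          using lift[OF overS TS Q Q'(1)] PP0 unfolding P_def by blast
        have "x * v \<in> Q0" using u(2) Q0(3) ux by auto
        moreover have "v \<in> elts ?S" using vT TS by blast
        moreover have "v \<notin> Q0" using v(2) vT Q0(3) by blast
        ultimately have "x \<in> Q0" using spec_prime[OF S Q0(1) xS, of v] by blast
        then show False using xQ' Q0(2) by blast
      qed
      then show ?thesis
        using spec_one[OF R P0] subring_1[OF A] subring_0[OF A]
        by (intro bexI[of _ 1] bexI[of _ 0]) auto
    next
      note P0I = spec_ideal[OF R P0]
      assume P0P: "P0 \<subseteq> P"
      obtain Q0 where Q0: "Q0 \<in> spec_h T" "Q0 \<subseteq> Q" "Q0 \<inter> elts R = P0"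
        using gGD_overring[OF gd over P0 Q] P0P unfolding P_def by blast
      obtain s r where s: "s \<in> elts R - P0" "r \<in> elts R" "integral_over P0 (s * v - r)" "v \<in> Q0 \<longleftrightarrow> r \<in> P0"
        using witness[OF vT P0] Q0(1,3) by blast
      obtain s' r' where s': "s' \<in> elts R - P0" "r' \<in> elts R" "integral_over P0 (s' * u - r')"
        using witness[OF uT P0] by blast
      have "r \<notin> P0" using s(4) Q0(2) v(2) by blast
      then have "s' * r \<in> elts R - P0"
        using s(2) s'(1) spec_prime[OF R P0] subring_mult[OF A] by blast
      moreover have "s * r' \<in> elts R" using s(1) s'(2) by (auto intro: subring_mult[OF A])
      moreover have "integral_over P0 ((s' * u - r') * s - (s * v - r) * (s' * x))"
        using s(1) s'(1)
        by (intro integral_over_diff[OF A P0I] integral_over_mult[OF A P0I s(3)] integral_over_mult[OF A P0I s'(3)]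
            integral_over_mult[OF A ideal_self[OF A] _ xint]) (auto intro: integral_over_self)
      moreover have "(s' * u - r') * s - (s * v - r) * (s' * x) = (s' * r) * x - s * r'"
        unfolding ux by (simp add: algebra_simps)
      ultimately show ?thesis by metis
    qed
    then show ?thesis using xint by (simp add: unibranched_element_def x_def)
  qed
  have "graded_divided T"
    unfolding graded_divided_def homogeneous_divided_def
  proof (intro conjI ballI)
    fix Q v u assume Q: "Q \<in> spec_h T" and v: "v \<in> nz_homog T - Q" and u: "u \<in> homog T \<inter> Q"
    have v0: "v \<noteq> 0" "v \<in> homog T" using v by (auto simp: nz_homog_def)
    have "u / v \<in> G"
      using quotient[OF Q, of u v] u v v0 homog_hquot_divide[OF R, of u v] homT(1) by (auto simp: G_def)
    then have "u / v \<in> elts T" unfolding Telts by (rule aspan_base)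
    moreover have "u = v * (u / v)" using v0 by simp
    ultimately show "v divides\<^bsub>ring_of T\<^esub> u" unfolding factor_def ring_of_simps by blast
  qed (rule Tg)
  then show ?thesis using over integral uni by blast
qed

lemma overring_divided_extension:
  fixes R T :: "('a::field, 'g::ab_group_add) graded"
  assumes R: "graded_domain R" and T: "homogeneous_overring R T" "graded_divided T"
    "integral_extension R T" "homogeneous_unibranched R T"
  shows "has_divided_extension R TYPE(('a, 'g) graded)"
proof -
  have "graded_isomorphic R R"
    unfolding graded_isomorphic_def
    by (rule exI[of _ id], rule exI[of _ id]) (auto simp: ring_iso_def ring_hom_def)
  then show ?thesis
    unfolding has_divided_extension_def using overring_extension[OF T(1) R] T(2-) by blast
qed

theorem theorem4p7:
  fixes R :: "('a::field, 'g::ab_group_add) graded"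
  assumes "graded_domain R"
    and "\<exists>!M. maximal_homogeneous_ideal R M"
  shows
    "(gGD_domain R \<longleftrightarrow>
        (\<exists>T. homogeneous_overring R T \<and> graded_divided T \<and>
             integral_extension R T \<and> homogeneous_unibranched R T)) \<and>
     (gGD_domain R \<longleftrightarrow> has_divided_extension R TYPE(('a, 'g) graded)) \<and>
     (has_divided_extension R TYPE(('b::comm_ring_1, 'l::comm_monoid_add) graded) \<longrightarrow>
        gGD_domain R)"
proof -
  have "\<exists>T. homogeneous_overring R T \<and> graded_divided T \<and> integral_extension R T \<and>
      homogeneous_unibranched R T" if "gGD_domain R"
    by (rule gGD_divided_overring[OF that assms(2)])
  moreover have "has_divided_extension R TYPE(('a, 'g) graded)"
    if "\<exists>T. homogeneous_overring R T \<and> graded_divided T \<and> integral_extension R T \<and>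
      homogeneous_unibranched R T"
    using that overring_divided_extension[OF assms(1)] by blast
  moreover have "gGD_domain R" if "has_divided_extension R TYPE(('a, 'g) graded)"
    using assms(1) that by (rule divided_extension_gGD)
  moreover have "gGD_domain R" if "has_divided_extension R TYPE(('b, 'l) graded)"
    using assms(1) that by (rule divided_extension_gGD)
  ultimately show ?thesis by blast
qed

end
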